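(* Let $d\ge1$, $p>0$, $\alpha\in(0,2)$, $T>0$, and let $\sigma$, $Q(\cdot\mid u)$, $M$, $Q$ be as in the context. Let $\{E_j\},\{E'_j\},\Gamma_j,\{T_j\},\{U_j\},\{V_j\}$ be as follows: $\{E_j\},\{E'_j\}$ i.i.d. standard exponential, $\Gamma_j=E'_1+\cdots+E'_j$, $\{T_j\}$ i.i.d. uniform on $(0,T)$, $\{U_j\}$ i.i.d. uniform on $(0,1)$, $\{V_j\}$ i.i.d. with law $Q/\|\sigma\|$, all independent. For $s>0$, $v\in\mathbb{R}^d\setminus\{0\}$, $e>0$, $u'\in(0,1)$ put $$H(s;(v,e,u')):=\left(\left(\frac{\alpha s}{\|\sigma\|T}\right)^{-1/\alpha}\wedge\frac{e^{1/p}u'^{1/\alpha}}{\|v\|^{1/p}}\right)\frac{v}{\|v\|}.$$ For $n\in\mathbb{N}$ define $$L^{(n)}_t:=\sum_{j:\,\Gamma_j\le Tn}\mathbf{1}_{(0,t]}(T_j)\,H(\Gamma_j;(V_j,E_j,U_j))-\frac{t}{T}\,\mathbb{E}\bigl[H(\Gamma_j;(V_j,E_j,U_j))\bigr],\qquad t\in[0,T]$$ (the last term being a deterministic linear centering). Then $L^{(n)}$ is a compound Poisson process with no Gaussian part whose Lévy measure $M_n$ satisfies, for every $x>0$ and $B\in\mathcal{B}(\mathbb{S}^{d-1})$, $$M_n\bigl((x,\infty)B\bigr)=\left(\frac{n\alpha}{\|\sigma\|}x^{\alpha}\wedge 1\right)M\bigl((x,\infty)B\bigr),$$ and consequently the Lévy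 measures $M_n$ converge to $M$ as $n\to\infty$.
   Context: $\mathbb{S}^{d-1}$ is the unit sphere in $\mathbb{R}^d$; $\sigma$ is a finite nonzero Borel measure on it with $\|\sigma\|:=\sigma(\mathbb{S}^{d-1})$; $\{Q(\cdot\mid u)\}_{u\in\mathbb{S}^{d-1}}$ is a measurable family of Borel probability measures on $(0,\infty)$ and $q(r,u):=\int_{(0,\infty)}e^{-rs}Q(ds\mid u)$. The Lévy measure of the proper $p$-tempered $\alpha$-stable distribution is $M(A):=\int_{\mathbb{S}^{d-1}}\int_0^\infty\mathbf{1}_A(ru)\,q(r^p,u)\,r^{-\alpha-1}\,dr\,\sigma(du)$, and $Q(A):=\int_{\mathbb{S}^{d-1}}\int_{(0,\infty)}\mathbf{1}_A(su)\,Q(ds\mid u)\,\sigma(du)$ for Borel $A\subset\mathbb{R}^d$. For $x>0$ and $B\in\mathcal{B}(\mathbb{S}^{d-1})$, $(x,\infty)B:=\{ru:\ r>x,\ u\in B\}$. *)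

theory Defs
  imports "HOL-Probability.Probability"
begin

definition qfun :: "('a \<Rightarrow> real measure) \<Rightarrow> real \<Rightarrow> 'a \<Rightarrow> real" where
  "qfun Qk r u = (\<integral>s. exp (- r * s) \<partial>(Qk u))"

definition levyM :: "real \<Rightarrow> real \<Rightarrow> 'a::euclidean_space measure \<Rightarrow> ('a \<Rightarrow> real measure) \<Rightarrow> 'a measure" where
  "levyM p \<alpha> \<sigma> Qk = measure_of UNIV (sets borel)
     (\<lambda>A. \<integral>\<^sup>+u. (\<integral>\<^sup>+r. indicator {0<..} r * indicator A (r *\<^sub>R u)
              * ennreal (qfun Qk (r powr p) u * r powr (- \<alpha> - 1)) \<partial>lborel) \<partial>\<sigma>)"

definition Qmeas :: "'a::euclidean_space measure \<Rightarrow> ('a \<Rightarrow> real measure) \<Rightarrow> 'a measure" where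
  "Qmeas \<sigma> Qk = measure_of UNIV (sets borel)
     (\<lambda>A. \<integral>\<^sup>+u. emeasure (Qk u) {s. 0 < s \<and> s *\<^sub>R u \<in> A} \<partial>\<sigma>)"

definition radial_set :: "real \<Rightarrow> 'a::real_vector set \<Rightarrow> 'a set" where
  "radial_set x B = {r *\<^sub>R u | r u. x < r \<and> u \<in> B}"

text \<open>H(s;(v,e,u')); sn stands for the total mass of sigma.\<close>
definition Hfun :: "real \<Rightarrow> real \<Rightarrow> real \<Rightarrow> real \<Rightarrow> real \<Rightarrow> 'a::real_normed_vector \<Rightarrow> real \<Rightarrow> real \<Rightarrow> 'a" where
  "Hfun sn T \<alpha> p s v e u' =
     (min ((\<alpha> * s / (sn * T)) powr (- 1 / \<alpha>)) (e powr (1 / p) * u' powr (1 / \<alpha>) / norm v powr (1 / p)))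
       *\<^sub>R (v /\<^sub>R norm v)"

text \<open>Gamma_j = E'_1 + ... + E'_j (indices shifted to start at 0).\<close>
definition Gam :: "(nat \<Rightarrow> 'w \<Rightarrow> real) \<Rightarrow> nat \<Rightarrow> 'w \<Rightarrow> real" where
  "Gam E' j \<omega> = (\<Sum>i\<le>j. E' i \<omega>)"

definition Lsum :: "real \<Rightarrow> real \<Rightarrow> real \<Rightarrow> real \<Rightarrow> nat \<Rightarrow> (nat \<Rightarrow> 'w \<Rightarrow> real) \<Rightarrow> (nat \<Rightarrow> 'w \<Rightarrow> real)
      \<Rightarrow> (nat \<Rightarrow> 'w \<Rightarrow> real) \<Rightarrow> (nat \<Rightarrow> 'w \<Rightarrow> real) \<Rightarrow> (nat \<Rightarrow> 'w \<Rightarrow> 'a::real_normed_vector) \<Rightarrow> real \<Rightarrow> 'w \<Rightarrow> 'a" where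
  "Lsum sn T \<alpha> p n E E' Tt U V t \<omega> =
     (\<Sum>j\<in>{j. Gam E' j \<omega> \<le> T * real n}.
        indicator {0<..t} (Tt j \<omega>) *\<^sub>R Hfun sn T \<alpha> p (Gam E' j \<omega>) (V j \<omega>) (E j \<omega>) (U j \<omega>))"

definition Lproc :: "'w measure \<Rightarrow> real \<Rightarrow> real \<Rightarrow> real \<Rightarrow> real \<Rightarrow> nat \<Rightarrow> (nat \<Rightarrow> 'w \<Rightarrow> real) \<Rightarrow> (nat \<Rightarrow> 'w \<Rightarrow> real)
      \<Rightarrow> (nat \<Rightarrow> 'w \<Rightarrow> real) \<Rightarrow> (nat \<Rightarrow> 'w \<Rightarrow> real) \<Rightarrow> (nat \<Rightarrow> 'w \<Rightarrow> 'a::euclidean_space) \<Rightarrow> real \<Rightarrow> 'w \<Rightarrow> 'a" where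
  "Lproc P sn T \<alpha> p n E E' Tt U V t \<omega> =
     Lsum sn T \<alpha> p n E E' Tt U V t \<omega>
     - (t / T) *\<^sub>R (\<integral>\<omega>'. (\<Sum>j\<in>{j. Gam E' j \<omega>' \<le> T * real n}.
            Hfun sn T \<alpha> p (Gam E' j \<omega>') (V j \<omega>') (E j \<omega>') (U j \<omega>')) \<partial>P)"

text \<open>X on [0,T] is a compound Poisson process (Levy process with triplet (b,0,nu),
  nu a finite measure without atom at 0): cadlag paths a.s., X_0 = 0 a.s., independent
  increments, and increment characteristic functions
  E exp(i z.(X_t - X_s)) = exp((t-s)(int (e^{i z.x} - 1) nu(dx) + i z.b)).\<close>
definition compound_poisson_process ::
  "'w measure \<Rightarrow> real \<Rightarrow> (real \<Rightarrow> 'w \<Rightarrow> 'a::euclidean_space) \<Rightarrow> 'a measure \<Rightarrow> 'a \<Rightarrow> bool" where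
  "compound_poisson_process P T X \<nu> b \<longleftrightarrow>
     prob_space P \<and> finite_measure \<nu> \<and> sets \<nu> = sets borel \<and> emeasure \<nu> {0} = 0 \<and>
     (\<forall>t\<in>{0..T}. X t \<in> borel_measurable P) \<and>
     (AE \<omega> in P. X 0 \<omega> = 0) \<and>
     (AE \<omega> in P. (\<forall>t\<in>{0..<T}. ((\<lambda>s. X s \<omega>) \<longlongrightarrow> X t \<omega>) (at_right t)) \<and>
                  (\<forall>t\<in>{0<..T}. \<exists>l. ((\<lambda>s. X s \<omega>) \<longlongrightarrow> l) (at_left t))) \<and>
     (\<forall>k (\<tau>::nat \<Rightarrow> real). 0 \<le> \<tau> 0 \<and> (\<forall>i<k. \<tau> i \<le> \<tau> (Suc i)) \<and> \<tau> k \<le> T \<longrightarrow>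
        prob_space.indep_vars P (\<lambda>_. borel) (\<lambda>i \<omega>. X (\<tau> (Suc i)) \<omega> - X (\<tau> i) \<omega>) {..<k}) \<and>
     (\<forall>s t z. 0 \<le> s \<and> s \<le> t \<and> t \<le> T \<longrightarrow>
        (\<integral>\<omega>. cis (z \<bullet> (X t \<omega> - X s \<omega>)) \<partial>P) =
          exp (complex_of_real (t - s) *
               ((\<integral>x. (cis (z \<bullet> x) - 1) \<partial>\<nu>) + \<i> * complex_of_real (z \<bullet> b))))"

definition levy_measures_converge :: "(nat \<Rightarrow> 'a::euclidean_space measure) \<Rightarrow> 'a measure \<Rightarrow> bool" where
  "levy_measures_converge Mn M \<longleftrightarrow>
     (\<forall>f :: 'a \<Rightarrow> real. continuous_on UNIV f \<and> bounded (range f) \<and>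
        (\<exists>\<delta>>0. \<forall>x. norm x < \<delta> \<longrightarrow> f x = 0) \<longrightarrow>
        (\<lambda>n. \<integral>x. f x \<partial>(Mn n)) \<longlonglongrightarrow> (\<integral>x. f x \<partial>M))"

end

theory Submission
  imports Defs
begin

text \<open>
  The points \<open>\<Gamma>\<^sub>j\<close> form a unit rate Poisson process with independent marks, so
  for \<open>\<bar>g\<bar> \<le> 1\<close> with mean \<open>\<gamma>(s)\<close> at time \<open>s\<close> the expectation of the product of the
  \<open>g(\<Gamma>\<^sub>j, mark\<^sub>j)\<close> over \<open>\<Gamma>\<^sub>j \<le> c\<close> is the exponential of the integral of \<open>\<gamma> - 1\<close> over \<open>[0,c]\<close>.
  Taking for \<open>g\<close> the character of several increments at once, and using that the time windows are
  disjoint, the joint characteristic function of the increments factorizes into compound Poisson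
  characteristic functions with Levy measure \<open>M\<^sub>n(A) = 1/T \<integral>\<^sub>0\<^bsup>Tn\<^esup> P(H(s; V, E, U) \<in> A) ds\<close>, and
  independence follows from the uniqueness theorem.

  The norm of \<open>H(s; v, e, u)\<close> exceeds \<open>x\<close> iff both terms of the minimum do. The first condition
  concerns \<open>s\<close> only and contributes \<open>min (n, \<parallel>\<sigma>\<parallel> x\<^bsup>-\<alpha>\<^esup> / \<alpha>)\<close>. For the second one, \<open>x U\<^bsup>-1/\<alpha>\<^esup>\<close> is
  Pareto distributed with density \<open>\<alpha> x\<^bsup>\<alpha>\<^esup> r\<^bsup>-\<alpha>-1\<^esup>\<close> on \<open>(x, \<infinity>)\<close> and \<open>P(E > r\<^bsup>p\<^esup> s) = exp (-r\<^bsup>p\<^esup> s)\<close>,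
  which yields \<open>\<alpha> x\<^bsup>\<alpha>\<^esup> / \<parallel>\<sigma>\<parallel>\<close> times the mass of \<open>(x, \<infinity>)B\<close> under \<open>M\<close>. Hence \<open>M\<^sub>n\<close> and \<open>M\<close> coincide
  outside any given ball around the origin as soon as \<open>n\<close> is large enough.
\<close>

section \<open>Independence from characteristic functions\<close>

text \<open>The product formula is not obtained by conditioning on the number of points, but from
  the gaps between them. The exponential solves a renewal equation, found by conditioning on the
  next gap and its mark; hence the product of the factors seen so far, times the predicted value of
  the remaining ones, has constant mean, and almost surely the arrival times eventually pass c. The
  first term of the minimum in H explodes as s tends to 0. The mean \<gamma> is therefore only known
  to be continuous for s > 0, and the renewal equation is integrated by a form of the fundamental
  theorem that asks for derivatives in the interior only. The uniqueness theorem is applied in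
  dimension one: a bounded weight orthogonal to all characters of a variable is orthogonal to all
  its indicators. Characters can thus be traded for indicators, one coordinate and one variable at a
  time. M is infinite near the origin whereas M_n has total mass n, so the two are compared as
  finite measures outside a ball, in polar coordinates. The centering is a fixed vector times t and
  affects the drift alone.\<close>

lemma borel_measurable_cis [measurable]:
  assumes [measurable]: "f \<in> borel_measurable M"
  shows "(\<lambda>x. cis (f x)) \<in> borel_measurable M"
proof -
  have "cis \<in> borel_measurable borel"
    by (intro borel_measurable_continuous_onI continuous_intros)
  then show ?thesis by measurable
qed

lemma borel_measurable_cnj [measurable]:
  assumes [measurable]: "f \<in> borel_measurable M"
  shows "(\<lambda>x. cnj (f x)) \<in> borel_measurable M"
proof -
  have "cnj \<in> borel_measurable borel"
    by (intro borel_measurable_continuous_onI continuous_intros)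
  then show ?thesis by measurable
qed

text \<open>Since \<open>\<bar>W\<bar> \<le> 1\<close>, the density \<open>1 + W\<close> defines a probability measure under which \<open>X\<close> has the
  same characteristic function as under the original one.\<close>

lemma (in prob_space) real_weighted_char_eq_0_imp:
  fixes X W :: "'a \<Rightarrow> real"
  assumes X[measurable]: "random_variable borel X" and W[measurable]: "random_variable borel W"
    and bound: "\<And>\<omega>. \<bar>W \<omega>\<bar> \<le> 1"
    and zero: "\<And>t. (\<integral>\<omega>. W \<omega> *\<^sub>R cis (t * X \<omega>) \<partial>M) = 0"
    and A[measurable]: "A \<in> sets borel"
  shows "(\<integral>\<omega>. W \<omega> * indicator A (X \<omega>) \<partial>M) = 0"
proof -
  define N where "N = density M (\<lambda>\<omega>. ennreal (1 + W \<omega>))"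
  have pos: "0 \<le> 1 + W \<omega>" for \<omega> using bound[of \<omega>] by linarith
  have intW: "integrable M W"
    by (rule integrable_const_bound[where B=1]) (use bound in auto)
  have intWc: "integrable M (\<lambda>\<omega>. W \<omega> *\<^sub>R cis (t * X \<omega>))" for t
    by (rule integrable_const_bound[where B=1]) (use bound in \<open>auto simp: norm_mult\<close>)
  have intc: "integrable M (\<lambda>\<omega>. cis (t * X \<omega>))" for t
    by (rule integrable_const_bound[where B=1]) auto
  \<comment> \<open>Frequency 0 shows that \<open>W\<close> has mean zero, which normalises
    \<open>N\<close>.\<close>
  have "of_real (\<integral>\<omega>. W \<omega> \<partial>M) = (0::complex)"
    using zero[of 0] by (simp add: scaleR_conv_of_real flip: integral_complex_of_real)
  then have W0: "(\<integral>\<omega>. W \<omega> \<partial>M) = 0" by simp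
  have "emeasure N (space N) = (\<integral>\<^sup>+\<omega>. ennreal (1 + W \<omega>) \<partial>M)"
    unfolding N_def by (subst emeasure_density) (auto intro!: nn_integral_cong)
  also have "\<dots> = ennreal (\<integral>\<omega>. 1 + W \<omega> \<partial>M)"
    using pos intW by (intro nn_integral_eq_integral) auto
  also have "\<dots> = 1" using intW W0 by (simp add: prob_space)
  finally interpret N: prob_space N by (intro prob_spaceI)
  have XN[measurable]: "X \<in> borel_measurable N" unfolding N_def by simp
  have "char (distr N borel X) t = char (distr M borel X) t" for t
  proof -
    have "char (distr N borel X) t = (\<integral>\<omega>. cis (t * X \<omega>) \<partial>N)"
      unfolding char_def by (subst integral_distr) (auto simp: cis_conv_exp)
    also have "\<dots> = (\<integral>\<omega>. (1 + W \<omega>) *\<^sub>R cis (t * X \<omega>) \<partial>M)"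
      unfolding N_def using pos by (subst integral_density) auto
    also have "\<dots> = (\<integral>\<omega>. cis (t * X \<omega>) \<partial>M)"
      using zero[of t] intc[of t] intWc[of t] by (simp add: scaleR_left_distrib)
    also have "\<dots> = char (distr M borel X) t"
      unfolding char_def by (subst integral_distr) (auto simp: cis_conv_exp)
    finally show ?thesis .
  qed
  then have eq: "distr N borel X = distr M borel X"
    by (intro Levy_uniqueness N.real_distribution_distr real_distribution_distr) auto
  have intA: "integrable M (\<lambda>\<omega>. indicator A (X \<omega>) :: real)"
    by (rule integrable_const_bound[where B=1]) auto
  have intWA: "integrable M (\<lambda>\<omega>. W \<omega> * indicator A (X \<omega>))"
    by (rule integrable_const_bound[where B=1]) (use bound in \<open>auto simp: indicator_def\<close>)
  have "(\<integral>\<omega>. indicator A (X \<omega>) \<partial>M) = (\<integral>x. indicator A x \<partial>distr M borel X :: real)"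
    by (subst integral_distr) auto
  also have "\<dots> = (\<integral>\<omega>. indicator A (X \<omega>) \<partial>N)"
    unfolding eq[symmetric] by (subst integral_distr) auto
  also have "\<dots> = (\<integral>\<omega>. (1 + W \<omega>) *\<^sub>R indicator A (X \<omega>) \<partial>M)"
    unfolding N_def using pos by (subst integral_density) auto
  also have "\<dots> = (\<integral>\<omega>. indicator A (X \<omega>) \<partial>M) + (\<integral>\<omega>. W \<omega> * indicator A (X \<omega>) \<partial>M)"
    using intA intWA by (simp add: distrib_right)
  finally show ?thesis by simp
qed

text \<open>Conjugating and replacing t by -t shows that \<open>cnj W\<close> is orthogonal to all
  characters as well. Hence so are the real and imaginary parts, and the real case applies to each
  after scaling.\<close>

lemma (in prob_space) complex_weighted_char_eq_0_imp:
  fixes X :: "'a \<Rightarrow> real" and W :: "'a \<Rightarrow> complex"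
  assumes X[measurable]: "random_variable borel X" and W[measurable]: "random_variable borel W"
    and bound: "\<And>\<omega>. norm (W \<omega>) \<le> C"
    and zero: "\<And>t. (\<integral>\<omega>. W \<omega> * cis (t * X \<omega>) \<partial>M) = 0"
    and A[measurable]: "A \<in> sets borel"
  shows "(\<integral>\<omega>. W \<omega> * indicator A (X \<omega>) \<partial>M) = 0"
proof -
  \<comment> \<open>The maximum with 1 makes the scaling constant strictly positive.\<close>
  define D where "D = max C 1"
  have D: "D > 0" "norm (W \<omega>) \<le> D" for \<omega> using bound[of \<omega>] unfolding D_def by auto
  have int: "integrable M (\<lambda>\<omega>. W \<omega> * cis (t * X \<omega>))" for t
    by (rule integrable_const_bound[where B=D]) (use D in \<open>auto simp: norm_mult\<close>)
  have int': "integrable M (\<lambda>\<omega>. cnj (W \<omega>) * cis (t * X \<omega>))" for t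
    by (rule integrable_const_bound[where B=D]) (use D in \<open>auto simp: norm_mult\<close>)
  have cnj0: "(\<integral>\<omega>. cnj (W \<omega>) * cis (t * X \<omega>) \<partial>M) = 0" for t
  proof -
    have "(\<integral>\<omega>. cnj (W \<omega>) * cis (t * X \<omega>) \<partial>M) = (\<integral>\<omega>. cnj (W \<omega> * cis (- t * X \<omega>)) \<partial>M)"
      by (simp add: cis_cnj)
    also have "\<dots> = cnj (\<integral>\<omega>. W \<omega> * cis (- t * X \<omega>) \<partial>M)"
      by (rule integral_bounded_linear[OF bounded_linear_cnj int])
    finally show ?thesis using zero[of "- t"] by simp
  qed
  have Re: "(\<integral>\<omega>. (Re (W \<omega>) / D) * indicator A (X \<omega>) \<partial>M) = 0"
  proof (rule real_weighted_char_eq_0_imp)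
    show "\<bar>Re (W \<omega>) / D\<bar> \<le> 1" for \<omega>
      using D(1) order_trans[OF abs_Re_le_cmod D(2)[of \<omega>]] by simp
    have "(Re (W \<omega>) / D) *\<^sub>R cis (t * X \<omega>)
      = (W \<omega> * cis (t * X \<omega>) + cnj (W \<omega>) * cis (t * X \<omega>)) / of_real (2 * D)" for t \<omega>
    proof -
      have "W \<omega> * cis (t * X \<omega>) + cnj (W \<omega>) * cis (t * X \<omega>) = (2 * Re (W \<omega>)) * cis (t * X \<omega>)"
        by (simp only: complex_add_cnj distrib_right[symmetric] of_real_mult of_real_numeral)
      then show ?thesis using D(1) by (simp add: scaleR_conv_of_real field_simps)
    qed
    then show "(\<integral>\<omega>. (Re (W \<omega>) / D) *\<^sub>R cis (t * X \<omega>) \<partial>M) = 0" for t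
      using int[of t] int'[of t] zero[of t] cnj0[of t] by simp
  qed auto
  have Im: "(\<integral>\<omega>. (Im (W \<omega>) / D) * indicator A (X \<omega>) \<partial>M) = 0"
  proof (rule real_weighted_char_eq_0_imp)
    show "\<bar>Im (W \<omega>) / D\<bar> \<le> 1" for \<omega>
      using D(1) order_trans[OF abs_Im_le_cmod D(2)[of \<omega>]] by simp
    have "(Im (W \<omega>) / D) *\<^sub>R cis (t * X \<omega>)
      = (W \<omega> * cis (t * X \<omega>) - cnj (W \<omega>) * cis (t * X \<omega>)) / (of_real (2 * D) * \<i>)" for t \<omega>
    proof -
      have "W \<omega> * cis (t * X \<omega>) - cnj (W \<omega>) * cis (t * X \<omega>) = (2 * Im (W \<omega>)) * \<i> * cis (t * X \<omega>)"
        by (simp only: complex_diff_cnj left_diff_distrib[symmetric])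
      then show ?thesis using D(1) by (simp add: scaleR_conv_of_real field_simps)
    qed
    then show "(\<integral>\<omega>. (Im (W \<omega>) / D) *\<^sub>R cis (t * X \<omega>) \<partial>M) = 0" for t
      using int[of t] int'[of t] zero[of t] cnj0[of t] by simp
  qed auto
  have intA: "integrable M (\<lambda>\<omega>. W \<omega> * indicator A (X \<omega>))"
    by (rule integrable_const_bound[where B=D])
       (use D in \<open>auto simp: norm_mult indicator_def less_imp_le\<close>)
  show ?thesis
  proof (rule complex_eqI)
    have "Re (\<integral>\<omega>. W \<omega> * indicator A (X \<omega>) \<partial>M) = (\<integral>\<omega>. Re (W \<omega> * indicator A (X \<omega>)) \<partial>M)"
      using intA by (rule integral_Re[symmetric])
    also have "\<dots> = (\<integral>\<omega>. D * ((Re (W \<omega>) / D) * indicator A (X \<omega>)) \<partial>M)"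
      using D(1) by (intro Bochner_Integration.integral_cong) (auto simp: indicator_def)
    also have "\<dots> = 0" by (subst integral_mult_right_zero) (simp only: Re mult_zero_right)
    finally show "Re (\<integral>\<omega>. W \<omega> * indicator A (X \<omega>) \<partial>M) = Re 0" by simp
    have "Im (\<integral>\<omega>. W \<omega> * indicator A (X \<omega>) \<partial>M) = (\<integral>\<omega>. Im (W \<omega> * indicator A (X \<omega>)) \<partial>M)"
      using intA by (rule integral_Im[symmetric])
    also have "\<dots> = (\<integral>\<omega>. D * ((Im (W \<omega>) / D) * indicator A (X \<omega>)) \<partial>M)"
      using D(1) by (intro Bochner_Integration.integral_cong) (auto simp: indicator_def)
    also have "\<dots> = 0" by (subst integral_mult_right_zero) (simp only: Im mult_zero_right)
    finally show "Im (\<integral>\<omega>. W \<omega> * indicator A (X \<omega>) \<partial>M) = Im 0" by simp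
  qed
qed


text \<open>A character of a vector is a product of characters of its coordinates. Absorbing all
  factors but one into the weight lets the scalar case replace that one by an indicator; after all
  coordinates, this yields the claim for boxes.\<close>

lemma (in prob_space) vector_weighted_char_eq_0_imp:
  fixes X :: "'a \<Rightarrow> 'b::euclidean_space" and W :: "'a \<Rightarrow> complex"
  assumes X[measurable]: "random_variable borel X" and W[measurable]: "random_variable borel W"
    and bound: "\<And>\<omega>. norm (W \<omega>) \<le> C"
    and zero: "\<And>z. (\<integral>\<omega>. W \<omega> * cis (z \<bullet> X \<omega>) \<partial>M) = 0"
    and A: "A \<in> sets borel"
  shows "(\<integral>\<omega>. W \<omega> * indicator A (X \<omega>) \<partial>M) = 0"
proof -
  have C: "0 \<le> C" using bound norm_ge_zero order_trans by blast
  \<comment> \<open>The coordinates in \<open>B\<close> already carry indicators, the others still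
    carry characters. The frequencies \<open>c\<close> stay arbitrary so that the induction
    hypothesis can be used with every value at the next coordinate.\<close>
  have rect: "(\<integral>\<omega>. W \<omega> * (\<Prod>b\<in>B. indicator (S b) (X \<omega> \<bullet> b)) *
                 cis (\<Sum>b\<in>Basis - B. c b * (X \<omega> \<bullet> b)) \<partial>M) = 0"
    if "finite B" "B \<subseteq> Basis" "\<And>b. S b \<in> sets borel" for B S and c :: "'b \<Rightarrow> real"
    using that(1,2)
  proof (induction B arbitrary: c)
    case empty
    have "(\<Sum>b\<in>Basis. c b *\<^sub>R b) \<bullet> X \<omega> = (\<Sum>b\<in>Basis. c b * (X \<omega> \<bullet> b))" for \<omega>
      by (simp add: inner_sum_left inner_commute[of "X \<omega>"])
    then show ?case using zero[of "\<Sum>b\<in>Basis. c b *\<^sub>R b"] by simp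
  next
    case (insert b B)
    have [measurable]: "S b \<in> sets borel" for b by (rule that(3))
    let ?W = "\<lambda>\<omega>. W \<omega> * (\<Prod>b\<in>B. indicator (S b) (X \<omega> \<bullet> b)) *
                 cis (\<Sum>b\<in>Basis - insert b B. c b * (X \<omega> \<bullet> b))"
    have "(\<integral>\<omega>. ?W \<omega> * indicator (S b) (X \<omega> \<bullet> b) \<partial>M) = 0"
    proof (rule complex_weighted_char_eq_0_imp)
      have P: "norm (\<Prod>b\<in>B. indicator (S b) (X \<omega> \<bullet> b) :: complex) \<le> 1" for \<omega>
        unfolding prod_norm[symmetric] by (intro prod_le_1) (auto simp: indicator_def)
      show "norm (?W \<omega>) \<le> C" for \<omega>
        using mult_mono[OF bound[of \<omega>] P[of \<omega>]] C by (simp add: norm_mult)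
      show "(\<integral>\<omega>. ?W \<omega> * cis (t * (X \<omega> \<bullet> b)) \<partial>M) = 0" for t
      proof -
        have "(\<Sum>b'\<in>Basis - B. (c(b := t)) b' * (X \<omega> \<bullet> b')) =
            (\<Sum>b'\<in>Basis - insert b B. c b' * (X \<omega> \<bullet> b')) + t * (X \<omega> \<bullet> b)" for \<omega>
        proof -
          have eq: "Basis - B = insert b (Basis - insert b B)" using insert by auto
          have "(\<Sum>b'\<in>Basis - B. (c(b := t)) b' * (X \<omega> \<bullet> b')) =
            t * (X \<omega> \<bullet> b) + (\<Sum>b'\<in>Basis - insert b B. (c(b := t)) b' * (X \<omega> \<bullet> b'))"
            by (subst eq, subst sum.insert) auto
          also have "(\<Sum>b'\<in>Basis - insert b B. (c(b := t)) b' * (X \<omega> \<bullet> b')) =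
            (\<Sum>b'\<in>Basis - insert b B. c b' * (X \<omega> \<bullet> b'))"
            by (intro sum.cong) auto
          finally show ?thesis by simp
        qed
        then show ?thesis
          using insert.IH[of "c(b := t)"] insert.prems by (simp add: cis_mult mult.assoc)
      qed
    qed measurable
    then show ?case
      using insert.hyps by (simp add: mult_ac)
  qed
  have box: "(\<integral>\<omega>. W \<omega> * indicator (box u v) (X \<omega>) \<partial>M) = 0" for u v
  proof -
    have "indicator (box u v) x = (\<Prod>b\<in>Basis. indicator {u \<bullet> b<..<v \<bullet> b} (x \<bullet> b) :: complex)" for x
      by (auto simp: indicator_def box_def prod_zero_iff)
    then show ?thesis using rect[of Basis "\<lambda>b. {u \<bullet> b<..<v \<bullet> b}"] by simp
  qed
  have intA: "integrable M (\<lambda>\<omega>. W \<omega> * indicator A (X \<omega>))" if "A \<in> sets borel" for A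
  proof (rule integrable_const_bound[where B=C])
    show "random_variable borel (\<lambda>\<omega>. W \<omega> * indicator A (X \<omega>))"
      using that by measurable
  qed (use bound C in \<open>auto simp: norm_mult indicator_def\<close>)
  \<comment> \<open>Boxes form an intersection stable generator, so a Dynkin argument reaches all
    Borel sets. For complements, frequency 0 supplies that \<open>W\<close> itself integrates to
    0.\<close>
  have "A \<in> sigma_sets UNIV (range (\<lambda>(a, b). box a b))"
    using A by (subst (asm) borel_eq_box) simp
  then show ?thesis
  proof (induction rule: sigma_sets_induct_disjoint[rotated 2, consumes 1, case_names basic empty compl union gen sub])
    case (compl A)
    then have [measurable]: "A \<in> sets borel" by (subst borel_eq_box) simp
    have "W \<omega> * indicator (UNIV - A) (X \<omega>) = W \<omega> * indicator UNIV (X \<omega>) - W \<omega> * indicator A (X \<omega>)" for \<omega>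
      by (auto simp: indicator_def)
    then have "(\<integral>\<omega>. W \<omega> * indicator (UNIV - A) (X \<omega>) \<partial>M) =
      (\<integral>\<omega>. W \<omega> * indicator UNIV (X \<omega>) \<partial>M) - (\<integral>\<omega>. W \<omega> * indicator A (X \<omega>) \<partial>M)"
      using intA[of UNIV] intA[of A] by (simp only: Bochner_Integration.integral_diff sets.top \<open>A \<in> sets borel\<close> space_borel[symmetric])
    then show ?case using compl zero[of 0] by simp
  next
    case (union A)
    have [measurable]: "A i \<in> sets borel" for i using union(2) by (subst borel_eq_box) (auto)
    let ?A = "\<lambda>i. X -` A i \<inter> space M"
    have eq: "(\<integral>\<omega>. W \<omega> * indicator B (X \<omega>) \<partial>M) = (LINT \<omega>:X -` B \<inter> space M|M. W \<omega>)" for B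
      unfolding set_lebesgue_integral_def
      by (intro Bochner_Integration.integral_cong) (auto simp: indicator_def)
    have "(\<integral>\<omega>. W \<omega> * indicator (\<Union>i. A i) (X \<omega>) \<partial>M) = (LINT \<omega>:(\<Union>i. ?A i)|M. W \<omega>)"
      unfolding eq by (rule arg_cong[where f="\<lambda>S. set_lebesgue_integral M S W"]) auto
    also have "\<dots> = (\<Sum>i. LINT \<omega>:?A i|M. W \<omega>)"
    proof (rule lebesgue_integral_countable_add)
      show "?A i \<inter> ?A j = {}" if "i \<noteq> j" for i j
        using union(1) that by (fastforce simp: disjoint_family_on_def)
      show "set_integrable M (\<Union>i. ?A i) W"
        unfolding set_integrable_def
        by (rule integrable_const_bound[where B=C]) (use bound C in \<open>auto simp: indicator_def\<close>)
    qed measurable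
    also have "\<dots> = 0" using union(3) unfolding eq by simp
    finally show ?case .
  next
    case (basic A)
    then show ?case using box by auto
  next
    show "Int_stable (range (\<lambda>(a, b). box a b :: 'b set))"
      unfolding Int_stable_def
    proof (intro ballI)
      fix A B :: "'b set" assume "A \<in> range (\<lambda>(a, b). box a b)" "B \<in> range (\<lambda>(a, b). box a b)"
      then obtain a b c d where "A = box a b" "B = box c d" by auto
      then have "A \<inter> B = (\<lambda>(a, b). box a b) (\<Sum>i\<in>Basis. max (a \<bullet> i) (c \<bullet> i) *\<^sub>R i, \<Sum>i\<in>Basis. min (b \<bullet> i) (d \<bullet> i) *\<^sub>R i)"
        by (simp add: box_Int_box)
      then show "A \<inter> B \<in> range (\<lambda>(a, b). box a b)" by blast
    qed
  qed auto
qed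

text \<open>The exchange of characters for indicators is carried out one variable at a time on the
  factorization identity; once every variable carries an indicator, the identity is the product rule
  for probabilities.\<close>

lemma (in prob_space) indep_vars_if_char_prod:
  fixes X :: "'i \<Rightarrow> 'a \<Rightarrow> 'b::euclidean_space"
  assumes I: "finite I" and X[measurable]: "\<And>i. i \<in> I \<Longrightarrow> random_variable borel (X i)"
    and char: "\<And>z. (\<integral>\<omega>. cis (\<Sum>i\<in>I. z i \<bullet> X i \<omega>) \<partial>M) = (\<Prod>i\<in>I. \<integral>\<omega>. cis (z i \<bullet> X i \<omega>) \<partial>M)"
  shows "indep_vars (\<lambda>_. borel) X I"
proof (cases "I = {}")
  case True
  then show ?thesis unfolding indep_vars_def2 indep_sets_def by auto
next
  case False
  have mixed: "(\<integral>\<omega>. (\<Prod>i\<in>J. indicator (A i) (X i \<omega>)) * cis (\<Sum>i\<in>I - J. z i \<bullet> X i \<omega>) \<partial>M) =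
      (\<Prod>i\<in>J. \<integral>\<omega>. indicator (A i) (X i \<omega>) \<partial>M) * (\<Prod>i\<in>I - J. \<integral>\<omega>. cis (z i \<bullet> X i \<omega>) \<partial>M)"
    if J: "J \<subseteq> I" and A: "\<And>i. i \<in> I \<Longrightarrow> A i \<in> sets borel" for J z and A :: "'i \<Rightarrow> 'b set"
    using finite_subset[OF J I] J
  proof (induction J arbitrary: z)
    case empty
    then show ?case using char by simp
  next
    case (insert i J)
    then have i: "i \<in> I" "i \<notin> J" "J \<subseteq> I" and X_J[measurable]: "\<And>j. j \<in> J \<Longrightarrow> random_variable borel (X j)"
      and X_IJ[measurable]: "\<And>j. j \<in> I - insert i J \<Longrightarrow> random_variable borel (X j)"
      and X_i[measurable]: "random_variable borel (X i)"
      and A_i[measurable]: "A i \<in> sets borel"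
      and A_J[measurable]: "\<And>j. j \<in> J \<Longrightarrow> A j \<in> sets borel" using A by auto
    define W where "W \<omega> = (\<Prod>i\<in>J. indicator (A i) (X i \<omega>)) * cis (\<Sum>j\<in>I - insert i J. z j \<bullet> X j \<omega>)" for \<omega>
    \<comment> \<open>By induction, pairing \<open>W\<close> with any character of
      \<open>X i\<close> gives \<open>k\<close> times the mean of that character. So
      \<open>W - k\<close> is orthogonal to all characters of \<open>X i\<close>, and hence to the
      indicator of \<open>A i\<close>.\<close>
    define k :: complex where "k = (\<Prod>i\<in>J. \<integral>\<omega>. indicator (A i) (X i \<omega>) \<partial>M) *
        (\<Prod>j\<in>I - insert i J. \<integral>\<omega>. cis (z j \<bullet> X j \<omega>) \<partial>M)"
    have W[measurable]: "random_variable borel W" unfolding W_def by measurable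
    have IJ: "I - J = insert i (I - insert i J)" using i by auto
    have Wb: "norm (W \<omega>) \<le> 1" for \<omega>
    proof -
      have "norm (\<Prod>b\<in>J. indicator (A b) (X b \<omega>) :: complex) \<le> 1"
        unfolding prod_norm[symmetric] by (intro prod_le_1) (auto simp: indicator_def)
      then show ?thesis unfolding W_def by (simp add: norm_mult)
    qed
    have intW: "integrable M (\<lambda>\<omega>. W \<omega> * cis (y \<bullet> X i \<omega>))" "integrable M (\<lambda>\<omega>. cis (y \<bullet> X i \<omega>))" for y
      by (rule integrable_const_bound[where B=1]; use Wb in \<open>simp add: norm_mult\<close>)+
    have intA: "integrable M (\<lambda>\<omega>. W \<omega> * indicator (A i) (X i \<omega>))"
       "integrable M (\<lambda>\<omega>. indicator (A i) (X i \<omega>) :: complex)"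
      by (rule integrable_const_bound[where B=1]; use Wb in \<open>simp add: norm_mult indicator_def\<close>)+
    have "(\<integral>\<omega>. (W \<omega> - k) * indicator (A i) (X i \<omega>) \<partial>M) = 0"
    proof (rule vector_weighted_char_eq_0_imp)
      show "norm (W \<omega> - k) \<le> 1 + norm k" for \<omega>
        using norm_triangle_ineq4[of "W \<omega>" k] Wb[of \<omega>] by linarith
      fix y
      have "W \<omega> * cis (y \<bullet> X i \<omega>) = (\<Prod>i\<in>J. indicator (A i) (X i \<omega>)) * cis (\<Sum>j\<in>I - J. (z(i := y)) j \<bullet> X j \<omega>)" for \<omega>
      proof -
        have "(\<Sum>j\<in>I - J. (z(i := y)) j \<bullet> X j \<omega>) = y \<bullet> X i \<omega> + (\<Sum>j\<in>I - insert i J. (z(i := y)) j \<bullet> X j \<omega>)"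
          using I by (subst IJ, subst sum.insert) auto
        also have "(\<Sum>j\<in>I - insert i J. (z(i := y)) j \<bullet> X j \<omega>) = (\<Sum>j\<in>I - insert i J. z j \<bullet> X j \<omega>)"
          by (intro sum.cong) auto
        finally show ?thesis unfolding W_def by (simp add: cis_mult add.commute mult.assoc)
      qed
      then have "(\<integral>\<omega>. W \<omega> * cis (y \<bullet> X i \<omega>) \<partial>M) =
         (\<Prod>i\<in>J. \<integral>\<omega>. indicator (A i) (X i \<omega>) \<partial>M) * (\<Prod>j\<in>I - J. \<integral>\<omega>. cis ((z(i := y)) j \<bullet> X j \<omega>) \<partial>M)"
        using insert.IH[of "z(i := y)"] i by simp
      also have "(\<Prod>j\<in>I - J. \<integral>\<omega>. cis ((z(i := y)) j \<bullet> X j \<omega>) \<partial>M) =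
         (\<integral>\<omega>. cis (y \<bullet> X i \<omega>) \<partial>M) * (\<Prod>j\<in>I - insert i J. \<integral>\<omega>. cis ((z(i := y)) j \<bullet> X j \<omega>) \<partial>M)"
        using I by (subst IJ, subst prod.insert) auto
      also have "(\<Prod>j\<in>I - insert i J. \<integral>\<omega>. cis ((z(i := y)) j \<bullet> X j \<omega>) \<partial>M) =
          (\<Prod>j\<in>I - insert i J. \<integral>\<omega>. cis (z j \<bullet> X j \<omega>) \<partial>M)"
        by (intro prod.cong) auto
      finally show "(\<integral>\<omega>. (W \<omega> - k) * cis (y \<bullet> X i \<omega>) \<partial>M) = 0"
        using intW[of y] unfolding k_def[symmetric] left_diff_distrib by (simp add: k_def mult_ac)
    qed measurable
    then have "(\<integral>\<omega>. W \<omega> * indicator (A i) (X i \<omega>) \<partial>M) = k * (\<integral>\<omega>. indicator (A i) (X i \<omega>) \<partial>M)"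
      using intA by (simp add: left_diff_distrib)
    then show ?case
      using i insert.hyps unfolding W_def k_def by (simp add: mult_ac)
  qed
  show ?thesis
  proof (subst indep_vars_finite[where E="\<lambda>_. sets borel"])
    show "\<forall>A\<in>\<Pi> i\<in>I. sets borel. prob (\<Inter>j\<in>I. X j -` A j \<inter> space M) = (\<Prod>j\<in>I. prob (X j -` A j \<inter> space M))"
    proof
      fix A :: "'i \<Rightarrow> 'b set" assume A: "A \<in> (\<Pi> i\<in>I. sets borel)"
      have meas: "X j -` A j \<inter> space M \<in> sets M" if "j \<in> I" for j
        using that A by (intro measurable_sets[OF X[OF that]]) auto
      have "(\<integral>\<omega>. (\<Prod>i\<in>I. indicator (A i) (X i \<omega>)) \<partial>M) = (\<Prod>i\<in>I. \<integral>\<omega>. indicator (A i) (X i \<omega>) \<partial>M :: complex)"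
        using mixed[of I A] A by (auto simp: Pi_iff)
      moreover have "(\<integral>\<omega>. indicator (A i) (X i \<omega>) \<partial>M) = complex_of_real (prob (X i -` A i \<inter> space M))"
        if "i \<in> I" for i
      proof -
        have "(\<integral>\<omega>. indicator (A i) (X i \<omega>) \<partial>M) = (\<integral>\<omega>. complex_of_real (indicator (X i -` A i \<inter> space M) \<omega>) \<partial>M)"
          by (intro Bochner_Integration.integral_cong) (auto simp: indicator_def)
        then show ?thesis using meas[OF that] by simp
      qed
      moreover have "(\<integral>\<omega>. (\<Prod>i\<in>I. indicator (A i) (X i \<omega>)) \<partial>M) =
          complex_of_real (prob (\<Inter>j\<in>I. X j -` A j \<inter> space M))"
      proof -
        have "(\<integral>\<omega>. (\<Prod>i\<in>I. indicator (A i) (X i \<omega>)) \<partial>M) =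
          (\<integral>\<omega>. complex_of_real (indicator (\<Inter>j\<in>I. X j -` A j \<inter> space M) \<omega>) \<partial>M)"
          using I by (intro Bochner_Integration.integral_cong) (auto simp: indicator_def prod_zero_iff)
        moreover have "(\<Inter>j\<in>I. X j -` A j \<inter> space M) \<in> sets M"
          using meas I False by (intro sets.finite_INT) auto
        ultimately show ?thesis by simp
      qed
      ultimately have "complex_of_real (prob (\<Inter>j\<in>I. X j -` A j \<inter> space M)) =
          of_real (\<Prod>j\<in>I. prob (X j -` A j \<inter> space M))"
        by simp
      then show "prob (\<Inter>j\<in>I. X j -` A j \<inter> space M) = (\<Prod>j\<in>I. prob (X j -` A j \<inter> space M))"
        using of_real_eq_iff by blast
    qed
    show "sets (borel :: 'b measure) = sigma_sets (space borel) (sets borel)"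
      by (rule sets.sigma_sets_eq[symmetric])
  qed (use I False X in \<open>auto simp: sets.Int_stable\<close>)
qed

section \<open>A marked Poisson process\<close>

abbreviation (input) std_exponential :: "real measure" where
  "std_exponential \<equiv> density lborel (exponential_density 1)"

lemma prob_space_std_exponential: "prob_space std_exponential"
  by (rule prob_space_exponential_density) simp

lemma emeasure_std_exponential_greaterThan:
  assumes "0 \<le> x"
  shows "emeasure std_exponential {x<..} = ennreal (exp (- x))"
proof -
  interpret prob_space std_exponential by (rule prob_space_std_exponential)
  have "distributed std_exponential lborel (\<lambda>x. x) (exponential_density 1)"
    by (auto simp: distributed_def distr_id2 exponential_density_nonneg)
  then have "prob {y \<in> space std_exponential. x < y} = exp (- x * 1)"
    by (rule exponential_distributedD_gt) (use assms in auto)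
  also have "{y \<in> space std_exponential. x < y} = {x<..}" by auto
  finally show ?thesis by (simp add: emeasure_eq_measure)
qed

lemma AE_std_exponential_pos: "AE x in std_exponential. 0 < x"
proof -
  interpret prob_space std_exponential by (rule prob_space_std_exponential)
  have "prob {0<..} = 1"
    using emeasure_std_exponential_greaterThan[of 0] by (simp add: emeasure_eq_measure)
  then show ?thesis by (simp add: prob_eq_1)
qed

text \<open>Fubini for an independent pair, with the original space also hosting the independent
  copy. It serves to freeze the past gaps and marks while averaging over the next one.\<close>

lemma (in prob_space) indep_var_expectation_iterated:
  fixes f :: "'b \<times> 'b \<Rightarrow> 'd::{banach, second_countable_topology}"
  assumes "indep_var S X T Y" and f[measurable]: "f \<in> borel_measurable (S \<Otimes>\<^sub>M T)"
    and bound: "\<And>x. norm (f x) \<le> C"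
  shows "(\<integral>\<omega>. f (X \<omega>, Y \<omega>) \<partial>M) = (\<integral>\<omega>. (\<integral>\<omega>'. f (X \<omega>, Y \<omega>') \<partial>M) \<partial>M)"
proof -
  have X[measurable]: "random_variable S X" and Y[measurable]: "random_variable T Y"
    and eq: "distr M S X \<Otimes>\<^sub>M distr M T Y = distr M (S \<Otimes>\<^sub>M T) (\<lambda>x. (X x, Y x))"
    using assms(1) by (auto simp: indep_var_distribution_eq)
  interpret S: prob_space "distr M S X" by (rule prob_space_distr) simp
  interpret T: prob_space "distr M T Y" by (rule prob_space_distr) simp
  interpret ST: pair_prob_space "distr M S X" "distr M T Y" ..
  have int: "integrable (distr M S X \<Otimes>\<^sub>M distr M T Y) f"
    by (rule ST.P.integrable_const_bound[where B=C]) (use bound in auto)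
  have "(\<integral>\<omega>. f (X \<omega>, Y \<omega>) \<partial>M) = (\<integral>z. f z \<partial>(distr M S X \<Otimes>\<^sub>M distr M T Y))"
    unfolding eq by (subst integral_distr) auto
  also have "\<dots> = (\<integral>x. (\<integral>y. f (x, y) \<partial>distr M T Y) \<partial>distr M S X)"
    using int by (rule ST.integral_fst'[symmetric])
  also have "\<dots> = (\<integral>\<omega>. (\<integral>y. f (X \<omega>, y) \<partial>distr M T Y) \<partial>M)"
    by (rule integral_distr) measurable
  also have "\<dots> = (\<integral>\<omega>. (\<integral>\<omega>'. f (X \<omega>, Y \<omega>') \<partial>M) \<partial>M)"
    by (intro Bochner_Integration.integral_cong integral_distr) 
       (auto intro: measurable_compose[OF measurable_Pair1' f] dest: measurable_space[OF X])
  finally show ?thesis .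
qed

section \<open>The renewal equation of a unit rate Poisson process\<close>

text \<open>The predicted mean of the product of the factors at points after time a and up to c, for
  a unit rate Poisson process with mean factor \<open>\<gamma> s\<close> at time s. For a > c the
  interval is empty and the value is 1.\<close>

definition poisson_exponent :: "real \<Rightarrow> (real \<Rightarrow> complex) \<Rightarrow> real \<Rightarrow> complex" where
  "poisson_exponent c \<gamma> a = exp (LINT s:{a..c}|lborel. \<gamma> s - 1)"

lemma poisson_exponent_measurable [measurable]:
  assumes [measurable]: "\<gamma> \<in> borel_measurable borel"
  shows "poisson_exponent c \<gamma> \<in> borel_measurable borel"
proof -
  have "(\<lambda>a. \<integral>s. (if a \<le> s \<and> s \<le> c then \<gamma> s - 1 else 0) \<partial>lborel) \<in> borel_measurable borel"
    by measurable
  also have "(\<lambda>a. \<integral>s. (if a \<le> s \<and> s \<le> c then \<gamma> s - 1 else 0) \<partial>lborel) = (\<lambda>a. LINT s:{a..c}|lborel. \<gamma> s - 1)"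
    unfolding set_lebesgue_integral_def
    by (intro ext Bochner_Integration.integral_cong) (auto simp: indicator_def)
  finally have *[measurable]: "(\<lambda>a. LINT s:{a..c}|lborel. \<gamma> s - 1) \<in> borel_measurable borel" .
  have [measurable]: "(exp :: complex \<Rightarrow> complex) \<in> borel_measurable borel"
    by (intro borel_measurable_continuous_onI continuous_intros)
  show ?thesis unfolding poisson_exponent_def by measurable
qed

lemma poisson_exponent_eq_1: "c < a \<Longrightarrow> poisson_exponent c \<gamma> a = 1"
  by (simp add: poisson_exponent_def set_lebesgue_integral_def)

lemma set_integrable_bounded_Icc:
  fixes h :: "real \<Rightarrow> 'a::{banach, second_countable_topology}"
  assumes [measurable]: "h \<in> borel_measurable borel" and "\<And>s. s \<in> {a..c} \<Longrightarrow> norm (h s) \<le> C"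
  shows "set_integrable lborel {a..c} h"
  unfolding set_integrable_def
proof (rule Bochner_Integration.integrable_bound)
  show "integrable lborel (\<lambda>x. indicator {a..c} x *\<^sub>R C)"
    by (intro integrable_scaleR_left integrable_real_indicator) (auto simp: emeasure_lborel_Icc_eq)
  show "AE x in lborel. norm (indicator {a..c} x *\<^sub>R h x) \<le> norm (indicator {a..c} x *\<^sub>R C)"
    using assms(2) by (intro AE_I2) (fastforce simp: indicator_def)
qed measurable

text \<open>A number in the closed unit disc has real part at most 1, so the exponent has
  nonpositive real part.\<close>

lemma norm_poisson_exponent_le_1:
  assumes [measurable]: "\<gamma> \<in> borel_measurable borel" and bound: "\<And>s. norm (\<gamma> s) \<le> 1"
  shows "norm (poisson_exponent c \<gamma> a) \<le> 1"
proof -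
  have "norm (\<gamma> s - 1) \<le> 2" for s
    using norm_triangle_ineq4[of "\<gamma> s" 1] bound[of s] by simp
  then have int: "integrable lborel (\<lambda>s. indicator {a..c} s *\<^sub>R (\<gamma> s - 1))"
    using set_integrable_bounded_Icc[of "\<lambda>s. \<gamma> s - 1" a c 2] by (simp add: set_integrable_def)
  have "Re (LINT s:{a..c}|lborel. \<gamma> s - 1) = (\<integral>s. Re (indicator {a..c} s *\<^sub>R (\<gamma> s - 1)) \<partial>lborel)"
    unfolding set_lebesgue_integral_def by (rule integral_Re[symmetric, OF int])
  also have "\<dots> \<le> 0"
  proof -
    have "0 \<le> - Re (indicator {a..c} s *\<^sub>R (\<gamma> s - 1))" for s
      using bound[of s] complex_Re_le_cmod[of "\<gamma> s"] by (auto simp: indicator_def)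
    then have "0 \<le> (\<integral>s. - Re (indicator {a..c} s *\<^sub>R (\<gamma> s - 1)) \<partial>lborel)"
      by (rule Bochner_Integration.integral_nonneg)
    then show ?thesis by (simp only: integral_minus)
  qed
  finally show ?thesis unfolding poisson_exponent_def by simp
qed

text \<open>This conditions on the next gap d: a point at a + d \<le> c contributes its factor and
  the process restarts there, while a gap beyond c leaves the empty product 1.\<close>

lemma poisson_exponent_renewal_eq:
  assumes \<gamma>[measurable]: "\<gamma> \<in> borel_measurable borel" and bound: "\<And>s. norm (\<gamma> s) \<le> 1"
    and cont: "continuous_on {0<..} \<gamma>" and a: "0 \<le> a"
  shows "(\<integral>d. (if a + d \<le> c then \<gamma> (a + d) * poisson_exponent c \<gamma> (a + d) else 1) \<partial>std_exponential)
    = poisson_exponent c \<gamma> a"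
proof (cases "a \<le> c")
  case False
  have "(\<integral>d. (if a + d \<le> c then \<gamma> (a + d) * poisson_exponent c \<gamma> (a + d) else 1) \<partial>std_exponential)
    = (\<integral>d. 1 \<partial>std_exponential)"
  proof (rule integral_cong_AE)
    show "AE d in std_exponential. (if a + d \<le> c then \<gamma> (a + d) * poisson_exponent c \<gamma> (a + d) else 1) = 1"
      using AE_std_exponential_pos by eventually_elim (use False in auto)
  qed auto
  then show ?thesis
    using False prob_space.prob_space[OF prob_space_std_exponential] by (simp add: poisson_exponent_eq_1)
next
  case True
  let ?\<Phi> = "poisson_exponent c \<gamma>"
  define h where "h s = \<gamma> s - 1" for s
  \<comment> \<open>With the base point fixed at 0, the dependence of the exponent on its lower
    limit becomes \<open>F c - F u\<close> and can be differentiated.\<close>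
  define F where "F u = integral {0..u} h" for u
  have [measurable]: "h \<in> borel_measurable borel" unfolding h_def by measurable
  have hb: "norm (h s) \<le> 2" for s
    using norm_triangle_ineq4[of "\<gamma> s" 1] bound[of s] unfolding h_def by simp
  have seth: "set_integrable lborel {u..c} h" for u
    by (rule set_integrable_bounded_Icc[where C=2]) (use hb in auto)
  have inth: "h integrable_on {u..c}" for u
    using set_borel_integral_eq_integral(1)[OF seth] .
  have \<Phi>: "?\<Phi> u = exp (F c - F u)" if "0 \<le> u" "u \<le> c" for u
  proof -
    have "F u + integral {u..c} h = F c"
      unfolding F_def by (rule Henstock_Kurzweil_Integration.integral_combine) (use that inth in auto)
    moreover have "(LINT s:{u..c}|lborel. \<gamma> s - 1) = integral {u..c} h"
      using set_borel_integral_eq_integral(2)[OF seth] unfolding h_def .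
    ultimately show ?thesis unfolding poisson_exponent_def by (metis add_diff_cancel_left')
  qed
  have Fcont: "continuous_on {0..c} F"
    unfolding F_def by (rule indefinite_integral_continuous_1[OF inth])
  have Fderiv: "(F has_vector_derivative h u) (at u)" if "0 < u" "u < c" for u
  proof -
    have "continuous_on {0<..} h" unfolding h_def by (intro continuous_intros cont)
    then have "continuous (at u) h"
      using that by (simp add: continuous_on_eq_continuous_at)
    then have "((\<lambda>u. integral {0..u} h) has_vector_derivative h u) (at u within {0..c})"
      using integral_has_vector_derivative_continuous_at[OF inth, of u 0 "{}"] that
      by (simp add: continuous_at_imp_continuous_at_within)
    then have "(F has_vector_derivative h u) (at u within {0..c})" unfolding F_def .
    then have "(F has_vector_derivative h u) (at u within {0<..<c})"
      by (rule has_vector_derivative_within_subset) auto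
    moreover have "at u within {0<..<c} = at u" using that by (intro at_within_open) auto
    ultimately show ?thesis by simp
  qed
  define f where "f d = exp (- of_real d) * (\<gamma> (a + d) * ?\<Phi> (a + d))" for d :: real
  \<comment> \<open>\<open>?G\<close> is an antiderivative of \<open>f\<close>: the factor exp (-d)
    contributes 1 and the exponential contributes h = \<gamma> - 1, which add up to
    \<gamma>.\<close>
  let ?G = "\<lambda>d::real. - (exp (- of_real d) * exp (F c - F (a + d)))"
  have "(f has_integral (?G (c - a) - ?G 0)) {0..c - a}"
  proof (rule fundamental_theorem_of_calculus_interior)
    show "continuous_on {0..c - a} ?G"
      using a by (intro continuous_intros continuous_on_compose2[OF Fcont]) auto
    fix d assume d: "d \<in> {0<..<c - a}"
    have "((\<lambda>d. F (a + d)) has_vector_derivative h (a + d)) (at d)"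
    proof -
      have "(F has_vector_derivative h (a + d)) (at (a + d))" using Fderiv[of "a + d"] a d by auto
      then have "(F \<circ> (\<lambda>d. a + d) has_vector_derivative 1 *\<^sub>R h (a + d)) (at d)"
        by (intro vector_diff_chain_at) (auto intro!: derivative_eq_intros)
      then show ?thesis by (simp add: o_def)
    qed
    then have "((\<lambda>d. F c - F (a + d)) has_vector_derivative - h (a + d)) (at d)"
      by (auto intro!: derivative_eq_intros)
    then have "((\<lambda>d. exp (F c - F (a + d))) has_vector_derivative (- h (a + d)) * exp (F c - F (a + d))) (at d)"
      using field_vector_diff_chain_at[where f="\<lambda>d. F c - F (a + d)" and f'="- h (a + d)" and g=exp and g'="exp (F c - F (a + d))", OF _ DERIV_exp]
      by (simp only: o_def)
    then have 1: "((\<lambda>d. exp (F c - F (a + d))) has_vector_derivative - h (a + d) * exp (F c - F (a + d))) (at d)"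
      by simp
    have "((\<lambda>d. - of_real d :: complex) has_vector_derivative - 1) (at d)"
      by (auto intro!: derivative_eq_intros)
    then have 2: "((\<lambda>d. exp (- of_real d) :: complex) has_vector_derivative - 1 * exp (- of_real d)) (at d)"
      using field_vector_diff_chain_at[where f="\<lambda>d. - of_real d :: complex" and f'="- 1" and g=exp and g'="exp (- of_real d)", OF _ DERIV_exp]
      by (simp only: o_def)
    have "(?G has_vector_derivative - (exp (- of_real d) * (- h (a + d) * exp (F c - F (a + d)))
         + (- 1 * exp (- of_real d)) * exp (F c - F (a + d)))) (at d)"
      by (intro has_vector_derivative_minus has_vector_derivative_mult 1 2)
    also have "- (exp (- of_real d) * (- h (a + d) * exp (F c - F (a + d)))
         + (- 1 * exp (- of_real d)) * exp (F c - F (a + d))) = f d"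
      unfolding f_def h_def using \<Phi>[of "a + d"] a d by (simp add: algebra_simps)
    finally show "(?G has_vector_derivative f d) (at d)" .
  qed (use True in auto)
  \<comment> \<open>The boundary term at c - a is the probability of a gap longer than c - a. It is
    returned below by the indicator part of the integrand.\<close>
  moreover have "?G (c - a) - ?G 0 = ?\<Phi> a - of_real (exp (- (c - a)))"
    using \<Phi>[of a] a True by (simp add: exp_of_real[symmetric])
  ultimately have int_f: "integral {0..c - a} f = ?\<Phi> a - of_real (exp (- (c - a)))"
    by (simp add: integral_unique)
  have [measurable]: "(\<lambda>d. exp (- complex_of_real d)) \<in> borel_measurable borel"
    by (intro borel_measurable_continuous_onI continuous_intros)
  have f[measurable]: "f \<in> borel_measurable borel" unfolding f_def by measurable
  have b1: "norm (\<gamma> u * ?\<Phi> u) \<le> 1" for u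
    using mult_mono[OF bound[of u] norm_poisson_exponent_le_1[OF \<gamma> bound, of c u]] by (simp add: norm_mult)
  have "norm (f d) \<le> 1" if "d \<in> {0..c - a}" for d
  proof -
    have "norm (exp (- complex_of_real d)) \<le> 1" using that by simp
    then show ?thesis unfolding f_def using mult_mono[OF _ b1[of "a + d"], of "norm (exp (- complex_of_real d))" 1]
      by (simp add: norm_mult)
  qed
  then have setf: "set_integrable lborel {0..c - a} f"
    by (intro set_integrable_bounded_Icc) auto
  interpret E: prob_space std_exponential by (rule prob_space_std_exponential)
  let ?k = "\<lambda>d. if a + d \<le> c then \<gamma> (a + d) * ?\<Phi> (a + d) else 0"
  have intk: "integrable std_exponential ?k"
    by (rule E.integrable_const_bound[where B=1]) (use b1 in auto)
  have "(\<integral>d. (if a + d \<le> c then \<gamma> (a + d) * ?\<Phi> (a + d) else 1) \<partial>std_exponential)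
    = (\<integral>d. ?k d + of_real (indicator {c - a<..} d) \<partial>std_exponential)"
    by (intro Bochner_Integration.integral_cong) (auto simp: indicator_def)
  also have "\<dots> = (\<integral>d. ?k d \<partial>std_exponential) + (\<integral>d. of_real (indicator {c - a<..} d) \<partial>std_exponential)"
    by (intro Bochner_Integration.integral_add intk) (simp add: E.emeasure_eq_measure)
  also have "(\<integral>d. of_real (indicator {c - a<..} d) \<partial>std_exponential) = complex_of_real (exp (- (c - a)))"
    using emeasure_std_exponential_greaterThan[of "c - a"] True by (simp add: E.emeasure_eq_measure)
  also have "(\<integral>d. ?k d \<partial>std_exponential) = (LINT d:{0..c - a}|lborel. f d)"
    unfolding set_lebesgue_integral_def
    by (subst integral_density)
       (auto simp: exponential_density_nonneg exponential_density_def f_def indicator_def scaleR_conv_of_real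
         exp_of_real[symmetric] intro!: Bochner_Integration.integral_cong)
  also have "\<dots> = ?\<Phi> a - of_real (exp (- (c - a)))"
    using set_borel_integral_eq_integral(2)[OF setf] int_f by simp
  finally show ?thesis by simp
qed


text \<open>Multiplying the rate 1 density by exp (-d) gives half the rate 2 density. This is the
  constant of the exponential Markov bound for the arrival times.\<close>

lemma nn_integral_exp_std_exponential: "(\<integral>\<^sup>+d. ennreal (exp (- d)) \<partial>std_exponential) = ennreal (1 / 2)"
proof -
  interpret prob_space "density lborel (exponential_density 2)"
    by (rule prob_space_exponential_density) simp
  have "(\<integral>\<^sup>+d. ennreal (exp (- d)) \<partial>std_exponential) =
      (\<integral>\<^sup>+d. ennreal (1 / 2) * ennreal (exponential_density 2 d) \<partial>lborel)"
  proof (subst nn_integral_density)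
    have "exponential_density 1 d * exp (- d) = 1 / 2 * exponential_density 2 d" for d :: real
      by (simp add: exponential_density_def mult_exp_exp mult.commute)
    then have "ennreal (exponential_density 1 d) * ennreal (exp (- d)) = ennreal (1 / 2) * ennreal (exponential_density 2 d)" for d :: real
      by (simp only: ennreal_mult'[symmetric] ennreal_mult''[symmetric] exp_ge_zero exponential_density_nonneg zero_less_numeral)
    then show "(\<integral>\<^sup>+d. ennreal (exponential_density 1 d) * ennreal (exp (- d)) \<partial>lborel) =
        (\<integral>\<^sup>+d. ennreal (1 / 2) * ennreal (exponential_density 2 d) \<partial>lborel)" by simp
  qed auto
  also have "\<dots> = ennreal (1 / 2) * emeasure (density lborel (exponential_density 2)) UNIV"
    by (subst nn_integral_cmult) (auto simp: emeasure_density)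
  finally show ?thesis using emeasure_space_1 by simp
qed

section \<open>Gaps with marks, and divergence of the arrival times\<close>

text \<open>\<open>D\<close> holds the gaps and \<open>Y\<close> the marks. The pairs are
  independent over j, and the product law makes gap and mark independent within a pair; marks may
  take values in an arbitrary probability space \<open>N\<close>.\<close>

locale marked_poisson = prob_space M + N: prob_space N
  for M :: "'a measure" and N :: "'y measure" +
  fixes D :: "nat \<Rightarrow> 'a \<Rightarrow> real" and Y :: "nat \<Rightarrow> 'a \<Rightarrow> 'y"
  assumes indep: "indep_vars (\<lambda>_. borel \<Otimes>\<^sub>M N) (\<lambda>j \<omega>. (D j \<omega>, Y j \<omega>)) UNIV"
    and law: "\<And>j. distr M (borel \<Otimes>\<^sub>M N) (\<lambda>\<omega>. (D j \<omega>, Y j \<omega>)) = std_exponential \<Otimes>\<^sub>M N"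
begin

lemma measurable_DY: "random_variable (borel \<Otimes>\<^sub>M N) (\<lambda>\<omega>. (D j \<omega>, Y j \<omega>))"
  using indep by (auto simp: indep_vars_def)

lemma measurable_D [measurable]: "random_variable borel (D j)"
  using measurable_compose[OF measurable_DY measurable_fst] by simp

lemma measurable_Y [measurable]: "random_variable N (Y j)"
  using measurable_compose[OF measurable_DY measurable_snd] by simp

lemma measurable_Gam [measurable]: "random_variable borel (Gam D j)"
  unfolding Gam_def by measurable

lemma distr_D: "distr M borel (D j) = std_exponential"
proof -
  interpret E: prob_space std_exponential by (rule prob_space_std_exponential)
  interpret EN: pair_prob_space std_exponential N ..
  have "distr M borel (D j) = distr (distr M (borel \<Otimes>\<^sub>M N) (\<lambda>\<omega>. (D j \<omega>, Y j \<omega>))) borel fst"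
    by (subst distr_distr) (auto simp: o_def)
  also have "\<dots> = distr (std_exponential \<Otimes>\<^sub>M N) std_exponential fst"
    unfolding law by (rule distr_cong) auto
  also have "\<dots> = std_exponential"
    by (rule N.distr_pair_fst) 
  finally show ?thesis .
qed

lemma AE_D_pos: "AE \<omega> in M. 0 < D j \<omega>"
proof -
  have "AE x in distr M borel (D j). 0 < x"
    unfolding distr_D by (rule AE_std_exponential_pos)
  then show ?thesis by (subst (asm) AE_distr_iff) auto
qed

text \<open>Exponential Markov bound and Borel-Cantelli: the event that \<open>Gam D j\<close> is at
  most c has probability at most exp c * (1/2)^(j+1), which is summable. The exponent is j + 1
  because \<open>Gam D j\<close> adds the gaps 0 to j.\<close>

lemma AE_eventually_Gam_gt: "AE \<omega> in M. eventually (\<lambda>j. c < Gam D j \<omega>) sequentially"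
proof -
  have le: "emeasure M {\<omega> \<in> space M. Gam D j \<omega> \<le> c} \<le> ennreal (exp c * (1 / 2) ^ Suc j)" for j
  proof -
    have "indep_vars (\<lambda>_. borel) (\<lambda>i \<omega>. ennreal (exp (- fst (D i \<omega>, Y i \<omega>)))) UNIV"
      by (rule indep_vars_compose2[OF indep]) measurable
    then have ind: "indep_vars (\<lambda>_. borel) (\<lambda>i \<omega>. ennreal (exp (- D i \<omega>))) {..j}"
      by (auto intro: indep_vars_subset)
    have int: "(\<integral>\<^sup>+\<omega>. ennreal (exp (- D i \<omega>)) \<partial>M) = ennreal (1 / 2)" for i
    proof -
      have "(\<integral>\<^sup>+\<omega>. ennreal (exp (- D i \<omega>)) \<partial>M) = (\<integral>\<^sup>+d. ennreal (exp (- d)) \<partial>distr M borel (D i))"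
        by (subst nn_integral_distr) auto
      then show ?thesis unfolding distr_D nn_integral_exp_std_exponential .
    qed
    have "emeasure M {\<omega> \<in> space M. Gam D j \<omega> \<le> c} = (\<integral>\<^sup>+\<omega>. indicator {\<omega> \<in> space M. Gam D j \<omega> \<le> c} \<omega> \<partial>M)"
      by simp
    also have "\<dots> \<le> (\<integral>\<^sup>+\<omega>. ennreal (exp c) * (\<Prod>i\<le>j. ennreal (exp (- D i \<omega>))) \<partial>M)"
    proof (rule nn_integral_mono)
      fix \<omega>
      have "ennreal (exp c) * (\<Prod>i\<le>j. ennreal (exp (- D i \<omega>))) = ennreal (exp (c - Gam D j \<omega>))"
      proof -
        have "(\<Prod>i\<le>j. ennreal (exp (- D i \<omega>))) = ennreal (exp (\<Sum>i\<le>j. - D i \<omega>))"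
          by (simp only: prod_ennreal exp_ge_zero exp_sum finite_atMost)
        then show ?thesis
          unfolding Gam_def by (simp add: sum_negf exp_add flip: ennreal_mult' diff_conv_add_uminus)
             (simp add: exp_diff exp_minus divide_inverse)
      qed
      then show "indicator {\<omega> \<in> space M. Gam D j \<omega> \<le> c} \<omega> \<le> ennreal (exp c) * (\<Prod>i\<le>j. ennreal (exp (- D i \<omega>)))"
        by (auto simp: indicator_def simp flip: ennreal_1 intro!: ennreal_leI)
    qed
    also have "\<dots> = ennreal (exp c) * (\<Prod>i\<le>j. ennreal (1 / 2))"
      using indep_vars_nn_integral[OF _ ind] int by (subst nn_integral_cmult) auto
    also have "\<dots> = ennreal (exp c * (1 / 2) ^ Suc j)"
      by (simp only: prod_constant card_atMost ennreal_power ennreal_mult''[symmetric] zero_le_power zero_le_divide_1_iff zero_le_numeral)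
    finally show ?thesis .
  qed
  have "AE \<omega> in M. eventually (\<lambda>j. \<omega> \<in> space M - {\<omega> \<in> space M. Gam D j \<omega> \<le> c}) sequentially"
  proof (rule borel_cantelli_AE1)
    have "summable (\<lambda>j. exp c * (1 / 2 :: real) ^ Suc j)"
      by (intro summable_mult) (simp add: summable_geometric)
    then show "summable (\<lambda>j. prob {\<omega> \<in> space M. Gam D j \<omega> \<le> c})"
      by (rule summable_comparison_test[rotated])
         (use le in \<open>auto simp: emeasure_eq_measure ennreal_le_iff\<close>)
  qed (auto simp: emeasure_eq_measure)
  then show ?thesis
    by eventually_elim (auto elim!: eventually_mono)
qed

end

section \<open>Measurability of sums and products over a random index set\<close>

text \<open>On the measurable event of a finite index set the truncated sums stabilise; elsewhere
  the sum has its default value 0, to which the approximants are set as well.\<close>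

lemma borel_measurable_random_sum:
  fixes f :: "nat \<Rightarrow> 'a \<Rightarrow> 'b::{second_countable_topology, real_normed_vector}"
  assumes Q[measurable]: "\<And>j. Measurable.pred M (Q j)" and f[measurable]: "\<And>j. f j \<in> borel_measurable M"
  shows "(\<lambda>\<omega>. \<Sum> j\<in>{j. Q j \<omega>}. f j \<omega>) \<in> borel_measurable M"
proof (rule borel_measurable_LIMSEQ_metric)
  have [measurable]: "Measurable.pred M (\<lambda>\<omega>. finite {j. Q j \<omega>})"
    unfolding finite_nat_set_iff_bounded Ball_def mem_Collect_eq by measurable
  let ?h = "\<lambda>m \<omega>. if finite {j. Q j \<omega>} then \<Sum> j<m. (if Q j \<omega> then f j \<omega> else 0) else 0"
  show "?h m \<in> borel_measurable M" for m by measurable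
  show "(\<lambda>m. ?h m \<omega>) \<longlonglongrightarrow> (\<Sum> j\<in>{j. Q j \<omega>}. f j \<omega>)" for \<omega>
  proof (cases "finite {j. Q j \<omega>}")
    case True
    then obtain k where k: "{j. Q j \<omega>} \<subseteq> {..<k}" by (auto simp: finite_nat_set_iff_bounded)
    have "?h m \<omega> = (\<Sum> j\<in>{j. Q j \<omega>}. f j \<omega>)" if "m \<ge> k" for m
      using True k that by (simp, intro sum.mono_neutral_cong_right) auto
    then show ?thesis by (intro tendsto_eventually eventually_sequentiallyI[of k])
  qed simp
qed

lemma borel_measurable_random_prod:
  fixes f :: "nat \<Rightarrow> 'a \<Rightarrow> 'b::{second_countable_topology, real_normed_field}"
  assumes Q[measurable]: "\<And>j. Measurable.pred M (Q j)" and f[measurable]: "\<And>j. f j \<in> borel_measurable M"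
  shows "(\<lambda>\<omega>. \<Prod> j\<in>{j. Q j \<omega>}. f j \<omega>) \<in> borel_measurable M"
proof (rule borel_measurable_LIMSEQ_metric)
  have [measurable]: "Measurable.pred M (\<lambda>\<omega>. finite {j. Q j \<omega>})"
    unfolding finite_nat_set_iff_bounded Ball_def mem_Collect_eq by measurable
  let ?h = "\<lambda>m \<omega>. if finite {j. Q j \<omega>} then \<Prod> j<m. (if Q j \<omega> then f j \<omega> else 1) else 1"
  show "?h m \<in> borel_measurable M" for m by measurable
  show "(\<lambda>m. ?h m \<omega>) \<longlonglongrightarrow> (\<Prod> j\<in>{j. Q j \<omega>}. f j \<omega>)" for \<omega>
  proof (cases "finite {j. Q j \<omega>}")
    case True
    then obtain k where k: "{j. Q j \<omega>} \<subseteq> {..<k}" by (auto simp: finite_nat_set_iff_bounded)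
    have "?h m \<omega> = (\<Prod> j\<in>{j. Q j \<omega>}. f j \<omega>)" if "m \<ge> k" for m
      using True k that by (simp, intro prod.mono_neutral_cong_right) auto
    then show ?thesis by (intro tendsto_eventually eventually_sequentiallyI[of k])
  qed simp
qed

section \<open>The mean of a product over marked points\<close>

context marked_poisson
begin

context
  fixes g :: "real \<Rightarrow> 'y \<Rightarrow> complex" and c :: real
  assumes g[measurable]: "(\<lambda>(s, y). g s y) \<in> borel_measurable (borel \<Otimes>\<^sub>M N)"
    and bound: "\<And>s y. norm (g s y) \<le> 1"
    and cont: "continuous_on {0<..} (\<lambda>s. \<integral>y. g s y \<partial>N)"
begin

lemma mean_measurable: "(\<lambda>s. \<integral>y. g s y \<partial>N) \<in> borel_measurable borel"
  by measurable

lemma mean_bound: "norm (\<integral>y. g s y \<partial>N) \<le> 1"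
proof -
  have "norm (\<integral>y. g s y \<partial>N) \<le> (\<integral>y. norm (g s y) \<partial>N)" by (rule integral_norm_bound)
  also have "\<dots> \<le> (\<integral>y. 1 \<partial>N)"
    by (rule integral_mono_AE'[of N "\<lambda>_. 1"]) (use bound in auto)
  finally show ?thesis by (simp add: N.prob_space)
qed

abbreviation (input) "\<Phi> \<equiv> poisson_exponent c (\<lambda>s. \<integral>y. g s y \<partial>N)"

lemma norm_exponent_le_1: "norm (\<Phi> a) \<le> 1"
  by (rule norm_poisson_exponent_le_1[OF mean_measurable mean_bound])

text \<open>Integrating out the mark replaces \<open>g\<close> by its mean and reduces the claim to
  \<open>poisson_exponent_renewal_eq\<close>.\<close>

lemma marked_renewal_eq:
  assumes a: "0 \<le> a"
  shows "(\<integral>\<omega>. (if a + D j \<omega> \<le> c then g (a + D j \<omega>) (Y j \<omega>) * \<Phi> (a + D j \<omega>) else 1) \<partial>M) = \<Phi> a"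
proof -
  interpret E: prob_space std_exponential by (rule prob_space_std_exponential)
  interpret EN: pair_prob_space std_exponential N ..
  note mean_measurable[measurable]
  let ?k = "\<lambda>(d, y). if a + d \<le> c then g (a + d) y * \<Phi> (a + d) else 1"
  have [measurable]: "?k \<in> borel_measurable (borel \<Otimes>\<^sub>M N)" by measurable
  have kb: "norm (?k x) \<le> 1" for x
    using mult_mono[OF bound[of "a + fst x" "snd x"] norm_exponent_le_1[of "a + fst x"]]
    by (auto simp: norm_mult split: prod.split)
  have "(\<integral>\<omega>. (if a + D j \<omega> \<le> c then g (a + D j \<omega>) (Y j \<omega>) * \<Phi> (a + D j \<omega>) else 1) \<partial>M) =
      (\<integral>x. ?k x \<partial>distr M (borel \<Otimes>\<^sub>M N) (\<lambda>\<omega>. (D j \<omega>, Y j \<omega>)))"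
    by (subst integral_distr[OF measurable_DY]) auto
  also have "\<dots> = (\<integral>x. ?k x \<partial>(std_exponential \<Otimes>\<^sub>M N))" unfolding law ..
  also have "\<dots> = (\<integral>d. (\<integral>y. ?k (d, y) \<partial>N) \<partial>std_exponential)"
  proof (rule EN.integral_fst'[symmetric])
    have "?k \<in> borel_measurable (std_exponential \<Otimes>\<^sub>M N)"
      by (subst measurable_cong_sets[OF sets_pair_measure_cong[OF sets_density refl] refl]) 
         (simp add: measurable_cong_sets[OF sets_pair_measure_cong[OF sets_lborel refl] refl])
    then show "integrable (std_exponential \<Otimes>\<^sub>M N) ?k"
      by (rule EN.P.integrable_const_bound[where B=1, rotated]) (use kb in auto)
  qed
  also have "\<dots> = (\<integral>d. (if a + d \<le> c then (\<integral>y. g (a + d) y \<partial>N) * \<Phi> (a + d) else 1) \<partial>std_exponential)"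
    by (intro Bochner_Integration.integral_cong) (auto simp: N.prob_space)
  also have "\<dots> = \<Phi> a"
    by (rule poisson_exponent_renewal_eq[OF mean_measurable mean_bound cont a])
  finally show ?thesis .
qed

text \<open>The value 1 beyond c lets products over the deterministic range j < m stand in for
  products over the random set of points up to c.\<close>

definition stopped_factor :: "nat \<Rightarrow> 'a \<Rightarrow> complex" where
  "stopped_factor j \<omega> = (if Gam D j \<omega> \<le> c then g (Gam D j \<omega>) (Y j \<omega>) else 1)"

lemma stopped_factor_measurable [measurable]: "random_variable borel (stopped_factor j)"
  unfolding stopped_factor_def by measurable

lemma norm_stopped_factor_le_1: "norm (stopped_factor j \<omega>) \<le> 1"
  unfolding stopped_factor_def using bound by simp

text \<open>Multiplying the partial product by the conditional expectation of the remaining factors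
  gives a martingale; only the constancy of its mean is needed.\<close>

lemma martingale_step:
  "(\<integral>\<omega>. (\<Prod>j<Suc m. stopped_factor j \<omega>) * \<Phi> (\<Sum>i<Suc m. D i \<omega>) \<partial>M) =
   (\<integral>\<omega>. (\<Prod>j<m. stopped_factor j \<omega>) * \<Phi> (\<Sum>i<m. D i \<omega>) \<partial>M)"
proof -
  note mean_measurable[measurable]
  let ?L = "(borel :: real measure) \<Otimes>\<^sub>M N"
  define X where "X A \<omega> = restrict (\<lambda>j. (D j \<omega>, Y j \<omega>)) A" for A \<omega>
  have ind: "indep_var (PiM {..<m} (\<lambda>_. ?L)) (X {..<m}) (PiM {m} (\<lambda>_. ?L)) (X {m})"
    unfolding X_def by (rule indep_var_restrict[OF indep]) auto
  \<comment> \<open>\<open>pr\<close> is the partial product as a function of the m past gap and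
    mark pairs. \<open>k\<close> is what pair number m contributes, prediction included, when time
    \<open>a\<close> has elapsed.\<close>
  define pr where "pr x = (\<Prod>j<m. if (\<Sum>i\<le>j. fst (x i)) \<le> c then g (\<Sum>i\<le>j. fst (x i)) (snd (x j)) else 1)"
    for x :: "nat \<Rightarrow> real \<times> 'y"
  define k where "k a w = (if a + fst w \<le> c then g (a + fst w) (snd w) * \<Phi> (a + fst w) else 1)" for a w
  define f where "f z = pr (fst z) * k (\<Sum>i<m. fst (fst z i)) (snd z m)" for z
  have comp[measurable]: "(\<lambda>x. x i) \<in> PiM {..<m} (\<lambda>_. ?L) \<rightarrow>\<^sub>M ?L" if "i < m" for i
    using that by (intro measurable_component_singleton) auto
  have sums[measurable]: "(\<lambda>x. \<Sum>i\<le>j. fst (x i)) \<in> borel_measurable (PiM {..<m} (\<lambda>_. ?L))" if "j < m" for j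
  proof (rule borel_measurable_sum)
    show "(\<lambda>x. fst (x i)) \<in> borel_measurable (PiM {..<m} (\<lambda>_. ?L))" if "i \<in> {..j}" for i
      using that \<open>j < m\<close> by (intro measurable_compose[OF comp measurable_fst]) auto
  qed
  have sums'[measurable]: "(\<lambda>x. \<Sum>i<m. fst (x i)) \<in> borel_measurable (PiM {..<m} (\<lambda>_. ?L))"
  proof (rule borel_measurable_sum)
    show "(\<lambda>x. fst (x i)) \<in> borel_measurable (PiM {..<m} (\<lambda>_. ?L))" if "i \<in> {..<m}" for i
      using that by (intro measurable_compose[OF comp measurable_fst]) auto
  qed
  have pr[measurable]: "pr \<in> borel_measurable (PiM {..<m} (\<lambda>_. ?L))"
    unfolding pr_def
  proof (rule borel_measurable_prod)
    fix j assume "j \<in> {..<m}"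
    then have [measurable]: "(\<lambda>x. \<Sum>i\<le>j. fst (x i)) \<in> borel_measurable (PiM {..<m} (\<lambda>_. ?L))"
      "(\<lambda>x. snd (x j)) \<in> PiM {..<m} (\<lambda>_. ?L) \<rightarrow>\<^sub>M N"
      by (auto intro: sums measurable_compose[OF comp measurable_snd])
    show "(\<lambda>x. if (\<Sum>i\<le>j. fst (x i)) \<le> c then g (\<Sum>i\<le>j. fst (x i)) (snd (x j)) else 1)
       \<in> borel_measurable (PiM {..<m} (\<lambda>_. ?L))"
      by measurable
  qed
  have k[measurable]: "(\<lambda>(a, w). k a w) \<in> borel_measurable (borel \<Otimes>\<^sub>M ?L)"
    unfolding k_def by measurable
  have comp_m[measurable]: "(\<lambda>x. x m) \<in> PiM {m} (\<lambda>_. ?L) \<rightarrow>\<^sub>M ?L"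
    by (intro measurable_component_singleton) auto
  have f: "f \<in> borel_measurable (PiM {..<m} (\<lambda>_. ?L) \<Otimes>\<^sub>M PiM {m} (\<lambda>_. ?L))"
  proof -
    have "(\<lambda>z. (\<Sum>i<m. fst (fst z i))) \<in> borel_measurable (PiM {..<m} (\<lambda>_. ?L) \<Otimes>\<^sub>M PiM {m} (\<lambda>_. ?L))"
      using measurable_compose[OF measurable_fst sums'] .
    moreover have "(\<lambda>z. snd z m) \<in> (PiM {..<m} (\<lambda>_. ?L) \<Otimes>\<^sub>M PiM {m} (\<lambda>_. ?L)) \<rightarrow>\<^sub>M ?L"
      using measurable_compose[OF measurable_snd comp_m] .
    ultimately have "(\<lambda>z. k (\<Sum>i<m. fst (fst z i)) (snd z m)) \<in> borel_measurable (PiM {..<m} (\<lambda>_. ?L) \<Otimes>\<^sub>M PiM {m} (\<lambda>_. ?L))"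
      using measurable_compose[OF measurable_Pair k] by simp
    then show ?thesis
      unfolding f_def by (intro borel_measurable_times measurable_compose[OF measurable_fst pr])
  qed
  have kb: "norm (k a w) \<le> 1" for a w
    unfolding k_def using mult_mono[OF bound norm_exponent_le_1] by (simp add: norm_mult)
  have prb: "norm (pr x) \<le> 1" for x
    unfolding pr_def prod_norm[symmetric] using bound by (intro prod_le_1) auto
  have fb: "norm (f z) \<le> 1" for z
    unfolding f_def using mult_mono[OF prb kb] by (simp add: norm_mult)
  have pr_X: "pr (X {..<m} \<omega>) = (\<Prod>j<m. stopped_factor j \<omega>)" for \<omega>
    unfolding pr_def stopped_factor_def
  proof (intro prod.cong refl)
    fix j assume "j \<in> {..<m}"
    then have "(\<Sum>i\<le>j. fst (X {..<m} \<omega> i)) = Gam D j \<omega>" "snd (X {..<m} \<omega> j) = Y j \<omega>"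
      unfolding Gam_def X_def by (auto intro!: sum.cong)
    then show "(if (\<Sum>i\<le>j. fst (X {..<m} \<omega> i)) \<le> c then g (\<Sum>i\<le>j. fst (X {..<m} \<omega> i)) (snd (X {..<m} \<omega> j)) else 1) =
        (if Gam D j \<omega> \<le> c then g (Gam D j \<omega>) (Y j \<omega>) else 1)" by simp
  qed
  have sum_X: "(\<Sum>i<m. fst (X {..<m} \<omega> i)) = (\<Sum>i<m. D i \<omega>)" for \<omega>
    unfolding X_def by (auto intro!: sum.cong)
  have f_X: "f (X {..<m} \<omega>, X {m} \<omega>') = (\<Prod>j<m. stopped_factor j \<omega>) *
     (if (\<Sum>i<m. D i \<omega>) + D m \<omega>' \<le> c then g ((\<Sum>i<m. D i \<omega>) + D m \<omega>') (Y m \<omega>') * \<Phi> ((\<Sum>i<m. D i \<omega>) + D m \<omega>') else 1)" for \<omega> \<omega>'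
    unfolding f_def fst_conv pr_X sum_X unfolding k_def X_def by simp
  \<comment> \<open>Once \<open>Gam D m\<close> exceeds c, the new stopped factor and the prediction
    are both 1, in agreement with the else branch.\<close>
  have "(\<Prod>j<Suc m. stopped_factor j \<omega>) * \<Phi> (\<Sum>i<Suc m. D i \<omega>) = f (X {..<m} \<omega>, X {m} \<omega>)" for \<omega>
    unfolding f_X
    by (auto simp: stopped_factor_def[of m] Gam_def lessThan_Suc_atMost[symmetric] poisson_exponent_eq_1)
  then have "(\<integral>\<omega>. (\<Prod>j<Suc m. stopped_factor j \<omega>) * \<Phi> (\<Sum>i<Suc m. D i \<omega>) \<partial>M) =
      (\<integral>\<omega>. f (X {..<m} \<omega>, X {m} \<omega>) \<partial>M)" by simp
  also have "\<dots> = (\<integral>\<omega>. (\<integral>\<omega>'. f (X {..<m} \<omega>, X {m} \<omega>') \<partial>M) \<partial>M)"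
    by (rule indep_var_expectation_iterated[OF ind f fb])
  also have "\<dots> = (\<integral>\<omega>. (\<Prod>j<m. stopped_factor j \<omega>) * (\<integral>\<omega>'. (if (\<Sum>i<m. D i \<omega>) + D m \<omega>' \<le> c then
        g ((\<Sum>i<m. D i \<omega>) + D m \<omega>') (Y m \<omega>') * \<Phi> ((\<Sum>i<m. D i \<omega>) + D m \<omega>') else 1) \<partial>M) \<partial>M)"
    unfolding f_X by simp
  also have "\<dots> = (\<integral>\<omega>. (\<Prod>j<m. stopped_factor j \<omega>) * \<Phi> (\<Sum>i<m. D i \<omega>) \<partial>M)"
  proof (rule integral_cong_AE)
    \<comment> \<open>Positive gaps make the elapsed time nonnegative, as the renewal equation
      requires.\<close>
    have "AE \<omega> in M. \<forall>i. 0 < D i \<omega>" using AE_D_pos by (simp add: AE_all_countable)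
    then show "AE \<omega> in M. (\<Prod>j<m. stopped_factor j \<omega>) * (\<integral>\<omega>'. (if (\<Sum>i<m. D i \<omega>) + D m \<omega>' \<le> c then
        g ((\<Sum>i<m. D i \<omega>) + D m \<omega>') (Y m \<omega>') * \<Phi> ((\<Sum>i<m. D i \<omega>) + D m \<omega>') else 1) \<partial>M) =
        (\<Prod>j<m. stopped_factor j \<omega>) * \<Phi> (\<Sum>i<m. D i \<omega>)"
    proof eventually_elim
      case (elim \<omega>)
      then have "0 \<le> (\<Sum>i<m. D i \<omega>)" by (intro sum_nonneg) (auto intro: less_imp_le)
      then show ?case by (simp only: marked_renewal_eq)
    qed
  qed measurable
  finally show ?thesis .
qed

text \<open>For m = 0 the martingale is the constant \<Phi> 0. Almost surely it equals the full
  product from some m on, and as it is bounded by 1 the constant mean passes to the limit.\<close>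

theorem expectation_prod_marks:
  assumes c: "0 \<le> c"
  shows "(\<integral>\<omega>. (\<Prod>j\<in>{j. Gam D j \<omega> \<le> c}. g (Gam D j \<omega>) (Y j \<omega>)) \<partial>M) = \<Phi> 0"
proof -
  note mean_measurable[measurable]
  let ?M = "\<lambda>m \<omega>. (\<Prod>j<m. stopped_factor j \<omega>) * \<Phi> (\<Sum>i<m. D i \<omega>)"
  have const: "(\<integral>\<omega>. ?M m \<omega> \<partial>M) = \<Phi> 0" for m
  proof (induction m)
    case 0
    show ?case by (simp add: prob_space)
  next
    case (Suc m)
    then show ?case using martingale_step[of m] by simp
  qed
  let ?P = "\<lambda>\<omega>. \<Prod>j\<in>{j. Gam D j \<omega> \<le> c}. g (Gam D j \<omega>) (Y j \<omega>)"
  have AE: "AE \<omega> in M. eventually (\<lambda>m. ?M m \<omega> = ?P \<omega>) sequentially"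
    using AE_eventually_Gam_gt[of c]
  proof eventually_elim
    case (elim \<omega>)
    then obtain m0 where m0: "\<And>j. j \<ge> m0 \<Longrightarrow> c < Gam D j \<omega>" by (auto simp: eventually_sequentially)
    \<comment> \<open>The elapsed time after m gaps is \<open>Gam D (m - 1)\<close>, hence the shift
      by one.\<close>
    have "?M m \<omega> = ?P \<omega>" if "m \<ge> Suc m0" for m
    proof -
      define l where "l = m - 1"
      then have l: "m = Suc l" "l \<ge> m0" using that by auto
      have "(\<Sum>i<m. D i \<omega>) = Gam D l \<omega>" by (simp add: Gam_def l lessThan_Suc_atMost)
      then have "\<Phi> (\<Sum>i<m. D i \<omega>) = 1" using m0[OF l(2)] by (simp add: poisson_exponent_eq_1)
      moreover have "(\<Prod>j<m. stopped_factor j \<omega>) = ?P \<omega>"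
      proof (rule prod.mono_neutral_cong_right)
        show "{j. Gam D j \<omega> \<le> c} \<subseteq> {..<m}"
          using m0 that by (force simp: not_le[symmetric])
      qed (auto simp: stopped_factor_def)
      ultimately show ?thesis by simp
    qed
    then show ?case unfolding eventually_sequentially by blast
  qed
  have "(\<lambda>m. \<integral>\<omega>. ?M m \<omega> \<partial>M) \<longlonglongrightarrow> (\<integral>\<omega>. ?P \<omega> \<partial>M)"
  proof (rule integral_dominated_convergence[where w="\<lambda>_. 1"])
    show "AE \<omega> in M. (\<lambda>m. ?M m \<omega>) \<longlonglongrightarrow> ?P \<omega>"
      using AE by eventually_elim (rule tendsto_eventually)
    have "norm (\<Prod>j<m. stopped_factor j \<omega>) \<le> 1" for m \<omega>
      unfolding prod_norm[symmetric] using norm_stopped_factor_le_1 by (intro prod_le_1) auto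
    then show "AE \<omega> in M. norm (?M m \<omega>) \<le> 1" for m
      using mult_mono[OF _ norm_exponent_le_1] by (fastforce simp: norm_mult)
    show "random_variable borel ?P"
      by (intro borel_measurable_random_prod) measurable
  qed measurable
  then have "(\<lambda>m::nat. \<Phi> 0) \<longlonglongrightarrow> (\<integral>\<omega>. ?P \<omega> \<partial>M)" unfolding const .
  then show ?thesis using LIMSEQ_unique tendsto_const by blast
qed

end

end

section \<open>Radial decomposition of the Levy measures\<close>

lemma nn_integral_pair4:
  assumes "sigma_finite_measure B" "sigma_finite_measure C" "sigma_finite_measure R"
    and f[measurable]: "f \<in> borel_measurable (A \<Otimes>\<^sub>M (B \<Otimes>\<^sub>M (C \<Otimes>\<^sub>M R)))"
  shows "(\<integral>\<^sup>+z. f z \<partial>(A \<Otimes>\<^sub>M (B \<Otimes>\<^sub>M (C \<Otimes>\<^sub>M R)))) = (\<integral>\<^sup>+a. \<integral>\<^sup>+b. \<integral>\<^sup>+c. \<integral>\<^sup>+r. f (a, b, c, r) \<partial>R \<partial>C \<partial>B \<partial>A)"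
proof -
  interpret B: sigma_finite_measure B by fact
  interpret C: sigma_finite_measure C by fact
  interpret R: sigma_finite_measure R by fact
  interpret CR: pair_sigma_finite C R ..
  interpret BCR: pair_sigma_finite B "C \<Otimes>\<^sub>M R" ..
  have "(\<integral>\<^sup>+z. f z \<partial>(A \<Otimes>\<^sub>M (B \<Otimes>\<^sub>M (C \<Otimes>\<^sub>M R)))) = (\<integral>\<^sup>+a. \<integral>\<^sup>+z. f (a, z) \<partial>(B \<Otimes>\<^sub>M (C \<Otimes>\<^sub>M R)) \<partial>A)"
    by (rule BCR.P.nn_integral_fst[symmetric]) fact
  also have "\<dots> = (\<integral>\<^sup>+a. \<integral>\<^sup>+b. \<integral>\<^sup>+z. f (a, b, z) \<partial>(C \<Otimes>\<^sub>M R) \<partial>B \<partial>A)"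
    by (intro nn_integral_cong CR.P.nn_integral_fst[symmetric]) measurable
  also have "\<dots> = (\<integral>\<^sup>+a. \<integral>\<^sup>+b. \<integral>\<^sup>+c. \<integral>\<^sup>+r. f (a, b, c, r) \<partial>R \<partial>C \<partial>B \<partial>A)"
    by (intro nn_integral_cong R.nn_integral_fst[symmetric]) measurable
  finally show ?thesis .
qed

text \<open>The joint law lists E before E', but the gap E' has to come first and E belongs to the
  mark, behind the time T. This permutes (E, E', T, (U, V)) into (E', T, E, (U, V)).\<close>

lemma distr_pair_move_first:
  assumes "sigma_finite_measure A" "sigma_finite_measure B" "sigma_finite_measure C" "sigma_finite_measure R"
  shows "distr (A \<Otimes>\<^sub>M (B \<Otimes>\<^sub>M (C \<Otimes>\<^sub>M R))) (B \<Otimes>\<^sub>M (C \<Otimes>\<^sub>M (A \<Otimes>\<^sub>M R))) (\<lambda>(a, b, c, r). (b, c, a, r)) =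
    B \<Otimes>\<^sub>M (C \<Otimes>\<^sub>M (A \<Otimes>\<^sub>M R))" (is "distr ?S ?T ?f = ?T")
proof (rule measure_eqI)
  interpret A: sigma_finite_measure A by fact
  interpret B: sigma_finite_measure B by fact
  interpret C: sigma_finite_measure C by fact
  interpret R: sigma_finite_measure R by fact
  interpret AB: pair_sigma_finite A B ..
  interpret AC: pair_sigma_finite A C ..
  fix X assume "X \<in> sets (distr ?S ?T ?f)"
  then have [measurable]: "X \<in> sets ?T" by simp
  have [measurable]: "?f \<in> ?S \<rightarrow>\<^sub>M ?T" by measurable
  have "emeasure (distr ?S ?T ?f) X = (\<integral>\<^sup>+z. indicator X z \<partial>distr ?S ?T ?f)"
    by simp
  also have "\<dots> = (\<integral>\<^sup>+z. indicator X (?f z) \<partial>?S)"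
    by (subst nn_integral_distr) auto
  also have "\<dots> = (\<integral>\<^sup>+a. \<integral>\<^sup>+b. \<integral>\<^sup>+c. \<integral>\<^sup>+r. indicator X (b, c, a, r) \<partial>R \<partial>C \<partial>B \<partial>A)"
    by (subst nn_integral_pair4) (use assms in auto)
  also have "\<dots> = (\<integral>\<^sup>+b. \<integral>\<^sup>+a. \<integral>\<^sup>+c. \<integral>\<^sup>+r. indicator X (b, c, a, r) \<partial>R \<partial>C \<partial>A \<partial>B)"
    by (rule AB.Fubini'[symmetric]) measurable
  also have "\<dots> = (\<integral>\<^sup>+b. \<integral>\<^sup>+c. \<integral>\<^sup>+a. \<integral>\<^sup>+r. indicator X (b, c, a, r) \<partial>R \<partial>A \<partial>C \<partial>B)"
    by (intro nn_integral_cong AC.Fubini'[symmetric]) measurable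
  also have "\<dots> = (\<integral>\<^sup>+z. indicator X z \<partial>?T)"
    by (rule nn_integral_pair4[symmetric]) (use assms in auto)
  also have "\<dots> = emeasure ?T X" by simp
  finally show "emeasure (distr ?S ?T ?f) X = emeasure ?T X" .
qed simp

text \<open>Countable additivity of the set functions defining \<open>Qmeas\<close> and
  \<open>levyM\<close> is obtained by exhibiting a genuine measure with the same values.\<close>

lemma measure_of_borel_eqI:
  assumes "sets B = sets borel" and "\<And>A. A \<in> sets borel \<Longrightarrow> \<mu> A = emeasure B A"
  shows "measure_of UNIV (sets borel) \<mu> = B"
proof -
  have "measure_of UNIV (sets borel) \<mu> = measure_of UNIV (sets borel) (emeasure B)"
    by (rule measure_of_eq) (use assms(2) sets.sigma_sets_eq[of borel] in auto)
  also have "\<dots> = measure_of (space B) (sets B) (emeasure B)"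
    using assms(1) sets_eq_imp_space_eq[OF assms(1)] by simp
  finally show ?thesis by (simp add: measure_of_of_measure)
qed

lemma powr_less_powr_neg_iff:
  fixes x y a :: real
  assumes "0 < x" "0 < y" "0 < a"
  shows "x powr (- a) < y powr (- a) \<longleftrightarrow> y < x"
proof
  show "y < x \<Longrightarrow> x powr (- a) < y powr (- a)"
    using assms by (intro powr_less_mono2_neg) auto
  show "y < x" if "x powr (- a) < y powr (- a)"
    using that powr_mono2'[of "- a" x y] assms by (cases "y < x") auto
qed

lemma sigma_sets_borel: "sigma_sets UNIV (sets borel) = sets borel"
  by (metis sets.sigma_sets_eq space_borel)

section \<open>The Pareto law and sets in polar form\<close>

text \<open>The two laws have the same tail (max x y / x)^(-\<alpha>) beyond every level y. This is
  where the factor r^(-\<alpha>-1) of the Levy density comes from.\<close>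

lemma pareto_eq_distr_uniform:
  fixes \<alpha> x :: real
  assumes \<alpha>: "0 < \<alpha>" and x: "0 < x"
  shows "distr (uniform_measure lborel {0<..<1}) borel (\<lambda>w. x * w powr (- 1 / \<alpha>)) =
    density lborel (\<lambda>r. indicator {x<..} r * ennreal (\<alpha> * x powr \<alpha> * r powr (- \<alpha> - 1)))" (is "?L = ?R")
proof (rule measure_eqI_lessThan)
  have L: "emeasure ?L {y<..} = ennreal ((max x y / x) powr (- \<alpha>))" for y
  proof -
    \<comment> \<open>Both laws live on (x, \<infinity>), so a level y below x may be raised to
      x.\<close>
    define m where "m = max x y"
    have m: "x \<le> m" "0 < m" using x unfolding m_def by auto
    have iff: "y < x * w powr (- 1 / \<alpha>) \<longleftrightarrow> w < (m / x) powr (- \<alpha>)" if w: "0 < w" "w < 1" for w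
    proof -
      have w': "w = (w powr (- 1 / \<alpha>)) powr (- \<alpha>)" using w \<alpha> by (simp add: powr_powr)
      have "1 < w powr (- 1 / \<alpha>)"
        using w \<alpha> powr_less_powr_neg_iff[of 1 w "1 / \<alpha>"] by simp
      then have "y < x * w powr (- 1 / \<alpha>) \<longleftrightarrow> m < x * w powr (- 1 / \<alpha>)"
        unfolding m_def using x by auto
      also have "\<dots> \<longleftrightarrow> m / x < w powr (- 1 / \<alpha>)" using x by (simp add: field_simps)
      also have "\<dots> \<longleftrightarrow> (w powr (- 1 / \<alpha>)) powr (- \<alpha>) < (m / x) powr (- \<alpha>)"
        using powr_less_powr_neg_iff[of "w powr (- 1 / \<alpha>)" "m / x" \<alpha>] \<alpha> m w x by simp
      finally show ?thesis using w' by simp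
    qed
    have le1: "(m / x) powr (- \<alpha>) \<le> 1"
      using m x \<alpha> powr_mono2[of \<alpha> 1 "m / x"] by (simp add: powr_minus inverse_le_1_iff)
    have "emeasure ?L {y<..} = emeasure (uniform_measure lborel {0<..<1}) {w. y < x * w powr (- 1 / \<alpha>)}"
      by (subst emeasure_distr) (simp_all add: vimage_def del: emeasure_uniform_measure)
    also have "\<dots> = emeasure lborel ({0<..<1} \<inter> {w. y < x * w powr (- 1 / \<alpha>)}) / emeasure lborel {0<..<1::real}"
      by (rule emeasure_uniform_measure) measurable
    also have "{0<..<1} \<inter> {w. y < x * w powr (- 1 / \<alpha>)} = {0<..<(m / x) powr (- \<alpha>)}"
      using iff le1 by (auto simp: subset_iff)
    finally show ?thesis using m x unfolding m_def by (simp add: divide_ennreal_def)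
  qed
  have R: "emeasure ?R {y<..} = ennreal ((max x y / x) powr (- \<alpha>))" for y
  proof -
    define m where "m = max x y"
    have m: "x \<le> m" "0 < m" using x unfolding m_def by auto
    have "emeasure ?R {y<..} = (\<integral>\<^sup>+r. (indicator {x<..} r * ennreal (\<alpha> * x powr \<alpha> * r powr (- \<alpha> - 1))) * indicator {y<..} r \<partial>lborel)"
      by (rule emeasure_density) auto
    also have "\<dots> = (\<integral>\<^sup>+r. ennreal (\<alpha> * x powr \<alpha> * r powr (- \<alpha> - 1)) * indicator {m..} r \<partial>lborel)"
    proof (rule nn_integral_cong_AE)
      show "AE r in lborel. (indicator {x<..} r * ennreal (\<alpha> * x powr \<alpha> * r powr (- \<alpha> - 1))) * indicator {y<..} r =
          ennreal (\<alpha> * x powr \<alpha> * r powr (- \<alpha> - 1)) * indicator {m..} r"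
        using AE_lborel_singleton[of m] by eventually_elim (auto simp: indicator_def m_def max_def)
    qed
    also have "\<dots> = ennreal (0 - (- (x powr \<alpha> * m powr (- \<alpha>))))"
    proof (rule nn_integral_FTC_atLeast)
      fix r assume "m \<le> r"
      then have r: "0 < r" using m by simp
      show "((\<lambda>r. - (x powr \<alpha> * r powr (- \<alpha>))) has_real_derivative \<alpha> * x powr \<alpha> * r powr (- \<alpha> - 1)) (at r)"
        using r by (auto intro!: derivative_eq_intros simp: powr_diff field_simps)
      show "0 \<le> \<alpha> * x powr \<alpha> * r powr (- \<alpha> - 1)" using \<alpha> by simp
    next
      have "((\<lambda>r. r powr (- \<alpha>)) \<longlongrightarrow> 0) at_top"
        using \<alpha> by (intro tendsto_neg_powr filterlim_ident) auto
      then have "((\<lambda>r. - (x powr \<alpha> * r powr (- \<alpha>))) \<longlongrightarrow> - (x powr \<alpha> * 0)) at_top"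
        by (intro tendsto_intros)
      then show "((\<lambda>r. - (x powr \<alpha> * r powr (- \<alpha>))) \<longlongrightarrow> 0) at_top" by simp
    qed auto
    also have "0 - (- (x powr \<alpha> * m powr (- \<alpha>))) = (m / x) powr (- \<alpha>)"
      using m x by (simp add: powr_minus powr_divide field_simps)
    finally show ?thesis unfolding m_def .
  qed
  show "emeasure ?L {y<..} = emeasure ?R {y<..}" "emeasure ?L {y<..} < \<infinity>" for y
    unfolding L R by simp_all
qed auto

lemma nn_integral_pareto:
  fixes \<alpha> x :: real
  assumes \<alpha>: "0 < \<alpha>" and x: "0 < x" and [measurable]: "f \<in> borel_measurable borel"
  shows "(\<integral>\<^sup>+w. f (x * w powr (- 1 / \<alpha>)) \<partial>uniform_measure lborel {0<..<1}) =
    ennreal (\<alpha> * x powr \<alpha>) * (\<integral>\<^sup>+r. indicator {x<..} r * ennreal (r powr (- \<alpha> - 1)) * f r \<partial>lborel)"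
proof -
  have "(\<integral>\<^sup>+w. f (x * w powr (- 1 / \<alpha>)) \<partial>uniform_measure lborel {0<..<1}) =
      (\<integral>\<^sup>+r. f r \<partial>distr (uniform_measure lborel {0<..<1}) borel (\<lambda>w. x * w powr (- 1 / \<alpha>)))"
    by (subst nn_integral_distr) auto
  also have "\<dots> = (\<integral>\<^sup>+r. indicator {x<..} r * ennreal (\<alpha> * x powr \<alpha> * r powr (- \<alpha> - 1)) * f r \<partial>lborel)"
    unfolding pareto_eq_distr_uniform[OF \<alpha> x] by (subst nn_integral_density) auto
  also have "\<dots> = (\<integral>\<^sup>+r. ennreal (\<alpha> * x powr \<alpha>) * (indicator {x<..} r * ennreal (r powr (- \<alpha> - 1)) * f r) \<partial>lborel)"
    using \<alpha> by (intro nn_integral_cong) (simp add: ennreal_mult mult_ac)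
  finally show ?thesis by (simp add: nn_integral_cmult)
qed

lemma radial_set_eq:
  fixes B :: "'a::real_normed_vector set"
  assumes "0 < x" "B \<subseteq> sphere 0 1"
  shows "radial_set x B = {y. x < norm y \<and> y /\<^sub>R norm y \<in> B}"
proof (intro equalityI subsetI)
  fix y assume "y \<in> radial_set x B"
  then obtain r u where y: "y = r *\<^sub>R u" "x < r" "u \<in> B" unfolding radial_set_def by auto
  then have "norm u = 1" using assms(2) by auto
  then show "y \<in> {y. x < norm y \<and> y /\<^sub>R norm y \<in> B}" using y assms(1) by simp
next
  fix y assume "y \<in> {y. x < norm y \<and> y /\<^sub>R norm y \<in> B}"
  moreover from this have "y = norm y *\<^sub>R (y /\<^sub>R norm y)" using assms(1) by (cases "y = 0") auto
  ultimately show "y \<in> radial_set x B" unfolding radial_set_def by blast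
qed

lemma radial_set_borel:
  fixes B :: "'a::euclidean_space set"
  assumes "0 < x" "B \<subseteq> sphere 0 1" and [measurable]: "B \<in> sets borel"
  shows "radial_set x B \<in> sets borel"
  unfolding radial_set_eq[OF assms(1,2)] by measurable


section \<open>The law of V and the tempered stable Levy measure\<close>

locale tempered_stable =
  fixes \<sigma> :: "'a::euclidean_space measure" and Qk :: "'a \<Rightarrow> real measure" and p \<alpha> T :: real
  assumes p: "0 < p" and \<alpha>: "0 < \<alpha>" and T: "0 < T"
    and \<sigma>fin: "finite_measure \<sigma>" and \<sigma>sets: "sets \<sigma> = sets borel"
    and \<sigma>sphere: "emeasure \<sigma> (UNIV - sphere 0 1) = 0"
    and \<sigma>nz: "emeasure \<sigma> UNIV \<noteq> 0"
    and Qk_kernel: "Qk \<in> borel \<rightarrow>\<^sub>M prob_algebra borel"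
    and Qpos: "\<forall>u. emeasure (Qk u) {..0} = 0"
begin

sublocale \<sigma>: finite_measure \<sigma> by (rule \<sigma>fin)

abbreviation sn :: real where "sn \<equiv> measure \<sigma> UNIV"

lemma space_\<sigma> [simp]: "space \<sigma> = UNIV"
  using sets_eq_imp_space_eq[OF \<sigma>sets] by simp

lemma emeasure_\<sigma>: "emeasure \<sigma> UNIV = ennreal sn"
  by (rule \<sigma>.emeasure_eq_measure)

lemma sn_pos: "0 < sn"
  using \<sigma>nz unfolding emeasure_\<sigma> by (simp add: zero_less_measure_iff)

lemma measurable_\<sigma> [simp]: "measurable \<sigma> = measurable borel"
  by (intro ext measurable_cong_sets \<sigma>sets refl)

lemma Qk_prob: "prob_space (Qk u)" and sets_Qk [simp, measurable_cong]: "sets (Qk u) = sets borel"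
  using measurable_space[OF Qk_kernel, of u] by (auto simp: space_prob_algebra)

lemma space_Qk [simp]: "space (Qk u) = UNIV"
  using sets_eq_imp_space_eq[OF sets_Qk] by simp

lemma Qk_subprob [measurable]: "Qk \<in> borel \<rightarrow>\<^sub>M subprob_algebra borel"
  by (rule measurable_prob_algebraD[OF Qk_kernel])

lemma AE_Qk_pos: "AE s in Qk u. 0 < s"
proof (rule AE_I)
  show "{s \<in> space (Qk u). \<not> 0 < s} \<subseteq> {..0}" by auto
qed (use Qpos in auto)

lemma AE_\<sigma>_sphere: "AE u in \<sigma>. norm u = 1"
proof (rule AE_I)
  show "{u \<in> space \<sigma>. norm u \<noteq> 1} \<subseteq> UNIV - sphere 0 1" by auto
qed (use \<sigma>sphere \<sigma>sets in auto)

text \<open>The restriction to s > 0 in \<open>Qmeas\<close> costs no mass because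
  \<open>Qk u\<close> lives on (0, \<infinity>). So \<open>Qmeas\<close> is the \<sigma>-mixture of
  the images of \<open>Qk u\<close> under scaling of u, and integrals against it become
  iterated.\<close>

lemma Qmeas_eq_bind: "Qmeas \<sigma> Qk = \<sigma> \<bind> (\<lambda>u. distr (Qk u) borel (\<lambda>s. s *\<^sub>R u))"
  and kernel_scaled [measurable]: "(\<lambda>u. distr (Qk u) borel (\<lambda>s. s *\<^sub>R u)) \<in> borel \<rightarrow>\<^sub>M subprob_algebra borel"
proof -
  show k[measurable]: "(\<lambda>u. distr (Qk u) borel (\<lambda>s. s *\<^sub>R u)) \<in> borel \<rightarrow>\<^sub>M subprob_algebra borel"
    by (rule measurable_distr2[OF _ Qk_subprob]) measurable
  show "Qmeas \<sigma> Qk = \<sigma> \<bind> (\<lambda>u. distr (Qk u) borel (\<lambda>s. s *\<^sub>R u))"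
    unfolding Qmeas_def
  proof (rule measure_of_borel_eqI)
    show "sets (\<sigma> \<bind> (\<lambda>u. distr (Qk u) borel (\<lambda>s. s *\<^sub>R u))) = sets borel"
      by (rule sets_bind) auto
    fix A :: "'a set" assume A[measurable]: "A \<in> sets borel"
    have "emeasure (Qk u) {s. 0 < s \<and> s *\<^sub>R u \<in> A} = emeasure (distr (Qk u) borel (\<lambda>s. s *\<^sub>R u)) A" for u
    proof -
      have "emeasure (distr (Qk u) borel (\<lambda>s. s *\<^sub>R u)) A = emeasure (Qk u) {s. s *\<^sub>R u \<in> A}"
        by (subst emeasure_distr) (auto intro!: arg_cong[where f="emeasure _"])
      also have "\<dots> = emeasure (Qk u) {s. 0 < s \<and> s *\<^sub>R u \<in> A}"
      proof (rule emeasure_eq_AE)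
        show "AE s in Qk u. (s \<in> {s. s *\<^sub>R u \<in> A}) = (s \<in> {s. 0 < s \<and> s *\<^sub>R u \<in> A})"
          using AE_Qk_pos[of u] by eventually_elim auto
      qed auto
      finally show ?thesis ..
    qed
    moreover have "emeasure (\<sigma> \<bind> (\<lambda>u. distr (Qk u) borel (\<lambda>s. s *\<^sub>R u))) A =
        (\<integral>\<^sup>+u. emeasure (distr (Qk u) borel (\<lambda>s. s *\<^sub>R u)) A \<partial>\<sigma>)"
      by (rule emeasure_bind[where N=borel]) auto
    ultimately show "(\<integral>\<^sup>+u. emeasure (Qk u) {s. 0 < s \<and> s *\<^sub>R u \<in> A} \<partial>\<sigma>) =
        emeasure (\<sigma> \<bind> (\<lambda>u. distr (Qk u) borel (\<lambda>s. s *\<^sub>R u))) A" by simp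
  qed
qed

definition V_law :: "'a measure" where
  "V_law = scale_measure (ennreal (1 / sn)) (Qmeas \<sigma> Qk)"

lemma sets_V_law [simp, measurable_cong]: "sets V_law = sets borel"
  unfolding V_law_def Qmeas_def by (simp add: sigma_sets_borel)

lemma nn_integral_V_law:
  assumes [measurable]: "f \<in> borel_measurable borel"
  shows "(\<integral>\<^sup>+v. f v \<partial>V_law) = ennreal (1 / sn) * (\<integral>\<^sup>+u. \<integral>\<^sup>+s. f (s *\<^sub>R u) \<partial>Qk u \<partial>\<sigma>)"
proof -
  have "(\<integral>\<^sup>+v. f v \<partial>V_law) = ennreal (1 / sn) * (\<integral>\<^sup>+v. f v \<partial>Qmeas \<sigma> Qk)"
    unfolding V_law_def
    by (rule nn_integral_scale_measure) (simp add: Qmeas_def measurable_def sigma_sets_borel assms[unfolded measurable_def, simplified])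
  also have "(\<integral>\<^sup>+v. f v \<partial>Qmeas \<sigma> Qk) = (\<integral>\<^sup>+u. \<integral>\<^sup>+v. f v \<partial>distr (Qk u) borel (\<lambda>s. s *\<^sub>R u) \<partial>\<sigma>)"
    unfolding Qmeas_eq_bind by (rule nn_integral_bind[where B=borel]) auto
  also have "\<dots> = (\<integral>\<^sup>+u. \<integral>\<^sup>+s. f (s *\<^sub>R u) \<partial>Qk u \<partial>\<sigma>)"
    by (intro nn_integral_cong nn_integral_distr) auto
  finally show ?thesis .
qed

lemma prob_space_V_law: "prob_space V_law"
proof (rule prob_spaceI)
  have [simp]: "space V_law = UNIV" using sets_eq_imp_space_eq[OF sets_V_law] by simp
  have "emeasure V_law (space V_law) = (\<integral>\<^sup>+v. 1 \<partial>V_law)" by simp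
  also have "\<dots> = ennreal (1 / sn) * (\<integral>\<^sup>+u. 1 \<partial>\<sigma>)"
    using prob_space.emeasure_space_1[OF Qk_prob] by (subst nn_integral_V_law) auto
  also have "\<dots> = ennreal (1 / sn * sn)"
    unfolding nn_integral_const space_\<sigma> emeasure_\<sigma> using sn_pos by (simp only: mult_1 ennreal_mult' divide_nonneg_nonneg zero_le_one measure_nonneg)
  also have "\<dots> = 1" using sn_pos by simp
  finally show "emeasure V_law (space V_law) = 1" .
qed

sublocale V: prob_space V_law by (rule prob_space_V_law)

lemma AE_V_law_neq_0: "AE v in V_law. v \<noteq> 0"
proof -
  have "(\<integral>\<^sup>+v. indicator {0} v \<partial>V_law) = ennreal (1 / sn) * (\<integral>\<^sup>+u. \<integral>\<^sup>+s. indicator {0} (s *\<^sub>R u) \<partial>Qk u \<partial>\<sigma>)"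
    by (rule nn_integral_V_law) auto
  also have "(\<integral>\<^sup>+u. \<integral>\<^sup>+s. indicator {0} (s *\<^sub>R u) \<partial>Qk u \<partial>\<sigma>) = (\<integral>\<^sup>+u. 0 \<partial>\<sigma>)"
  proof (rule nn_integral_cong_AE)
    show "AE u in \<sigma>. (\<integral>\<^sup>+s. indicator {0} (s *\<^sub>R u) \<partial>Qk u) = 0"
      using AE_\<sigma>_sphere
    proof eventually_elim
      case (elim u)
      have "(\<integral>\<^sup>+s. indicator {0} (s *\<^sub>R u) \<partial>Qk u) = (\<integral>\<^sup>+s. 0 \<partial>Qk u)"
      proof (rule nn_integral_cong_AE)
        show "AE s in Qk u. indicator {0} (s *\<^sub>R u) = (0 :: ennreal)"
          using AE_Qk_pos[of u] by eventually_elim (use elim in \<open>auto simp: indicator_def\<close>)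
      qed
      then show ?case by simp
    qed
  qed
  finally have "emeasure V_law {0} = 0" by simp
  then show ?thesis by (intro AE_I[where N="{0}"]) auto
qed

text \<open>Measurability along a kernel is taken from the nonnegative integral. For negative r that
  integral may be infinite, and then both integrals give the default 0.\<close>

lemma qfun_measurable [measurable]: "(\<lambda>(r, u). qfun Qk r u) \<in> borel_measurable (borel \<Otimes>\<^sub>M borel)"
proof -
  have "(\<lambda>x. integral\<^sup>N (Qk (snd x)) (\<lambda>s. ennreal (exp (- fst x * s)))) \<in> borel_measurable (borel \<Otimes>\<^sub>M borel)"
    by (rule nn_integral_measurable_subprob_algebra2[where N=borel]) measurable
  then have "(\<lambda>x. enn2real (integral\<^sup>N (Qk (snd x)) (\<lambda>s. ennreal (exp (- fst x * s))))) \<in> borel_measurable (borel \<Otimes>\<^sub>M borel)"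
    by measurable
  moreover have "qfun Qk r u = enn2real (integral\<^sup>N (Qk u) (\<lambda>s. ennreal (exp (- r * s))))" for r u
    unfolding qfun_def by (rule integral_eq_nn_integral) auto
  ultimately show ?thesis by (simp add: case_prod_beta)
qed

lemma ennreal_qfun:
  assumes "0 \<le> r"
  shows "ennreal (qfun Qk r u) = (\<integral>\<^sup>+s. ennreal (exp (- r * s)) \<partial>Qk u)"
proof -
  interpret Q: prob_space "Qk u" by (rule Qk_prob)
  have "integrable (Qk u) (\<lambda>s. exp (- r * s))"
  proof (rule Q.integrable_const_bound[where B=1])
    show "AE s in Qk u. norm (exp (- r * s)) \<le> 1"
      using AE_Qk_pos[of u] by eventually_elim (use assms in auto)
  qed auto
  then show ?thesis unfolding qfun_def by (intro nn_integral_eq_integral[symmetric]) auto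
qed

text \<open>The set function is the image, under (u, r) to r u, of the product of \<sigma> and
  Lebesgue measure with the radial density.\<close>

lemma emeasure_levyM:
  assumes "A \<in> sets borel"
  shows "emeasure (levyM p \<alpha> \<sigma> Qk) A = (\<integral>\<^sup>+u. (\<integral>\<^sup>+r. indicator {0<..} r * indicator A (r *\<^sub>R u)
              * ennreal (qfun Qk (r powr p) u * r powr (- \<alpha> - 1)) \<partial>lborel) \<partial>\<sigma>)"
proof -
  note [measurable_cong] = \<sigma>sets
  let ?w = "\<lambda>(u, r). indicator {0<..} r * ennreal (qfun Qk (r powr p) u * r powr (- \<alpha> - 1))"
  let ?B = "distr (density (\<sigma> \<Otimes>\<^sub>M lborel) ?w) borel (\<lambda>(u, r). r *\<^sub>R u)"
  have w[measurable]: "?w \<in> borel_measurable (\<sigma> \<Otimes>\<^sub>M lborel)" by measurable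
  have eq: "(\<integral>\<^sup>+u. (\<integral>\<^sup>+r. indicator {0<..} r * indicator A (r *\<^sub>R u)
       * ennreal (qfun Qk (r powr p) u * r powr (- \<alpha> - 1)) \<partial>lborel) \<partial>\<sigma>) = emeasure ?B A"
    if A[measurable]: "A \<in> sets borel" for A
  proof -
    have "emeasure ?B A = (\<integral>\<^sup>+y. indicator A y \<partial>?B)" by simp
    also have "\<dots> = (\<integral>\<^sup>+z. indicator A (case z of (u, r) \<Rightarrow> r *\<^sub>R u) \<partial>density (\<sigma> \<Otimes>\<^sub>M lborel) ?w)"
      by (rule nn_integral_distr) auto
    also have "\<dots> = (\<integral>\<^sup>+z. ?w z * indicator A (case z of (u, r) \<Rightarrow> r *\<^sub>R u) \<partial>(\<sigma> \<Otimes>\<^sub>M lborel))"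
      by (rule nn_integral_density) auto
    also have "\<dots> = (\<integral>\<^sup>+u. (\<integral>\<^sup>+r. ?w (u, r) * indicator A (r *\<^sub>R u) \<partial>lborel) \<partial>\<sigma>)"
      by (subst lborel.nn_integral_fst[symmetric]) auto
    finally show ?thesis by (simp add: mult_ac)
  qed
  have "levyM p \<alpha> \<sigma> Qk = ?B"
    unfolding levyM_def by (rule measure_of_borel_eqI) (auto simp: eq)
  then show ?thesis using eq[OF assms] by simp
qed

lemma sets_levyM [simp, measurable_cong]: "sets (levyM p \<alpha> \<sigma> Qk) = sets borel"
  unfolding levyM_def by (simp add: sigma_sets_borel)

end

section \<open>Measures determined by their values on radial sets\<close>

text \<open>For a fixed set of directions the radial sets give the tails of the norm, hence its
  finite law beyond x0. Varying the directions gives all rectangles in polar coordinates, and these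
  determine the joint law of norm and direction, from which y is recovered as a product.\<close>

lemma integral_eq_if_radial_eq:
  fixes \<mu> \<nu> :: "'a::euclidean_space measure" and f :: "'a \<Rightarrow> real"
  assumes [measurable_cong]: "sets \<mu> = sets borel" "sets \<nu> = sets borel"
    and x0: "0 < x0"
    and eq: "\<And>x B. x0 \<le> x \<Longrightarrow> B \<in> sets borel \<Longrightarrow> B \<subseteq> sphere 0 1 \<Longrightarrow>
        emeasure \<mu> (radial_set x B) = emeasure \<nu> (radial_set x B)"
    and fin: "emeasure \<mu> (radial_set x0 (sphere 0 1)) < \<infinity>"
    and f[measurable]: "f \<in> borel_measurable borel" and f0: "\<And>y. norm y \<le> x0 \<Longrightarrow> f y = 0"
  shows "(\<integral>y. f y \<partial>\<mu>) = (\<integral>y. f y \<partial>\<nu>)"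
proof -
  let ?pol = "\<lambda>y::'a. (norm y, y /\<^sub>R norm y)"
  have rect: "emeasure \<mu> {y. x0 < norm y \<and> norm y \<in> A \<and> y /\<^sub>R norm y \<in> B} =
      emeasure \<nu> {y. x0 < norm y \<and> norm y \<in> A \<and> y /\<^sub>R norm y \<in> B}"
    if A[measurable]: "A \<in> sets borel" and B[measurable]: "B \<in> sets borel" for A B
  proof -
    let ?S = "{y. x0 < norm y \<and> y /\<^sub>R norm y \<in> B}"
    let ?D = "\<lambda>\<mu>. distr (density \<mu> (indicator ?S)) borel norm"
    have D: "emeasure (?D \<mu>) A = emeasure \<mu> {y. x0 < norm y \<and> norm y \<in> A \<and> y /\<^sub>R norm y \<in> B}"
      if [measurable_cong]: "sets \<mu> = sets borel" and [measurable]: "A \<in> sets borel" for \<mu> A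
    proof -
      have [simp]: "space \<mu> = UNIV" using sets_eq_imp_space_eq[OF that(1)] by simp
      have "emeasure (?D \<mu>) A = emeasure (density \<mu> (indicator ?S)) (norm -` A)"
        by (subst emeasure_distr) auto
      also have "\<dots> = (\<integral>\<^sup>+y. indicator ?S y * indicator (norm -` A) y \<partial>\<mu>)"
      proof (rule emeasure_density)
        show "norm -` A \<in> sets \<mu>"
          using measurable_sets[of norm borel borel A] that by simp
      qed measurable
      also have "\<dots> = (\<integral>\<^sup>+y. indicator {y. x0 < norm y \<and> norm y \<in> A \<and> y /\<^sub>R norm y \<in> B} y \<partial>\<mu>)"
        by (intro nn_integral_cong) (auto simp: indicator_def)
      also have "\<dots> = emeasure \<mu> {y. x0 < norm y \<and> norm y \<in> A \<and> y /\<^sub>R norm y \<in> B}"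
        by (rule nn_integral_indicator) measurable
      finally show ?thesis .
    qed
    \<comment> \<open>Intersecting with norm y > x0 only raises the level to the maximum, so a tail
      of the norm is again a radial set at a level where the measures agree.\<close>
    have tail: "{y. x0 < norm y \<and> norm y \<in> {x<..} \<and> y /\<^sub>R norm y \<in> B} = radial_set (max x0 x) (B \<inter> sphere 0 1)" for x
    proof -
      have "norm (y /\<^sub>R norm y) = 1" if "x0 < norm y" for y :: 'a using that x0 by (cases "y = 0") auto
      then show ?thesis using x0 by (subst radial_set_eq) auto
    qed
    have "?D \<mu> = ?D \<nu>"
    proof (rule measure_eqI_lessThan)
      fix x
      have m: "emeasure (?D \<mu>) {x<..} = emeasure \<mu> (radial_set (max x0 x) (B \<inter> sphere 0 1))"
        unfolding tail[symmetric] by (rule D) (use assms in auto)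
      have n: "emeasure (?D \<nu>) {x<..} = emeasure \<nu> (radial_set (max x0 x) (B \<inter> sphere 0 1))"
        unfolding tail[symmetric] by (rule D) (use assms in auto)
      show "emeasure (?D \<mu>) {x<..} = emeasure (?D \<nu>) {x<..}"
        unfolding m n using eq[of "max x0 x" "B \<inter> sphere 0 1"] by simp
      have "emeasure \<mu> (radial_set (max x0 x) (B \<inter> sphere 0 1)) \<le> emeasure \<mu> (radial_set x0 (sphere 0 1))"
        using radial_set_borel[OF x0, of "sphere 0 1"] assms(1)
        by (intro emeasure_mono) (auto simp: radial_set_def)
      then show "emeasure (?D \<mu>) {x<..} < \<infinity>"
        using fin unfolding m by (rule order_le_less_trans)
    qed auto
    then show ?thesis using D[of \<mu> A] D[of \<nu> A] assms(1,2) A by simp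
  qed
  let ?R = "{y::'a. x0 < norm y}"
  let ?G = "\<lambda>\<mu>. distr (density \<mu> (\<lambda>y. ennreal (indicator ?R y))) (borel \<Otimes>\<^sub>M borel) ?pol"
  have G: "emeasure (?G \<mu>) (A \<times> B) = emeasure \<mu> {y. x0 < norm y \<and> norm y \<in> A \<and> y /\<^sub>R norm y \<in> B}"
    if [measurable_cong]: "sets \<mu> = sets borel" and [measurable]: "A \<in> sets borel" "B \<in> sets borel" for \<mu> A B
  proof -
    have [simp]: "space \<mu> = UNIV" using sets_eq_imp_space_eq[OF that(1)] by simp
    have m: "{y. norm y \<in> A \<and> y /\<^sub>R norm y \<in> B} \<in> sets borel" by measurable
    have "emeasure (?G \<mu>) (A \<times> B) = emeasure (density \<mu> (\<lambda>y. ennreal (indicator ?R y))) {y. norm y \<in> A \<and> y /\<^sub>R norm y \<in> B}"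
      by (subst emeasure_distr) (auto intro!: arg_cong[where f="emeasure _"])
    also have "\<dots> = (\<integral>\<^sup>+y. ennreal (indicator ?R y) * indicator {y. norm y \<in> A \<and> y /\<^sub>R norm y \<in> B} y \<partial>\<mu>)"
      by (rule emeasure_density) (use m that(1) in auto)
    also have "\<dots> = (\<integral>\<^sup>+y. indicator {y. x0 < norm y \<and> norm y \<in> A \<and> y /\<^sub>R norm y \<in> B} y \<partial>\<mu>)"
      by (intro nn_integral_cong) (auto simp: indicator_def)
    also have "\<dots> = emeasure \<mu> {y. x0 < norm y \<and> norm y \<in> A \<and> y /\<^sub>R norm y \<in> B}"
      by (rule nn_integral_indicator) measurable
    finally show ?thesis .
  qed
  have G_eq: "?G \<mu> = ?G \<nu>"
  proof (rule measure_eqI_generator_eq[OF Int_stable_pair_measure_generator[of borel borel], where A="\<lambda>_. UNIV" and \<Omega>=UNIV])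
    fix X :: "(real \<times> 'a) set" assume "X \<in> {a \<times> b |a b. a \<in> sets borel \<and> b \<in> sets borel}"
    then show "emeasure (?G \<mu>) X = emeasure (?G \<nu>) X"
      using G[of \<mu>] G[of \<nu>] rect assms(1,2) by auto
  next
    have "emeasure (?G \<mu>) (UNIV \<times> UNIV) = emeasure \<mu> {y. x0 < norm y \<and> norm y \<in> UNIV \<and> y /\<^sub>R norm y \<in> UNIV}"
      by (rule G) (use assms(1) in auto)
    also have "{y::'a. x0 < norm y \<and> norm y \<in> UNIV \<and> y /\<^sub>R norm y \<in> UNIV} = radial_set x0 (sphere 0 1)"
    proof -
      have "y /\<^sub>R norm y \<in> sphere 0 1" if "x0 < norm y" for y :: 'a using that x0 by (cases "y = 0") auto
      then show ?thesis using x0 by (subst radial_set_eq) (auto simp del: mem_sphere mem_sphere_0)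
    qed
    finally show "emeasure (?G \<mu>) UNIV \<noteq> \<infinity>" using fin by simp
  next
    show "range (\<lambda>_::nat. UNIV :: (real \<times> 'a) set) \<subseteq> {a \<times> b |a b. a \<in> sets borel \<and> b \<in> sets borel}"
    proof (intro image_subsetI CollectI exI conjI)
      show "(UNIV :: (real \<times> 'a) set) = UNIV \<times> UNIV" by simp
    qed auto
  qed (auto simp: sets_pair_measure)
  \<comment> \<open>Restricting to norms above x0 loses nothing since f vanishes below; there y is
    norm times direction.\<close>
  have int: "(\<integral>y. f y \<partial>\<mu>) = (\<integral>z. f (fst z *\<^sub>R snd z) \<partial>?G \<mu>)" if [measurable_cong]: "sets \<mu> = sets borel" for \<mu>
  proof -
    have "(\<integral>z. f (fst z *\<^sub>R snd z) \<partial>?G \<mu>) = (\<integral>y. f (norm y *\<^sub>R (y /\<^sub>R norm y)) \<partial>density \<mu> (\<lambda>y. ennreal (indicator ?R y)))"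
      by (subst integral_distr) (auto intro!: measurable_Pair)
    also have "\<dots> = (\<integral>y. indicator ?R y *\<^sub>R f (norm y *\<^sub>R (y /\<^sub>R norm y)) \<partial>\<mu>)"
      by (subst integral_density) auto
    also have "\<dots> = (\<integral>y. f y \<partial>\<mu>)"
    proof (intro Bochner_Integration.integral_cong refl)
      fix y :: 'a
      have "norm y *\<^sub>R (y /\<^sub>R norm y) = y" by (cases "y = 0") auto
      then show "indicator ?R y *\<^sub>R f (norm y *\<^sub>R (y /\<^sub>R norm y)) = f y"
        using f0[of y] by (cases "x0 < norm y") auto
    qed
    finally show ?thesis ..
  qed
  show ?thesis unfolding int[OF assms(1)] int[OF assms(2)] G_eq ..
qed

lemma powr_less_powr_iff:
  fixes x y a :: real
  assumes "0 \<le> x" "0 \<le> y" "0 < a"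
  shows "x powr a < y powr a \<longleftrightarrow> x < y"
  using assms powr_less_mono2[of a x y] powr_mono2[of a y x] by (cases "x < y") auto

section \<open>The jump sizes and their intensity\<close>

context tempered_stable
begin

definition mark_law :: "(real \<times> real \<times> 'a) measure" where
  "mark_law = std_exponential \<Otimes>\<^sub>M (uniform_measure lborel {0<..<1} \<Otimes>\<^sub>M V_law)"

definition jump :: "real \<Rightarrow> real \<times> real \<times> 'a \<Rightarrow> 'a" where
  "jump s w = Hfun sn T \<alpha> p s (snd (snd w)) (fst w) (fst (snd w))"

text \<open>The arrival times range over [0, Tn] with unit intensity. Dividing by T gives the
  intensity per unit of process time, of total mass n.\<close>

definition time_measure :: "nat \<Rightarrow> real measure" where
  "time_measure n = density lborel (\<lambda>s. ennreal (indicator {0..T * real n} s / T))"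

definition Mn :: "nat \<Rightarrow> 'a measure" where
  "Mn n = distr (time_measure n \<Otimes>\<^sub>M mark_law) borel (\<lambda>(s, w). jump s w)"

lemma sets_mark_law [simp, measurable_cong]: "sets mark_law = sets (borel \<Otimes>\<^sub>M (borel \<Otimes>\<^sub>M borel))"
  unfolding mark_law_def by (intro sets_pair_measure_cong) auto

lemma space_mark_law [simp]: "space mark_law = UNIV"
  using sets_eq_imp_space_eq[OF sets_mark_law] by (simp add: space_pair_measure)

lemma sets_time_measure [simp, measurable_cong]: "sets (time_measure n) = sets borel"
  unfolding time_measure_def by simp

lemma prob_space_unit_uniform: "prob_space (uniform_measure lborel {0<..<1::real})"
  by (rule prob_space_uniform_measure) auto

lemma prob_space_mark_law: "prob_space mark_law"
  unfolding mark_law_def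
  by (intro prob_space_pair prob_space_std_exponential prob_space_unit_uniform prob_space_V_law)

sublocale K: prob_space mark_law by (rule prob_space_mark_law)

lemma jump_measurable [measurable]:
  "(\<lambda>(s, w). jump s w) \<in> borel_measurable (borel \<Otimes>\<^sub>M (borel \<Otimes>\<^sub>M (borel \<Otimes>\<^sub>M borel)))"
  unfolding jump_def Hfun_def by measurable

lemma sets_Mn [simp, measurable_cong]: "sets (Mn n) = sets borel"
  unfolding Mn_def by simp

lemma AE_unit_uniform: "AE u in uniform_measure lborel {0<..<1::real}. 0 < u \<and> u < 1"
  by (rule AE_uniform_measureI) auto

lemma AE_mark_law: "AE w in mark_law. 0 < fst w \<and> 0 < fst (snd w) \<and> snd (snd w) \<noteq> 0"
proof -
  interpret E: prob_space std_exponential by (rule prob_space_std_exponential)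
  interpret U: prob_space "uniform_measure lborel {0<..<1::real}" by (rule prob_space_unit_uniform)
  interpret UV: pair_prob_space "uniform_measure lborel {0<..<1::real}" V_law ..
  interpret K': pair_prob_space std_exponential "uniform_measure lborel {0<..<1::real} \<Otimes>\<^sub>M V_law" ..
  have "AE z in uniform_measure lborel {0<..<1::real} \<Otimes>\<^sub>M V_law. 0 < fst z \<and> snd z \<noteq> 0"
  proof (rule UV.AE_pair_measure)
    show "{z \<in> space (uniform_measure lborel {0<..<1::real} \<Otimes>\<^sub>M V_law). 0 < fst z \<and> snd z \<noteq> 0}
        \<in> sets (uniform_measure lborel {0<..<1} \<Otimes>\<^sub>M V_law)" by measurable
    show "AE u in uniform_measure lborel {0<..<1::real}. AE v in V_law. 0 < fst (u, v) \<and> snd (u, v) \<noteq> 0"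
      using AE_unit_uniform
    proof eventually_elim
      case (elim u)
      then show ?case using AE_V_law_neq_0 by auto
    qed
  qed
  note UV = this
  show ?thesis
    unfolding mark_law_def
  proof (rule K'.AE_pair_measure)
    show "{w \<in> space (std_exponential \<Otimes>\<^sub>M (uniform_measure lborel {0<..<1::real} \<Otimes>\<^sub>M V_law)). 0 < fst w \<and> 0 < fst (snd w) \<and> snd (snd w) \<noteq> 0}
        \<in> sets (std_exponential \<Otimes>\<^sub>M (uniform_measure lborel {0<..<1} \<Otimes>\<^sub>M V_law))" by measurable
    show "AE e in std_exponential. AE z in uniform_measure lborel {0<..<1::real} \<Otimes>\<^sub>M V_law.
        0 < fst (e, z) \<and> 0 < fst (snd (e, z)) \<and> snd (snd (e, z)) \<noteq> 0"
      using AE_std_exponential_pos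
    proof eventually_elim
      case (elim e)
      then show ?case using UV by auto
    qed
  qed
qed

text \<open>The second term of the minimum in H, the only one that depends on the mark.\<close>

definition radius :: "real \<times> real \<times> 'a \<Rightarrow> real" where
  "radius w = fst w powr (1 / p) * fst (snd w) powr (1 / \<alpha>) / norm (snd (snd w)) powr (1 / p)"

lemma radius_measurable [measurable]: "radius \<in> borel_measurable (borel \<Otimes>\<^sub>M (borel \<Otimes>\<^sub>M borel))"
  unfolding radius_def by measurable

text \<open>Solved for e, the condition becomes a tail event of the exponential variable at norm v *
  r^p, where r = x u^(-1/\<alpha>) is the Pareto variable.\<close>

lemma radius_gt_iff:
  assumes "0 < x" "0 < e" "0 < u" "v \<noteq> 0"
  shows "x < radius (e, u, v) \<longleftrightarrow> norm v * (x * u powr (- 1 / \<alpha>)) powr p < e"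
proof -
  have v: "0 < norm v" using assms by simp
  have "x < radius (e, u, v) \<longleftrightarrow> x * norm v powr (1 / p) / u powr (1 / \<alpha>) < e powr (1 / p)"
    unfolding radius_def using assms v by (simp add: field_simps)
  also have "x * norm v powr (1 / p) / u powr (1 / \<alpha>) = norm v powr (1 / p) * (x * u powr (- 1 / \<alpha>))"
    by (simp add: powr_minus_divide)
  also have "\<dots> < e powr (1 / p) \<longleftrightarrow>
      (norm v powr (1 / p) * (x * u powr (- 1 / \<alpha>))) powr p < (e powr (1 / p)) powr p"
    using assms p by (intro powr_less_powr_iff[symmetric]) auto
  also have "(e powr (1 / p)) powr p = e" using p assms by (simp add: powr_powr)
  also have "(norm v powr (1 / p) * (x * u powr (- 1 / \<alpha>))) powr p = norm v * (x * u powr (- 1 / \<alpha>)) powr p"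
    using p assms v by (subst powr_mult) (auto simp: powr_powr)
  finally show ?thesis .
qed

lemma emeasure_levyM_radial_set:
  assumes x: "0 < x" and B[measurable]: "B \<in> sets borel" and Bs: "B \<subseteq> sphere 0 1"
  shows "emeasure (levyM p \<alpha> \<sigma> Qk) (radial_set x B) = (\<integral>\<^sup>+u. (\<integral>\<^sup>+r. indicator {x<..} r * indicator B u
              * ennreal (qfun Qk (r powr p) u * r powr (- \<alpha> - 1)) \<partial>lborel) \<partial>\<sigma>)"
  unfolding emeasure_levyM[OF radial_set_borel[OF x Bs B]]
proof (rule nn_integral_cong_AE)
  show "AE u in \<sigma>. (\<integral>\<^sup>+r. indicator {0<..} r * indicator (radial_set x B) (r *\<^sub>R u)
              * ennreal (qfun Qk (r powr p) u * r powr (- \<alpha> - 1)) \<partial>lborel) =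
       (\<integral>\<^sup>+r. indicator {x<..} r * indicator B u * ennreal (qfun Qk (r powr p) u * r powr (- \<alpha> - 1)) \<partial>lborel)"
    using AE_\<sigma>_sphere
  proof eventually_elim
    case (elim u)
    have "indicator {0<..} r * indicator (radial_set x B) (r *\<^sub>R u) = (indicator {x<..} r * indicator B u :: ennreal)" for r
      unfolding radial_set_eq[OF x Bs] using elim x by (auto simp: indicator_def)
    then show ?case by simp
  qed
qed

text \<open>Integrating over E gives exp (-norm v * r^p), and integrating over U turns r into a
  Pareto variable. Writing v = s u under the law of V, the average over s is the Laplace transform
  \<open>qfun\<close>; the normalisation of that law leaves the factor 1 /
  \<open>sn\<close>.\<close>

lemma emeasure_mark_law_tail:
  assumes x: "0 < x" and B[measurable]: "B \<in> sets borel" and Bs: "B \<subseteq> sphere 0 1"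
  shows "emeasure mark_law {w. x < radius w \<and> snd (snd w) /\<^sub>R norm (snd (snd w)) \<in> B} =
    ennreal (\<alpha> * x powr \<alpha> / sn) * emeasure (levyM p \<alpha> \<sigma> Qk) (radial_set x B)"
proof -
  note [measurable_cong] = \<sigma>sets
  let ?U = "uniform_measure lborel {0<..<1::real}"
  interpret E: prob_space std_exponential by (rule prob_space_std_exponential)
  interpret U: prob_space ?U by (rule prob_space_unit_uniform)
  interpret UV: pair_prob_space ?U V_law ..
  interpret K': pair_prob_space std_exponential "?U \<Otimes>\<^sub>M V_law" ..
  let ?A = "{w. x < radius w \<and> snd (snd w) /\<^sub>R norm (snd (snd w)) \<in> B}"
  \<comment> \<open>The probability that E exceeds norm v * r^p, restricted to directions in
    \<open>B\<close>.\<close>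
  define h where "h v r = indicator B (v /\<^sub>R norm v) * ennreal (exp (- (norm v * r powr p)))" for v :: 'a and r
  have [measurable]: "(\<lambda>(v, r). h v r) \<in> borel_measurable (borel \<Otimes>\<^sub>M borel)"
    unfolding h_def by measurable
  have A: "?A \<in> sets (borel \<Otimes>\<^sub>M (borel \<Otimes>\<^sub>M borel))"
  proof -
    have "{w \<in> space (borel \<Otimes>\<^sub>M (borel \<Otimes>\<^sub>M borel)). x < radius w \<and> snd (snd w) /\<^sub>R norm (snd (snd w)) \<in> B}
        \<in> sets (borel \<Otimes>\<^sub>M (borel \<Otimes>\<^sub>M borel))" by measurable
    then show ?thesis by (simp add: space_pair_measure)
  qed
  have A'[measurable]: "(\<lambda>w. indicator ?A w :: ennreal) \<in> borel_measurable (borel \<Otimes>\<^sub>M (borel \<Otimes>\<^sub>M borel))"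
    using A by measurable
  have inner: "(\<integral>\<^sup>+e. indicator ?A (e, u, v) \<partial>std_exponential) = h v (x * u powr (- 1 / \<alpha>))"
    if u: "0 < u" for u v
  proof (cases "v /\<^sub>R norm v \<in> B")
    case False
    then show ?thesis unfolding h_def by simp
  next
    case True
    \<comment> \<open>By the convention for division by 0 the zero vector has direction 0, which is
      off the sphere.\<close>
    then have v: "v \<noteq> 0" using Bs by auto
    have "(\<integral>\<^sup>+e. indicator ?A (e, u, v) \<partial>std_exponential) =
        (\<integral>\<^sup>+e. indicator {norm v * (x * u powr (- 1 / \<alpha>)) powr p<..} e \<partial>std_exponential)"
    proof (rule nn_integral_cong_AE)
      show "AE e in std_exponential. indicator ?A (e, u, v) = (indicator {norm v * (x * u powr (- 1 / \<alpha>)) powr p<..} e :: ennreal)"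
        using AE_std_exponential_pos
        by eventually_elim (use radius_gt_iff[OF x _ u v] True in \<open>auto simp: indicator_def\<close>)
    qed
    also have "\<dots> = h v (x * u powr (- 1 / \<alpha>))"
      using True unfolding h_def by (simp add: emeasure_std_exponential_greaterThan)
    finally show ?thesis .
  qed
  have "emeasure mark_law ?A = (\<integral>\<^sup>+w. indicator ?A w \<partial>mark_law)"
    using A by simp
  also have "\<dots> = (\<integral>\<^sup>+z. \<integral>\<^sup>+e. indicator ?A (e, z) \<partial>std_exponential \<partial>(?U \<Otimes>\<^sub>M V_law))"
    unfolding mark_law_def by (rule K'.nn_integral_snd[symmetric]) measurable
  also have "\<dots> = (\<integral>\<^sup>+v. \<integral>\<^sup>+u. \<integral>\<^sup>+e. indicator ?A (e, u, v) \<partial>std_exponential \<partial>?U \<partial>V_law)"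
    by (rule UV.nn_integral_snd[symmetric]) measurable
  also have "\<dots> = (\<integral>\<^sup>+v. \<integral>\<^sup>+u. h v (x * u powr (- 1 / \<alpha>)) \<partial>?U \<partial>V_law)"
  proof (rule nn_integral_cong, rule nn_integral_cong_AE)
    fix v
    show "AE u in ?U. (\<integral>\<^sup>+e. indicator ?A (e, u, v) \<partial>std_exponential) = h v (x * u powr (- 1 / \<alpha>))"
      using AE_unit_uniform by eventually_elim (use inner in auto)
  qed
  also have "\<dots> = (\<integral>\<^sup>+v. ennreal (\<alpha> * x powr \<alpha>) * (\<integral>\<^sup>+r. indicator {x<..} r * ennreal (r powr (- \<alpha> - 1)) * h v r \<partial>lborel) \<partial>V_law)"
    by (intro nn_integral_cong nn_integral_pareto[OF \<alpha> x]) measurable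
  also have "\<dots> = ennreal (1 / sn) * (\<integral>\<^sup>+u. \<integral>\<^sup>+s. ennreal (\<alpha> * x powr \<alpha>) *
      (\<integral>\<^sup>+r. indicator {x<..} r * ennreal (r powr (- \<alpha> - 1)) * h (s *\<^sub>R u) r \<partial>lborel) \<partial>Qk u \<partial>\<sigma>)"
    by (rule nn_integral_V_law) measurable
  also have "(\<integral>\<^sup>+u. \<integral>\<^sup>+s. ennreal (\<alpha> * x powr \<alpha>) *
      (\<integral>\<^sup>+r. indicator {x<..} r * ennreal (r powr (- \<alpha> - 1)) * h (s *\<^sub>R u) r \<partial>lborel) \<partial>Qk u \<partial>\<sigma>) =
     (\<integral>\<^sup>+u. ennreal (\<alpha> * x powr \<alpha>) * (\<integral>\<^sup>+r. indicator {x<..} r * indicator B u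
              * ennreal (qfun Qk (r powr p) u * r powr (- \<alpha> - 1)) \<partial>lborel) \<partial>\<sigma>)"
  proof (rule nn_integral_cong_AE)
    show "AE u in \<sigma>. (\<integral>\<^sup>+s. ennreal (\<alpha> * x powr \<alpha>) *
      (\<integral>\<^sup>+r. indicator {x<..} r * ennreal (r powr (- \<alpha> - 1)) * h (s *\<^sub>R u) r \<partial>lborel) \<partial>Qk u) =
      ennreal (\<alpha> * x powr \<alpha>) * (\<integral>\<^sup>+r. indicator {x<..} r * indicator B u
              * ennreal (qfun Qk (r powr p) u * r powr (- \<alpha> - 1)) \<partial>lborel)"
      using AE_\<sigma>_sphere
    proof eventually_elim
      case (elim u)
      interpret Q: prob_space "Qk u" by (rule Qk_prob)
      interpret QL: pair_sigma_finite "Qk u" "lborel :: real measure" ..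
      have "(\<integral>\<^sup>+s. ennreal (\<alpha> * x powr \<alpha>) *
          (\<integral>\<^sup>+r. indicator {x<..} r * ennreal (r powr (- \<alpha> - 1)) * h (s *\<^sub>R u) r \<partial>lborel) \<partial>Qk u) =
        ennreal (\<alpha> * x powr \<alpha>) * (\<integral>\<^sup>+s. (\<integral>\<^sup>+r. indicator {x<..} r * ennreal (r powr (- \<alpha> - 1)) * h (s *\<^sub>R u) r \<partial>lborel) \<partial>Qk u)"
        by (rule nn_integral_cmult) measurable
      \<comment> \<open>Exchanging the order makes the s-integral of the exponential available at
        each fixed r.\<close>
      also have "(\<integral>\<^sup>+s. (\<integral>\<^sup>+r. indicator {x<..} r * ennreal (r powr (- \<alpha> - 1)) * h (s *\<^sub>R u) r \<partial>lborel) \<partial>Qk u) =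
         (\<integral>\<^sup>+r. (\<integral>\<^sup>+s. indicator {x<..} r * ennreal (r powr (- \<alpha> - 1)) * h (s *\<^sub>R u) r \<partial>Qk u) \<partial>lborel)"
        by (rule QL.Fubini'[symmetric]) measurable
      also have "\<dots> = (\<integral>\<^sup>+r. indicator {x<..} r * indicator B u
              * ennreal (qfun Qk (r powr p) u * r powr (- \<alpha> - 1)) \<partial>lborel)"
      proof (rule nn_integral_cong)
        fix r :: real
        have "(\<integral>\<^sup>+s. indicator {x<..} r * ennreal (r powr (- \<alpha> - 1)) * h (s *\<^sub>R u) r \<partial>Qk u) =
          (\<integral>\<^sup>+s. (indicator {x<..} r * ennreal (r powr (- \<alpha> - 1)) * indicator B u) * ennreal (exp (- (r powr p) * s)) \<partial>Qk u)"
        proof (rule nn_integral_cong_AE)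
          show "AE s in Qk u. indicator {x<..} r * ennreal (r powr (- \<alpha> - 1)) * h (s *\<^sub>R u) r =
            (indicator {x<..} r * ennreal (r powr (- \<alpha> - 1)) * indicator B u) * ennreal (exp (- (r powr p) * s))"
            using AE_Qk_pos[of u]
            by eventually_elim (use elim in \<open>simp add: h_def mult_ac\<close>)
        qed
        also have "\<dots> = (indicator {x<..} r * ennreal (r powr (- \<alpha> - 1)) * indicator B u) * ennreal (qfun Qk (r powr p) u)"
          by (subst nn_integral_cmult) (auto simp: ennreal_qfun)
        also have "\<dots> = indicator {x<..} r * indicator B u * ennreal (qfun Qk (r powr p) u * r powr (- \<alpha> - 1))"
          by (simp add: ennreal_mult'' mult_ac)
        finally show "(\<integral>\<^sup>+s. indicator {x<..} r * ennreal (r powr (- \<alpha> - 1)) * h (s *\<^sub>R u) r \<partial>Qk u) =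
          indicator {x<..} r * indicator B u * ennreal (qfun Qk (r powr p) u * r powr (- \<alpha> - 1))" .
      qed
      finally show ?case .
    qed
  qed
  also have "\<dots> = ennreal (\<alpha> * x powr \<alpha>) * emeasure (levyM p \<alpha> \<sigma> Qk) (radial_set x B)"
    unfolding emeasure_levyM_radial_set[OF x B Bs] by (rule nn_integral_cmult) measurable
  finally have "emeasure mark_law ?A = (ennreal (1 / sn) * ennreal (\<alpha> * x powr \<alpha>)) *
      emeasure (levyM p \<alpha> \<sigma> Qk) (radial_set x B)" by (simp only: mult.assoc)
  also have "ennreal (1 / sn) * ennreal (\<alpha> * x powr \<alpha>) = ennreal (\<alpha> * x powr \<alpha> / sn)"
    using \<alpha> sn_pos by (simp flip: ennreal_mult')
  finally show ?thesis .
qed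

lemma jump_eq: "jump s w = min ((\<alpha> * s / (sn * T)) powr (- 1 / \<alpha>)) (radius w) *\<^sub>R (snd (snd w) /\<^sub>R norm (snd (snd w)))"
  unfolding jump_def Hfun_def radius_def by simp

lemma radius_nonneg: "0 \<le> radius w"
  unfolding radius_def by simp

text \<open>A minimum exceeds x iff both terms do; the bound on s inverts the decreasing first term.
  For v = 0 both sides fail because the direction is 0.\<close>

lemma jump_in_radial_set_iff:
  assumes x: "0 < x" and s: "0 < s" and Bs: "B \<subseteq> sphere 0 1"
  shows "jump s w \<in> radial_set x B \<longleftrightarrow> s < sn * T * x powr (- \<alpha>) / \<alpha> \<and>
    x < radius w \<and> snd (snd w) /\<^sub>R norm (snd (snd w)) \<in> B"
proof -
  define c where "c = (\<alpha> * s / (sn * T)) powr (- 1 / \<alpha>)"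
  define m where "m = min c (radius w)"
  define d where "d = snd (snd w) /\<^sub>R norm (snd (snd w))"
  have pos: "0 < \<alpha> * s / (sn * T)" using \<alpha> s sn_pos T by simp
  have c0: "0 < c" unfolding c_def powr_gt_zero using pos by linarith
  have m0: "0 \<le> m" unfolding m_def using c0 radius_nonneg[of w] by simp
  have "x < c \<longleftrightarrow> c powr (- \<alpha>) < x powr (- \<alpha>)"
    using powr_less_powr_neg_iff[OF c0 x \<alpha>] by simp
  also have "c powr (- \<alpha>) = \<alpha> * s / (sn * T)"
  proof -
    have "c powr (- \<alpha>) = (\<alpha> * s / (sn * T)) powr 1"
      unfolding c_def powr_powr using \<alpha> by simp
    then show ?thesis using pos by (simp only: powr_one less_imp_le)
  qed
  also have "\<alpha> * s / (sn * T) < x powr (- \<alpha>) \<longleftrightarrow> s < sn * T * x powr (- \<alpha>) / \<alpha>"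
    using \<alpha> sn_pos T by (simp add: field_simps)
  finally have c: "x < c \<longleftrightarrow> s < sn * T * x powr (- \<alpha>) / \<alpha>" .
  have j: "jump s w = m *\<^sub>R d" unfolding jump_eq m_def c_def d_def ..
  have "jump s w \<in> radial_set x B \<longleftrightarrow> x < m \<and> d \<in> B"
  proof (cases "snd (snd w) = 0")
    case True
    then have "d = 0" "d \<notin> B" unfolding d_def using Bs by auto
    then show ?thesis unfolding radial_set_eq[OF x Bs] j using x by simp
  next
    case False
    then have "norm d = 1" unfolding d_def by simp
    then show ?thesis unfolding radial_set_eq[OF x Bs] j using x m0 by auto
  qed
  then show ?thesis unfolding m_def d_def using c by auto
qed

lemma nn_integral_time_measure:
  assumes [measurable]: "f \<in> borel_measurable borel"
  shows "(\<integral>\<^sup>+s. f s \<partial>time_measure n) = ennreal (1 / T) * (\<integral>\<^sup>+s. f s * indicator {0..T * real n} s \<partial>lborel)"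
proof -
  have "(\<integral>\<^sup>+s. f s \<partial>time_measure n) = (\<integral>\<^sup>+s. ennreal (indicator {0..T * real n} s / T) * f s \<partial>lborel)"
    unfolding time_measure_def by (rule nn_integral_density) auto
  also have "\<dots> = (\<integral>\<^sup>+s. ennreal (1 / T) * (f s * indicator {0..T * real n} s) \<partial>lborel)"
    by (intro nn_integral_cong) (auto simp: indicator_def mult_ac)
  finally show ?thesis by (simp add: nn_integral_cmult)
qed

lemma AE_time_measure_pos: "AE s in time_measure n. 0 < s"
proof -
  have "AE s in lborel. s \<noteq> (0::real)" by (rule AE_lborel_singleton)
  then show ?thesis
    unfolding time_measure_def by (subst AE_density) (auto simp: indicator_def elim!: eventually_mono)
qed

lemma emeasure_Mn:
  assumes [measurable]: "A \<in> sets borel"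
  shows "emeasure (Mn n) A = (\<integral>\<^sup>+s. emeasure mark_law {w. jump s w \<in> A} \<partial>time_measure n)"
proof -
  have "emeasure (Mn n) A = emeasure (time_measure n \<Otimes>\<^sub>M mark_law)
      ((\<lambda>(s, w). jump s w) -` A \<inter> space (time_measure n \<Otimes>\<^sub>M mark_law))"
    unfolding Mn_def by (rule emeasure_distr) measurable
  also have "\<dots> = (\<integral>\<^sup>+s. emeasure mark_law (Pair s -` ((\<lambda>(s, w). jump s w) -` A \<inter> space (time_measure n \<Otimes>\<^sub>M mark_law))) \<partial>time_measure n)"
    by (rule K.emeasure_pair_measure_alt) measurable
  also have "\<dots> = (\<integral>\<^sup>+s. emeasure mark_law {w. jump s w \<in> A} \<partial>time_measure n)"
    by (intro nn_integral_cong arg_cong[where f="emeasure _"])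
       (auto simp: space_pair_measure)
  finally show ?thesis .
qed

lemma finite_measure_Mn: "finite_measure (Mn n)"
proof (rule finite_measureI)
  have "emeasure (Mn n) UNIV = (\<integral>\<^sup>+s. 1 \<partial>time_measure n)"
    using K.emeasure_space_1 by (subst emeasure_Mn) auto
  also have "\<dots> = ennreal (1 / T) * ennreal (T * real n)"
    using T by (subst nn_integral_time_measure) auto
  finally show "emeasure (Mn n) (space (Mn n)) \<noteq> \<infinity>"
    by (simp add: Mn_def ennreal_mult_eq_top_iff)
qed

text \<open>For s > 0 and almost every mark, both terms of the minimum are positive and the
  direction is nonzero.\<close>

lemma emeasure_Mn_0: "emeasure (Mn n) {0} = 0"
proof -
  have "emeasure (Mn n) {0} = (\<integral>\<^sup>+s. emeasure mark_law {w. jump s w \<in> {0}} \<partial>time_measure n)"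
    by (rule emeasure_Mn) auto
  also have "\<dots> = (\<integral>\<^sup>+s. 0 \<partial>time_measure n)"
  proof (rule nn_integral_cong_AE)
    show "AE s in time_measure n. emeasure mark_law {w. jump s w \<in> {0}} = 0"
      using AE_time_measure_pos
    proof eventually_elim
      case (elim s)
      have "AE w in mark_law. jump s w \<noteq> 0"
        using AE_mark_law
      proof eventually_elim
        case (elim w)
        have "0 < \<alpha> * s / (sn * T)" using \<alpha> \<open>0 < s\<close> sn_pos T by simp
        then have "0 < (\<alpha> * s / (sn * T)) powr (- 1 / \<alpha>)" unfolding powr_gt_zero by linarith
        moreover have "0 < radius w" using elim unfolding radius_def by simp
        ultimately have "min ((\<alpha> * s / (sn * T)) powr (- 1 / \<alpha>)) (radius w) \<noteq> 0"
          by (simp add: min_def)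
        then show ?case unfolding jump_eq scaleR_eq_0_iff using elim by simp
      qed
      moreover have "{w \<in> space mark_law. \<not> jump s w \<noteq> 0} \<in> sets mark_law" by measurable
      ultimately show ?case by (subst (asm) AE_iff_measurable[OF _ refl]) auto
    qed
  qed
  finally show ?thesis by simp
qed

lemma emeasure_Mn_radial_set:
  assumes x: "0 < x" and B[measurable]: "B \<in> sets borel" and Bs: "B \<subseteq> sphere 0 1"
  shows "emeasure (Mn n) (radial_set x B) =
    ennreal (min (real n * \<alpha> / sn * x powr \<alpha>) 1) * emeasure (levyM p \<alpha> \<sigma> Qk) (radial_set x B)"
proof -
  \<comment> \<open>The time at which the first term of H falls to x. Times in [0, Tn] before b have
    length min b (Tn); the factor \<alpha> x^\<alpha> / (\<open>sn\<close> T) turns b into 1 and Tn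
    into n \<alpha> x^\<alpha> / \<open>sn\<close>.\<close>
  define b where "b = sn * T * x powr (- \<alpha>) / \<alpha>"
  let ?A = "{w. x < radius w \<and> snd (snd w) /\<^sub>R norm (snd (snd w)) \<in> B}"
  have b: "0 < b" unfolding b_def using sn_pos T x \<alpha> by simp
  have "emeasure (Mn n) (radial_set x B) = (\<integral>\<^sup>+s. emeasure mark_law {w. jump s w \<in> radial_set x B} \<partial>time_measure n)"
    by (rule emeasure_Mn) (rule radial_set_borel[OF x Bs B])
  also have "\<dots> = (\<integral>\<^sup>+s. indicator {..<b} s * emeasure mark_law ?A \<partial>time_measure n)"
  proof (rule nn_integral_cong_AE)
    show "AE s in time_measure n. emeasure mark_law {w. jump s w \<in> radial_set x B} =
        indicator {..<b} s * emeasure mark_law ?A"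
      using AE_time_measure_pos
    proof eventually_elim
      case (elim s)
      then show ?case
        unfolding jump_in_radial_set_iff[OF x elim Bs] b_def[symmetric] by (cases "s < b") auto
    qed
  qed
  also have "\<dots> = ennreal (1 / T) * (\<integral>\<^sup>+s. indicator {..<b} s * emeasure mark_law ?A * indicator {0..T * real n} s \<partial>lborel)"
    by (rule nn_integral_time_measure) measurable
  also have "(\<integral>\<^sup>+s. indicator {..<b} s * emeasure mark_law ?A * indicator {0..T * real n} s \<partial>lborel) =
      (\<integral>\<^sup>+s. indicator {0..min b (T * real n)} s * emeasure mark_law ?A \<partial>lborel)"
  proof (rule nn_integral_cong_AE)
    show "AE s in lborel. indicator {..<b} s * emeasure mark_law ?A * indicator {0..T * real n} s =
        indicator {0..min b (T * real n)} s * emeasure mark_law ?A"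
      using AE_lborel_singleton[of b] by eventually_elim (auto simp: indicator_def)
  qed
  also have "\<dots> = ennreal (min b (T * real n)) * emeasure mark_law ?A"
    using b T by (subst nn_integral_multc) auto
  also have "ennreal (1 / T) * (ennreal (min b (T * real n)) * emeasure mark_law ?A) =
      (ennreal (1 / T) * ennreal (min b (T * real n)) * ennreal (\<alpha> * x powr \<alpha> / sn)) *
        emeasure (levyM p \<alpha> \<sigma> Qk) (radial_set x B)"
    unfolding emeasure_mark_law_tail[OF x B Bs] by (simp only: mult.assoc)
  also have "ennreal (1 / T) * ennreal (min b (T * real n)) * ennreal (\<alpha> * x powr \<alpha> / sn) =
      ennreal (1 / T * min b (T * real n) * (\<alpha> * x powr \<alpha> / sn))"
    using T b \<alpha> sn_pos by (subst ennreal_mult'[symmetric], simp, subst ennreal_mult'[symmetric], simp, simp)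
  also have "1 / T * min b (T * real n) * (\<alpha> * x powr \<alpha> / sn) = min (real n * \<alpha> / sn * x powr \<alpha>) 1"
  proof -
    have k: "0 \<le> \<alpha> * x powr \<alpha> / (sn * T)" using \<alpha> sn_pos T by simp
    have "1 / T * min b (T * real n) * (\<alpha> * x powr \<alpha> / sn) = \<alpha> * x powr \<alpha> / (sn * T) * min b (T * real n)"
      by (simp add: mult_ac)
    also have "\<dots> = min (\<alpha> * x powr \<alpha> / (sn * T) * b) (\<alpha> * x powr \<alpha> / (sn * T) * (T * real n))"
      unfolding min_mult_distrib_left using k by (rule if_P)
    also have "\<alpha> * x powr \<alpha> / (sn * T) * b = 1"
      unfolding b_def using \<alpha> sn_pos T x by (simp add: powr_minus field_simps)
    also have "\<alpha> * x powr \<alpha> / (sn * T) * (T * real n) = real n * \<alpha> / sn * x powr \<alpha>"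
      using T by simp
    finally show ?thesis by (simp add: min.commute)
  qed
  finally show ?thesis .
qed

lemma levy_measures_converge_Mn: "levy_measures_converge Mn (levyM p \<alpha> \<sigma> Qk)"
  unfolding levy_measures_converge_def
proof (intro allI impI)
  fix f :: "'a \<Rightarrow> real"
  assume "continuous_on UNIV f \<and> bounded (range f) \<and> (\<exists>\<delta>>0. \<forall>x. norm x < \<delta> \<longrightarrow> f x = 0)"
  then obtain \<delta> where f: "continuous_on UNIV f" and \<delta>: "0 < \<delta>" "\<And>x. norm x < \<delta> \<Longrightarrow> f x = 0" by auto
  \<comment> \<open>Half of \<delta>, so that f vanishes on the closed ball of radius
    \<open>x0\<close>.\<close>
  define x0 where "x0 = \<delta> / 2"
  have x0: "0 < x0" "\<And>x. norm x \<le> x0 \<Longrightarrow> f x = 0" using \<delta> unfolding x0_def by auto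
  \<comment> \<open>The least n with n \<alpha> \<open>x0\<close>^\<alpha> / \<open>sn\<close> \<ge>
    1; from there on the factor relating \<open>Mn n\<close> to M is 1 at every level above
    \<open>x0\<close>.\<close>
  define n0 where "n0 = nat \<lceil>sn / (\<alpha> * x0 powr \<alpha>)\<rceil>"
  have eq: "emeasure (Mn n) (radial_set x B) = emeasure (levyM p \<alpha> \<sigma> Qk) (radial_set x B)"
    if "n0 \<le> n" "x0 \<le> x" "B \<in> sets borel" "B \<subseteq> sphere 0 1" for n x B
  proof -
    have "sn / (\<alpha> * x0 powr \<alpha>) \<le> real n" using that(1) unfolding n0_def by linarith
    then have "1 \<le> real n * \<alpha> / sn * x0 powr \<alpha>"
      using \<alpha> sn_pos x0 by (simp add: field_simps)
    also have "\<dots> \<le> real n * \<alpha> / sn * x powr \<alpha>"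
      using that(2) x0 \<alpha> sn_pos by (intro mult_left_mono powr_mono2) auto
    finally show ?thesis
      using emeasure_Mn_radial_set[of x B n] that x0 by simp
  qed
  have "(\<integral>x. f x \<partial>Mn n) = (\<integral>x. f x \<partial>levyM p \<alpha> \<sigma> Qk)" if "n0 \<le> n" for n
  proof (rule integral_eq_if_radial_eq[OF _ _ x0(1)])
    \<comment> \<open>Finiteness is read off from \<open>Mn n\<close>; equality on radial sets
      transfers it to M.\<close>
    show "emeasure (Mn n) (radial_set x0 (sphere 0 1)) < \<infinity>"
      using finite_measure.emeasure_finite[OF finite_measure_Mn, of n] by (simp add: top.not_eq_extremum)
    show "f \<in> borel_measurable borel" using f by (rule borel_measurable_continuous_onI)
  qed (use eq that x0 in auto)
  then show "(\<lambda>n. \<integral>x. f x \<partial>Mn n) \<longlonglongrightarrow> (\<integral>x. f x \<partial>levyM p \<alpha> \<sigma> Qk)"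
    by (intro tendsto_eventually eventually_sequentiallyI[of n0])
qed

end

section \<open>The compound Poisson process\<close>

context tempered_stable
begin

lemma jump_measurable_mark_law [measurable]: "jump s \<in> borel_measurable mark_law"
  unfolding jump_eq[abs_def] by measurable

text \<open>The integrand \<gamma> - 1 of the Poisson exponent when the factor is the character of a
  single jump.\<close>

definition jump_char :: "'a \<Rightarrow> real \<Rightarrow> complex" where
  "jump_char z s = (\<integral>w. cis (z \<bullet> jump s w) - 1 \<partial>mark_law)"

lemma norm_cis_diff_1_le: "norm (cis x - 1) \<le> 2"
  using norm_triangle_ineq4[of "cis x" 1] by simp

lemma jump_char_measurable [measurable]: "jump_char z \<in> borel_measurable borel"
  unfolding jump_char_def by measurable

lemma norm_jump_char_le: "norm (jump_char z s) \<le> 2"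
proof -
  have "norm (jump_char z s) \<le> (\<integral>w. norm (cis (z \<bullet> jump s w) - 1) \<partial>mark_law)"
    unfolding jump_char_def by (rule integral_norm_bound)
  also have "\<dots> \<le> (\<integral>w. 2 \<partial>mark_law)"
    by (rule integral_mono_AE'[of mark_law "\<lambda>_. 2"]) (use norm_cis_diff_1_le in auto)
  finally show ?thesis using K.prob_space by simp
qed

text \<open>For a fixed mark the jump depends continuously on s > 0, and dominated convergence with
  bound 2 moves this inside the mean.\<close>

lemma jump_char_continuous: "continuous_on {0<..} (jump_char z)"
  unfolding continuous_on_sequentially
proof (intro allI ballI impI)
  fix x :: "nat \<Rightarrow> real" and s assume s: "s \<in> {0<..}" and x: "(\<forall>n. x n \<in> {0<..}) \<and> x \<longlonglongrightarrow> s"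
  have pos: "0 < \<alpha> * s / (sn * T)" using s \<alpha> sn_pos T by simp
  show "(jump_char z \<circ> x) \<longlonglongrightarrow> jump_char z s"
    unfolding jump_char_def o_def
  proof (rule integral_dominated_convergence[where w="\<lambda>_. 2"])
    show "AE w in mark_law. (\<lambda>i. cis (z \<bullet> jump (x i) w) - 1) \<longlonglongrightarrow> cis (z \<bullet> jump s w) - 1"
    proof (rule AE_I2)
      fix w
      have "(\<lambda>i. (\<alpha> * x i / (sn * T)) powr (- 1 / \<alpha>)) \<longlonglongrightarrow> (\<alpha> * s / (sn * T)) powr (- 1 / \<alpha>)"
        using x pos by (intro tendsto_intros) auto
      then have j: "(\<lambda>i. z \<bullet> jump (x i) w) \<longlonglongrightarrow> z \<bullet> jump s w"
        unfolding jump_eq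
        by (rule tendsto_inner[OF tendsto_const tendsto_scaleR[OF tendsto_min[OF _ tendsto_const] tendsto_const]])
      have "continuous_on UNIV cis" by (intro continuous_intros)
      then have "isCont cis (z \<bullet> jump s w)" by (simp add: continuous_on_eq_continuous_at)
      then show "(\<lambda>i. cis (z \<bullet> jump (x i) w) - 1) \<longlonglongrightarrow> cis (z \<bullet> jump s w) - 1"
        by (rule tendsto_diff[OF isCont_tendsto_compose[OF _ j] tendsto_const])
    qed
    show "AE w in mark_law. norm (cis (z \<bullet> jump (x i) w) - 1) \<le> 2" for i
      using norm_cis_diff_1_le by simp
  qed auto
qed

lemma char_exponent_Mn:
  "(\<integral>x. cis (z \<bullet> x) - 1 \<partial>Mn n) = (LINT s:{0..T * real n}|lborel. jump_char z s) / of_real T"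
proof -
  have ft: "finite_measure (time_measure n)"
  proof (rule finite_measureI)
    have "emeasure (time_measure n) (space (time_measure n)) = (\<integral>\<^sup>+s. 1 \<partial>time_measure n)" by simp
    also have "\<dots> = ennreal (1 / T) * ennreal (T * real n)"
      using T by (subst nn_integral_time_measure) auto
    finally show "emeasure (time_measure n) (space (time_measure n)) \<noteq> \<infinity>"
      by (simp add: ennreal_mult_eq_top_iff)
  qed
  interpret F: finite_measure "time_measure n" by (rule ft)
  interpret FK: pair_sigma_finite "time_measure n" mark_law ..
  let ?h = "\<lambda>z'. cis (z \<bullet> (case z' of (s, w) \<Rightarrow> jump s w)) - 1"
  have int: "integrable (time_measure n \<Otimes>\<^sub>M mark_law) ?h"
  proof -
    interpret finite_measure "time_measure n \<Otimes>\<^sub>M mark_law"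
      by (rule finite_measure_pair_measure[OF K.finite_measure_axioms ft])
    show ?thesis by (rule integrable_const_bound[where B=2]) (use norm_cis_diff_1_le in auto)
  qed
  have "(\<integral>x. cis (z \<bullet> x) - 1 \<partial>Mn n) = (\<integral>z'. ?h z' \<partial>(time_measure n \<Otimes>\<^sub>M mark_law))"
    unfolding Mn_def by (subst integral_distr) auto
  also have "\<dots> = (\<integral>s. jump_char z s \<partial>time_measure n)"
    unfolding jump_char_def using FK.integral_fst'[OF int] by simp
  also have "\<dots> = (\<integral>s. (indicator {0..T * real n} s / T) *\<^sub>R jump_char z s \<partial>lborel)"
    unfolding time_measure_def using T by (subst integral_density) auto
  also have "\<dots> = (\<integral>s. (indicator {0..T * real n} s *\<^sub>R jump_char z s) / of_real T \<partial>lborel)"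
    by (intro Bochner_Integration.integral_cong) (auto simp: scaleR_conv_of_real)
  finally show ?thesis unfolding set_lebesgue_integral_def by simp
qed

section \<open>Characters of increments over consecutive windows\<close>

definition time_law :: "real measure" where
  "time_law = uniform_measure lborel {0<..<T}"

lemma sets_time_law [simp, measurable_cong]: "sets time_law = sets borel"
  unfolding time_law_def by simp

lemma prob_space_time_law: "prob_space time_law"
  unfolding time_law_def using T by (intro prob_space_uniform_measure) auto

sublocale Tl: prob_space time_law by (rule prob_space_time_law)
sublocale TK: pair_prob_space time_law mark_law ..

lemma measure_time_law_Ioc:
  assumes "0 \<le> a" "a \<le> b" "b \<le> T"
  shows "measure time_law {a<..b} = (b - a) / T"
proof -
  have "emeasure lborel ({0<..<T} \<inter> {a<..b}) = emeasure lborel {a<..b}"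
  proof (rule emeasure_eq_AE)
    show "AE t in lborel. (t \<in> {0<..<T} \<inter> {a<..b}) = (t \<in> {a<..b})"
      using AE_lborel_singleton[of T] by eventually_elim (use assms in auto)
  qed auto
  then have "emeasure time_law {a<..b} = ennreal (b - a) / ennreal T"
    unfolding time_law_def using assms T by simp
  also have "\<dots> = ennreal ((b - a) / T)" using assms T by (simp add: divide_ennreal)
  finally show ?thesis using assms T by (simp add: measure_def)
qed

text \<open>The contribution of one point, with time s and mark y, to the joint character of the k
  increments with frequencies \<open>z i\<close>.\<close>

definition step_mark :: "nat \<Rightarrow> (nat \<Rightarrow> real) \<Rightarrow> (nat \<Rightarrow> 'a) \<Rightarrow> real \<Rightarrow> real \<times> real \<times> real \<times> 'a \<Rightarrow> complex" where
  "step_mark k \<tau> z s y = cis (\<Sum>i<k. indicator {\<tau> i<..\<tau> (Suc i)} (fst y) * (z i \<bullet> jump s (snd y)))"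

lemma step_mark_measurable:
  "(\<lambda>(s, y). step_mark k \<tau> z s y) \<in> borel_measurable (borel \<Otimes>\<^sub>M (time_law \<Otimes>\<^sub>M mark_law))"
  unfolding step_mark_def by measurable

text \<open>The windows are disjoint, so at most one summand of the exponent is nonzero. The
  character minus 1 is thereby additive over the windows, which is the source of the independence of
  increments.\<close>

lemma step_mark_eq:
  assumes mono: "\<forall>i<k. \<tau> i \<le> \<tau> (Suc i)"
  shows "step_mark k \<tau> z s y - 1 =
    (\<Sum>i<k. of_real (indicator {\<tau> i<..\<tau> (Suc i)} (fst y)) * (cis (z i \<bullet> jump s (snd y)) - 1))"
proof -
  have le: "\<tau> i \<le> \<tau> j" if "i \<le> j" "j \<le> k" for i j
    using that by (induction j rule: dec_induct) (auto intro: order_trans[OF _ mono[rule_format]])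
  show ?thesis
  proof (cases "\<exists>i<k. fst y \<in> {\<tau> i<..\<tau> (Suc i)}")
    case True
    then obtain i where i: "i < k" "fst y \<in> {\<tau> i<..\<tau> (Suc i)}" by auto
    have other: "fst y \<notin> {\<tau> j<..\<tau> (Suc j)}" if "j < k" "j \<noteq> i" for j
    proof (cases "j < i")
      case True
      then show ?thesis using le[of "Suc j" i] i by auto
    next
      case False
      then show ?thesis using le[of "Suc i" j] i that by auto
    qed
    have ind: "indicator {\<tau> j<..\<tau> (Suc j)} (fst y) = (if j = i then 1 else 0 :: real)" if "j < k" for j
      using i other[OF that] by (cases "j = i") (simp_all add: indicator_def del: greaterThanAtMost_iff)
    have "(\<Sum>j<k. indicator {\<tau> j<..\<tau> (Suc j)} (fst y) * (z j \<bullet> jump s (snd y))) =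
        (\<Sum>j<k. if j = i then z j \<bullet> jump s (snd y) else 0)"
      by (intro sum.cong refl) (simp add: ind)
    moreover have "(\<Sum>j<k. of_real (indicator {\<tau> j<..\<tau> (Suc j)} (fst y)) * (cis (z j \<bullet> jump s (snd y)) - 1)) =
        (\<Sum>j<k. if j = i then cis (z j \<bullet> jump s (snd y)) - 1 else 0)"
      by (intro sum.cong refl) (simp add: ind)
    ultimately show ?thesis unfolding step_mark_def using i(1) by simp
  next
    case False
    then have "indicator {\<tau> j<..\<tau> (Suc j)} (fst y) = (0 :: real)" if "j < k" for j
      using that by (auto simp: indicator_def)
    then show ?thesis unfolding step_mark_def by simp
  qed
qed

lemma integral_step_mark:
  assumes \<tau>: "0 \<le> \<tau> 0" "\<forall>i<k. \<tau> i \<le> \<tau> (Suc i)" "\<tau> k \<le> T"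
  shows "(\<integral>y. step_mark k \<tau> z s y \<partial>(time_law \<Otimes>\<^sub>M mark_law)) =
    1 + (\<Sum>i<k. of_real ((\<tau> (Suc i) - \<tau> i) / T) * jump_char (z i) s)"
proof -
  let ?N = "time_law \<Otimes>\<^sub>M mark_law"
  have le: "\<tau> i \<le> \<tau> j" if "i \<le> j" "j \<le> k" for i j
    using that by (induction j rule: dec_induct) (auto intro: order_trans[OF _ \<tau>(2)[rule_format]])
  let ?f = "\<lambda>i y. complex_of_real (indicator {\<tau> i<..\<tau> (Suc i)} (fst y)) * (cis (z i \<bullet> jump s (snd y)) - 1)"
  have fb: "norm (?f i y) \<le> 2" for i y
    using norm_cis_diff_1_le[of "z i \<bullet> jump s (snd y)"] by (auto simp: norm_mult indicator_def)
  have int: "integrable ?N (?f i)" for i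
    by (rule TK.P.integrable_const_bound[where B=2]) (use fb in auto)
  have f: "(\<integral>y. ?f i y \<partial>?N) = of_real ((\<tau> (Suc i) - \<tau> i) / T) * jump_char (z i) s" if "i < k" for i
  proof -
    have "(\<integral>y. ?f i y \<partial>?N) = (\<integral>t. (\<integral>w. ?f i (t, w) \<partial>mark_law) \<partial>time_law)"
      by (rule TK.integral_fst'[OF int, symmetric])
    also have "\<dots> = (\<integral>t. of_real (indicator {\<tau> i<..\<tau> (Suc i)} t) * jump_char (z i) s \<partial>time_law)"
      unfolding jump_char_def by simp
    also have "\<dots> = of_real (measure time_law {\<tau> i<..\<tau> (Suc i)}) * jump_char (z i) s"
      by (simp add: Tl.emeasure_eq_measure)
    also have "measure time_law {\<tau> i<..\<tau> (Suc i)} = (\<tau> (Suc i) - \<tau> i) / T"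
      using le[of 0 i] le[of "Suc i" k] \<tau> that by (intro measure_time_law_Ioc) auto
    finally show ?thesis .
  qed
  have "(\<integral>y. step_mark k \<tau> z s y \<partial>?N) = (\<integral>y. 1 + (\<Sum>i<k. ?f i y) \<partial>?N)"
    using step_mark_eq[of k \<tau> z s, OF \<tau>(2)] by (intro Bochner_Integration.integral_cong) (auto simp: algebra_simps)
  also have "\<dots> = 1 + (\<Sum>i<k. \<integral>y. ?f i y \<partial>?N)"
    using int TK.P.prob_space by (subst Bochner_Integration.integral_add) (auto simp: Bochner_Integration.integral_sum)
  also have "\<dots> = 1 + (\<Sum>i<k. of_real ((\<tau> (Suc i) - \<tau> i) / T) * jump_char (z i) s)"
    using f by simp
  finally show ?thesis .
qed

end

section \<open>The series and the joint law of its increments\<close>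

locale shot_noise = tempered_stable \<sigma> Qk p \<alpha> T + P: prob_space P
  for \<sigma> :: "'a::euclidean_space measure" and Qk and p \<alpha> T and P :: "'w measure" +
  fixes E E' Tt U :: "nat \<Rightarrow> 'w \<Rightarrow> real" and V :: "nat \<Rightarrow> 'w \<Rightarrow> 'a"
  assumes law: "\<And>j. distr P borel (\<lambda>\<omega>. (E j \<omega>, E' j \<omega>, Tt j \<omega>, U j \<omega>, V j \<omega>)) =
      std_exponential \<Otimes>\<^sub>M (std_exponential \<Otimes>\<^sub>M (time_law \<Otimes>\<^sub>M (uniform_measure lborel {0<..<1} \<Otimes>\<^sub>M V_law)))"
    and indep: "P.indep_vars (\<lambda>_. borel) (\<lambda>j \<omega>. (E j \<omega>, E' j \<omega>, Tt j \<omega>, U j \<omega>, V j \<omega>)) UNIV"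
begin

definition mark :: "nat \<Rightarrow> 'w \<Rightarrow> real \<times> real \<times> real \<times> 'a" where
  "mark j \<omega> = (Tt j \<omega>, E j \<omega>, U j \<omega>, V j \<omega>)"

sublocale marked_poisson P "time_law \<Otimes>\<^sub>M mark_law" E' mark
proof -
  let ?X = "\<lambda>j \<omega>. (E j \<omega>, E' j \<omega>, Tt j \<omega>, U j \<omega>, V j \<omega>)"
  let ?rot = "\<lambda>(a, b, c, r). (b, c, a, r)"
  let ?U = "uniform_measure lborel {0<..<1::real}"
  let ?N = "time_law \<Otimes>\<^sub>M mark_law"
  interpret U: prob_space ?U by (rule prob_space_unit_uniform)
  interpret UV: pair_prob_space ?U V_law ..
  have "?rot \<in> (borel :: real measure) \<Otimes>\<^sub>M ((borel :: real measure) \<Otimes>\<^sub>M ((borel :: real measure) \<Otimes>\<^sub>M ((borel :: real measure) \<Otimes>\<^sub>M (borel :: 'a measure)))) \<rightarrow>\<^sub>M borel \<Otimes>\<^sub>M ?N"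
    by measurable
  then have rot: "?rot \<in> (borel :: (real \<times> real \<times> real \<times> real \<times> 'a) measure) \<rightarrow>\<^sub>M borel \<Otimes>\<^sub>M ?N"
    by (simp add: borel_prod)
  have X: "?X j \<in> P \<rightarrow>\<^sub>M borel" for j
    using indep by (auto simp: P.indep_vars_def)
  have rotX: "?rot (?X j \<omega>) = (E' j \<omega>, mark j \<omega>)" for j \<omega>
    unfolding mark_def by simp
  show "marked_poisson P ?N E' mark"
  proof unfold_locales
    show "P.indep_vars (\<lambda>_. borel \<Otimes>\<^sub>M ?N) (\<lambda>j \<omega>. (E' j \<omega>, mark j \<omega>)) UNIV"
      using P.indep_vars_compose2[OF indep rot] unfolding rotX .
    fix j
    have "distr P (borel \<Otimes>\<^sub>M ?N) (\<lambda>\<omega>. (E' j \<omega>, mark j \<omega>)) = distr (distr P borel (?X j)) (borel \<Otimes>\<^sub>M ?N) ?rot"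
      by (subst distr_distr[OF rot X]) (simp add: o_def mark_def)
    also have "\<dots> = distr (std_exponential \<Otimes>\<^sub>M (std_exponential \<Otimes>\<^sub>M (time_law \<Otimes>\<^sub>M (?U \<Otimes>\<^sub>M V_law))))
        (std_exponential \<Otimes>\<^sub>M (time_law \<Otimes>\<^sub>M (std_exponential \<Otimes>\<^sub>M (?U \<Otimes>\<^sub>M V_law)))) ?rot"
      unfolding law mark_law_def by (rule distr_cong) (auto intro!: sets_pair_measure_cong)
    also have "\<dots> = std_exponential \<Otimes>\<^sub>M ?N"
      unfolding mark_law_def
      by (rule distr_pair_move_first)
         (intro prob_space_imp_sigma_finite prob_space_std_exponential prob_space_time_law UV.P.prob_space_axioms)+
    finally show "distr P (borel \<Otimes>\<^sub>M ?N) (\<lambda>\<omega>. (E' j \<omega>, mark j \<omega>)) = std_exponential \<Otimes>\<^sub>M ?N" .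
  qed
qed

text \<open>The uncentered increment over the window (a, b].\<close>

definition shot :: "nat \<Rightarrow> real \<Rightarrow> real \<Rightarrow> 'w \<Rightarrow> 'a" where
  "shot n a b \<omega> = (\<Sum>j\<in>{j. Gam E' j \<omega> \<le> T * real n}.
      indicator {a<..b} (Tt j \<omega>) *\<^sub>R jump (Gam E' j \<omega>) (E j \<omega>, U j \<omega>, V j \<omega>))"

lemma shot_measurable [measurable]: "shot n a b \<in> borel_measurable P"
proof -
  have m[measurable]: "mark j \<in> P \<rightarrow>\<^sub>M (borel \<Otimes>\<^sub>M (borel \<Otimes>\<^sub>M (borel \<Otimes>\<^sub>M borel)))" for j
  proof -
    have "sets (time_law \<Otimes>\<^sub>M mark_law) = sets (borel \<Otimes>\<^sub>M (borel \<Otimes>\<^sub>M (borel \<Otimes>\<^sub>M borel)))"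
      by (intro sets_pair_measure_cong) auto
    then show ?thesis using measurable_Y[of j] by (simp cong: measurable_cong_sets)
  qed
  have "shot n a b = (\<lambda>\<omega>. \<Sum>j\<in>{j. Gam E' j \<omega> \<le> T * real n}.
      indicator {a<..b} (fst (mark j \<omega>)) *\<^sub>R jump (Gam E' j \<omega>) (snd (mark j \<omega>)))"
    unfolding shot_def mark_def by simp
  also have "\<dots> \<in> borel_measurable P"
    by (intro borel_measurable_random_sum) measurable
  finally show ?thesis .
qed

lemma prod_cis: "(\<Prod>j\<in>A. cis (f j)) = cis (\<Sum>j\<in>A. f j)"
  by (induction A rule: infinite_finite_induct) (auto simp: cis_mult)

text \<open>This holds for every outcome: if infinitely many arrival times are at most Tn, the
  default values 1 of the product and 0 of the sum still match.\<close>

lemma prod_step_mark: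
  "(\<Prod>j\<in>{j. Gam E' j \<omega> \<le> T * real n}. step_mark k \<tau> z (Gam E' j \<omega>) (mark j \<omega>)) =
    cis (\<Sum>i<k. z i \<bullet> shot n (\<tau> i) (\<tau> (Suc i)) \<omega>)"
  unfolding step_mark_def prod_cis shot_def inner_sum_right inner_scaleR_right mark_def
  by (subst sum.swap) simp

text \<open>The mean of \<open>step_mark\<close> minus 1 is a sum over the windows, so the Poisson
  exponent is a sum of compound Poisson exponents.\<close>

lemma char_shots:
  assumes \<tau>: "0 \<le> \<tau> 0" "\<forall>i<k. \<tau> i \<le> \<tau> (Suc i)" "\<tau> k \<le> T"
  shows "(\<integral>\<omega>. cis (\<Sum>i<k. z i \<bullet> shot n (\<tau> i) (\<tau> (Suc i)) \<omega>) \<partial>P) =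
    exp (\<Sum>i<k. of_real (\<tau> (Suc i) - \<tau> i) * (\<integral>x. cis (z i \<bullet> x) - 1 \<partial>Mn n))"
proof -
  let ?N = "time_law \<Otimes>\<^sub>M mark_law"
  let ?I = "{0..T * real n}"
  note mean = integral_step_mark[where \<tau>=\<tau> and k=k and z=z, OF \<tau>]
  have int: "set_integrable lborel ?I (jump_char (z i))" for i
    by (rule set_integrable_bounded_Icc[where C=2]) (use norm_jump_char_le in auto)
  have "(\<integral>\<omega>. cis (\<Sum>i<k. z i \<bullet> shot n (\<tau> i) (\<tau> (Suc i)) \<omega>) \<partial>P) =
      poisson_exponent (T * real n) (\<lambda>s. \<integral>y. step_mark k \<tau> z s y \<partial>?N) 0"
    unfolding prod_step_mark[symmetric]
  proof (rule expectation_prod_marks[OF step_mark_measurable])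
    show "norm (step_mark k \<tau> z s y) \<le> 1" for s y unfolding step_mark_def by simp
    show "continuous_on {0<..} (\<lambda>s. \<integral>y. step_mark k \<tau> z s y \<partial>?N)"
      unfolding mean by (intro continuous_intros jump_char_continuous)
    show "0 \<le> T * real n" using T by simp
  qed
  also have "\<dots> = exp (LINT s:?I|lborel. (\<Sum>i<k. of_real ((\<tau> (Suc i) - \<tau> i) / T) * jump_char (z i) s))"
    unfolding poisson_exponent_def mean by simp
  also have "(LINT s:?I|lborel. (\<Sum>i<k. of_real ((\<tau> (Suc i) - \<tau> i) / T) * jump_char (z i) s)) =
      (\<Sum>i<k. of_real ((\<tau> (Suc i) - \<tau> i) / T) * (LINT s:?I|lborel. jump_char (z i) s))"
  proof -
    have "(LINT s:?I|lborel. (\<Sum>i<k. of_real ((\<tau> (Suc i) - \<tau> i) / T) * jump_char (z i) s)) =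
        (\<Sum>i<k. (LINT s:?I|lborel. of_real ((\<tau> (Suc i) - \<tau> i) / T) * jump_char (z i) s))"
      using int unfolding set_lebesgue_integral_def set_integrable_def scaleR_sum_right mult_scaleR_right[symmetric]
      by (intro Bochner_Integration.integral_sum integrable_mult_right)
    then show ?thesis by (simp only: set_integral_mult_right)
  qed
  also have "\<dots> = (\<Sum>i<k. of_real (\<tau> (Suc i) - \<tau> i) * (\<integral>x. cis (z i \<bullet> x) - 1 \<partial>Mn n))"
    unfolding char_exponent_Mn by simp
  finally show ?thesis .
qed

lemma char_shot:
  assumes "0 \<le> a" "a \<le> b" "b \<le> T"
  shows "(\<integral>\<omega>. cis (z \<bullet> shot n a b \<omega>) \<partial>P) = exp (of_real (b - a) * (\<integral>x. cis (z \<bullet> x) - 1 \<partial>Mn n))"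
  using char_shots[of "\<lambda>i. if i = 0 then a else b" 1 "\<lambda>_. z" n] assms by simp

text \<open>The exponential of the sum in \<open>char_shots\<close> is the product of the individual
  characteristic functions, as the factorization criterion asks.\<close>

lemma indep_shots:
  assumes \<tau>: "0 \<le> \<tau> 0" "\<forall>i<k. \<tau> i \<le> \<tau> (Suc i)" "\<tau> k \<le> T"
  shows "P.indep_vars (\<lambda>_. borel) (\<lambda>i. shot n (\<tau> i) (\<tau> (Suc i))) {..<k}"
proof (rule P.indep_vars_if_char_prod)
  fix z :: "nat \<Rightarrow> 'a"
  have le: "\<tau> i \<le> \<tau> j" if "i \<le> j" "j \<le> k" for i j
    using that by (induction j rule: dec_induct) (auto intro: order_trans[OF _ \<tau>(2)[rule_format]])
  have "(\<Prod>i<k. \<integral>\<omega>. cis (z i \<bullet> shot n (\<tau> i) (\<tau> (Suc i)) \<omega>) \<partial>P) =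
      (\<Prod>i<k. exp (of_real (\<tau> (Suc i) - \<tau> i) * (\<integral>x. cis (z i \<bullet> x) - 1 \<partial>Mn n)))"
  proof (intro prod.cong refl char_shot)
    fix i assume "i \<in> {..<k}"
    then show "0 \<le> \<tau> i" "\<tau> i \<le> \<tau> (Suc i)" "\<tau> (Suc i) \<le> T"
      using le[of 0 i] le[of "Suc i" k] \<tau> by auto
  qed
  then show "(\<integral>\<omega>. cis (\<Sum>i<k. z i \<bullet> shot n (\<tau> i) (\<tau> (Suc i)) \<omega>) \<partial>P) =
      (\<Prod>i<k. \<integral>\<omega>. cis (z i \<bullet> shot n (\<tau> i) (\<tau> (Suc i)) \<omega>) \<partial>P)"
    unfolding char_shots[OF \<tau>] by (simp add: exp_sum)
qed auto

section \<open>Centering, paths and the Levy property\<close>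

abbreviation process :: "nat \<Rightarrow> real \<Rightarrow> 'w \<Rightarrow> 'a" where
  "process n \<equiv> Lproc P sn T \<alpha> p n E E' Tt U V"

definition centering :: "nat \<Rightarrow> 'a" where
  "centering n = (\<integral>\<omega>'. (\<Sum>j\<in>{j. Gam E' j \<omega>' \<le> T * real n}.
      Hfun sn T \<alpha> p (Gam E' j \<omega>') (V j \<omega>') (E j \<omega>') (U j \<omega>')) \<partial>P)"

lemma process_eq: "process n t \<omega> = shot n 0 t \<omega> - (t / T) *\<^sub>R centering n"
  unfolding Lproc_def Lsum_def shot_def jump_def centering_def by simp

lemma process_increment:
  assumes "0 \<le> s" "s \<le> t"
  shows "process n t \<omega> - process n s \<omega> = shot n s t \<omega> - ((t - s) / T) *\<^sub>R centering n"
proof -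
  have "shot n 0 t \<omega> = shot n 0 s \<omega> + shot n s t \<omega>"
    unfolding shot_def sum.distrib[symmetric] scaleR_left_distrib[symmetric]
    using assms by (intro sum.cong refl) (auto simp: indicator_def)
  moreover have "((t - s) / T) *\<^sub>R centering n = (t / T) *\<^sub>R centering n - (s / T) *\<^sub>R centering n"
    by (simp add: diff_divide_distrib scaleR_left_diff_distrib)
  ultimately show ?thesis unfolding process_eq by simp
qed

lemma tendsto_shot_right: "((\<lambda>s. shot n 0 s \<omega>) \<longlongrightarrow> shot n 0 t \<omega>) (at_right t)"
  unfolding shot_def
proof (intro tendsto_sum tendsto_scaleR tendsto_const tendsto_eventually)
  fix j
  let ?x = "Tt j \<omega>"
  show "\<forall>\<^sub>F s in at_right t. (indicator {0<..s} ?x :: real) = indicator {0<..t} ?x"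
  proof (cases "?x \<le> t")
    case True
    \<comment> \<open>Times s > t keep a point at or before t inside the window; that the window is
      closed on the right makes the path right continuous.\<close>
    then show ?thesis by (auto simp: eventually_at_filter indicator_def)
  next
    case False
    then have "\<forall>\<^sub>F s in at_right t. s < ?x" by (intro order_tendstoD(2)[OF tendsto_ident_at]) simp
    then show ?thesis by eventually_elim (use False in \<open>auto simp: indicator_def\<close>)
  qed
qed

text \<open>The left limit is the sum over the open window (0, t), which drops any jump at time t
  itself.\<close>

lemma tendsto_shot_left: "\<exists>l. ((\<lambda>s. shot n 0 s \<omega>) \<longlongrightarrow> l) (at_left t)"
proof
  show "((\<lambda>s. shot n 0 s \<omega>) \<longlongrightarrow> (\<Sum>j\<in>{j. Gam E' j \<omega> \<le> T * real n}.
      indicator {0<..<t} (Tt j \<omega>) *\<^sub>R jump (Gam E' j \<omega>) (E j \<omega>, U j \<omega>, V j \<omega>))) (at_left t)"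
    unfolding shot_def
  proof (intro tendsto_sum tendsto_scaleR tendsto_const tendsto_eventually)
    fix j
    let ?x = "Tt j \<omega>"
    show "\<forall>\<^sub>F s in at_left t. (indicator {0<..s} ?x :: real) = indicator {0<..<t} ?x"
    proof (cases "t \<le> ?x")
      case True
      then show ?thesis by (auto simp: eventually_at_filter indicator_def)
    next
      case False
      then have "\<forall>\<^sub>F s in at_left t. ?x < s" by (intro order_tendstoD(1)[OF tendsto_ident_at]) simp
      then show ?thesis by eventually_elim (use False in \<open>auto simp: indicator_def\<close>)
    qed
  qed
qed

theorem compound_poisson_process: "compound_poisson_process P T (process n) (Mn n) (- (centering n /\<^sub>R T))"
  unfolding compound_poisson_process_def
proof (intro conjI allI ballI impI)
  show "process n t \<in> borel_measurable P" for t
    unfolding process_eq[abs_def] by measurable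
  show "AE \<omega> in P. process n 0 \<omega> = 0"
    unfolding process_eq by (simp add: shot_def)
  show "AE \<omega> in P. (\<forall>t\<in>{0..<T}. ((\<lambda>s. process n s \<omega>) \<longlongrightarrow> process n t \<omega>) (at_right t)) \<and>
      (\<forall>t\<in>{0<..T}. \<exists>l. ((\<lambda>s. process n s \<omega>) \<longlongrightarrow> l) (at_left t))"
  proof (intro AE_I2 conjI ballI)
    fix \<omega> t
    show "((\<lambda>s. process n s \<omega>) \<longlongrightarrow> process n t \<omega>) (at_right t)"
      unfolding process_eq using T by (intro tendsto_intros tendsto_shot_right) auto
    obtain l where "((\<lambda>s. shot n 0 s \<omega>) \<longlongrightarrow> l) (at_left t)" using tendsto_shot_left by blast
    then have "((\<lambda>s. process n s \<omega>) \<longlongrightarrow> l - (t / T) *\<^sub>R centering n) (at_left t)"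
      unfolding process_eq using T by (intro tendsto_intros) auto
    then show "\<exists>l. ((\<lambda>s. process n s \<omega>) \<longlongrightarrow> l) (at_left t)" by blast
  qed
  show "P.indep_vars (\<lambda>_. borel) (\<lambda>i \<omega>. process n (\<tau> (Suc i)) \<omega> - process n (\<tau> i) \<omega>) {..<k}"
    if "0 \<le> \<tau> 0 \<and> (\<forall>i<k. \<tau> i \<le> \<tau> (Suc i)) \<and> \<tau> k \<le> T" for k and \<tau> :: "nat \<Rightarrow> real"
  proof -
    have \<tau>: "0 \<le> \<tau> 0" "\<forall>i<k. \<tau> i \<le> \<tau> (Suc i)" "\<tau> k \<le> T" using that by auto
    have pos: "0 \<le> \<tau> i" if "i \<le> k" for i
      using that by (induction i) (auto intro: order_trans[OF _ \<tau>(2)[rule_format]] \<tau>(1))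
    \<comment> \<open>Centering subtracts a constant from each increment and so preserves
      independence.\<close>
    have "P.indep_vars (\<lambda>_. borel) (\<lambda>i \<omega>. shot n (\<tau> i) (\<tau> (Suc i)) \<omega> - ((\<tau> (Suc i) - \<tau> i) / T) *\<^sub>R centering n) {..<k}"
      by (rule P.indep_vars_compose2[OF indep_shots[OF \<tau>]]) auto
    then show ?thesis
      by (rule P.indep_vars_cong[THEN iffD1, rotated -1]) (auto simp: fun_eq_iff process_increment pos \<tau>(2)[rule_format])
  qed
  show "(\<integral>\<omega>. cis (z \<bullet> (process n t \<omega> - process n s \<omega>)) \<partial>P) =
      exp (complex_of_real (t - s) * ((\<integral>x. (cis (z \<bullet> x) - 1) \<partial>Mn n) +
        \<i> * complex_of_real (z \<bullet> - (centering n /\<^sub>R T))))"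
    if "0 \<le> s \<and> s \<le> t \<and> t \<le> T" for s t z
  proof -
    have st: "0 \<le> s" "s \<le> t" "t \<le> T" using that by auto
    \<comment> \<open>The centering contributes a deterministic phase linear in t - s, hence the
      drift \<open>- (centering n /\<^sub>R T)\<close>.\<close>
    let ?d = "- (z \<bullet> (((t - s) / T) *\<^sub>R centering n))"
    have "(\<integral>\<omega>. cis (z \<bullet> (process n t \<omega> - process n s \<omega>)) \<partial>P) = (\<integral>\<omega>. cis (z \<bullet> shot n s t \<omega>) * cis ?d \<partial>P)"
      unfolding process_increment[OF st(1,2)] by (simp add: inner_diff_right cis_mult)
    also have "\<dots> = (\<integral>\<omega>. cis (z \<bullet> shot n s t \<omega>) \<partial>P) * cis ?d" by simp
    also have "\<dots> = exp (of_real (t - s) * (\<integral>x. cis (z \<bullet> x) - 1 \<partial>Mn n) + \<i> * of_real ?d)"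
      unfolding char_shot[OF st] exp_add cis_conv_exp[of ?d] ..
    also have "\<i> * of_real ?d = of_real (t - s) * (\<i> * complex_of_real (z \<bullet> - (centering n /\<^sub>R T)))"
      by (simp add: divide_inverse mult_ac)
    finally show ?thesis by (simp only: distrib_left)
  qed
qed (auto intro: P.prob_space_axioms finite_measure_Mn emeasure_Mn_0)

end

theorem mainTheorem3:
  fixes P :: "'w measure" and \<sigma> :: "'a::euclidean_space measure" and Qk :: "'a \<Rightarrow> real measure"
    and p \<alpha> T :: real
    and E E' Tt U :: "nat \<Rightarrow> 'w \<Rightarrow> real" and V :: "nat \<Rightarrow> 'w \<Rightarrow> 'a"
  assumes P: "prob_space P"
    and p: "0 < p" and \<alpha>: "0 < \<alpha>" "\<alpha> < 2" and T: "0 < T"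
    and \<sigma>fin: "finite_measure \<sigma>" and \<sigma>sets: "sets \<sigma> = sets borel"
    and \<sigma>sphere: "emeasure \<sigma> (UNIV - sphere 0 1) = 0"
    and \<sigma>nz: "emeasure \<sigma> UNIV \<noteq> 0"
    and Qmeas: "Qk \<in> borel \<rightarrow>\<^sub>M prob_algebra borel"
    and Qpos: "\<forall>u. emeasure (Qk u) {..0} = 0"
    and law: "\<forall>j. distr P borel (\<lambda>\<omega>. (E j \<omega>, E' j \<omega>, Tt j \<omega>, U j \<omega>, V j \<omega>)) =
               density lborel (exponential_density 1) \<Otimes>\<^sub>M
               (density lborel (exponential_density 1) \<Otimes>\<^sub>M
               (uniform_measure lborel {0<..<T} \<Otimes>\<^sub>M
               (uniform_measure lborel {0<..<1} \<Otimes>\<^sub>M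
                scale_measure (ennreal (1 / measure \<sigma> UNIV)) (Qmeas \<sigma> Qk))))"
    and indep: "prob_space.indep_vars P (\<lambda>_. borel)
                  (\<lambda>j \<omega>. (E j \<omega>, E' j \<omega>, Tt j \<omega>, U j \<omega>, V j \<omega>)) UNIV"
  shows "\<exists>Mn :: nat \<Rightarrow> 'a measure.
           (\<forall>n. (\<exists>b. compound_poisson_process P T
                        (Lproc P (measure \<sigma> UNIV) T \<alpha> p n E E' Tt U V) (Mn n) b) \<and>
                (\<forall>x B. 0 < x \<and> B \<in> sets borel \<and> B \<subseteq> sphere 0 1 \<longrightarrow>
                   emeasure (Mn n) (radial_set x B) =
                     ennreal (min (real n * \<alpha> / measure \<sigma> UNIV * x powr \<alpha>) 1)
                     * emeasure (levyM p \<alpha> \<sigma> Qk) (radial_set x B))) \<and>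
           levy_measures_converge Mn (levyM p \<alpha> \<sigma> Qk)"
proof -
  interpret prob_space P by (rule P)
  interpret tempered_stable \<sigma> Qk p \<alpha> T
    by (rule tempered_stable.intro) (fact p \<alpha>(1) T \<sigma>fin \<sigma>sets \<sigma>sphere \<sigma>nz Qmeas Qpos)+
  interpret shot_noise \<sigma> Qk p \<alpha> T P E E' Tt U V
    by unfold_locales (use law indep in \<open>simp_all add: time_law_def V_law_def\<close>)
  \<comment> \<open>The witness is the intensity measure \<open>Mn\<close>, with the drift coming
    from the centering.\<close>
  show ?thesis
    using compound_poisson_process emeasure_Mn_radial_set levy_measures_converge_Mn by blast
qed

end
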